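(* Assume (H1) and (H2), where the constant $L$ in (H2) satisfies $Me^{2LT}<1$, $M>0$ being a constant such that $\mathbb{E}|X^x_T|^2\le Me^{2LT}(1+|x|^2)$ for all $x\in\mathbb{R}^d$ (such an $M$, independent of $x$ and $L$, exists under (H1)–(H2)). Then the discrete-time semigroup $(P^n_T)_{n\ge1}$ has a unique invariant probability measure $\mu$, i.e. a unique probability measure $\mu$ on $\mathbb{R}^d$ with $\int P_T f\,d\mu=\int f\,d\mu$ for all $f\in\mathscr{B}_b(\mathbb{R}^d)$.
   Context: Fix $T>0$, $H\in(1/2,1)$; $B^H$ is a $d$-dimensional fractional Brownian motion with Hurst parameter $H$. Consider $dX_t=b(t,X_t)dt+\sigma(t)dB^H_t$, $X_0=x\in\mathbb{R}^d$, $t\in[0,T]$, with $b:[0,T]\times\mathbb{R}^d\to\mathbb{R}^d$ and $\sigma:[0,T]\to$ invertible $d\times d$ matrices (pathwise Young integral); $X^x_t$ denotes the unique solution. Assumption (H1): (i) there is $K>0$ with $|b(t,x)-b(t,y)|\le K|x-y|$ for all $t,x,y$, and $t\mapsto b(t,x)$ is Lipschitz for each $x$; (ii) $\sigma$ is bounded and $|\sigma^{-1}(t)-\sigma^{-1}(s)|\le\bar K|t-s|^{\alpha_0}$ for some $\bar K\ge0$, $\alpha_0\in(H-1/2,1]$. Assumption (H2): there is $L\in\mathbb{R}$ with $\langle x,b(t,x)\rangle\le L|x|^2$ for all $t\in[0,T]$, $x\in\mathbb{R}^d$. $\mathscr{B}_b(\mathbb{R}^d)$ denotes the bounded Borel functions.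 Define the kernel $P_T(x,A)=\mathbb{P}(X^x_T\in A)$ for Borel $A\subset\mathbb{R}^d$, and $P^n_T(x,A)=\int_{\mathbb{R}^d}P^{n-1}_T(x,dy)P_T(y,A)$ for $n\ge2$; $P^n_Tf(x)=\int f(y)P^n_T(x,dy)$. *)

theory Defs
  imports "HOL-Probability.Probability"
begin

definition fbm_cov :: "real \<Rightarrow> real \<Rightarrow> real \<Rightarrow> real" where
  "fbm_cov H s t = ((s powr (2*H)) + (t powr (2*H)) - (\<bar>t - s\<bar> powr (2*H))) / 2"

text \<open>B is a d-dimensional fractional Brownian motion with Hurst index H on the probability
  space M (components independent one-dimensional fBms), with continuous sample paths.
  Gaussianity and covariance are expressed via all finite linear combinations
  (Cramer-Wold): each is a centred normal variable with the prescribed variance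
  (a variance-0 normal variable being the constant 0).\<close>
definition fBm :: "'a measure \<Rightarrow> real \<Rightarrow> (real \<Rightarrow> 'a \<Rightarrow> real^'d) \<Rightarrow> bool" where
  "fBm M H B \<longleftrightarrow>
     prob_space M \<and>
     (\<forall>t\<ge>0. B t \<in> borel_measurable M) \<and>
     (\<forall>\<omega>\<in>space M. continuous_on {0..} (\<lambda>t. B t \<omega>)) \<and>
     (\<forall>ps :: (real \<times> (real^'d)) list. (\<forall>p\<in>set ps. 0 \<le> fst p) \<longrightarrow>
        (let Y = (\<lambda>\<omega>. \<Sum>p\<leftarrow>ps. snd p \<bullet> B (fst p) \<omega>);
             v = (\<Sum>p\<leftarrow>ps. \<Sum>q\<leftarrow>ps. (snd p \<bullet> snd q) * fbm_cov H (fst p) (fst q))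
         in if v = 0 then (AE \<omega> in M. Y \<omega> = 0)
            else distributed M lborel Y (\<lambda>y. ennreal (normal_density 0 (sqrt v) y))))"

definition has_RS_integral ::
  "(real \<Rightarrow> real^'d^'d) \<Rightarrow> (real \<Rightarrow> real^'d) \<Rightarrow> real \<Rightarrow> real \<Rightarrow> real^'d \<Rightarrow> bool" where
  "has_RS_integral f g a b I \<longleftrightarrow>
     (\<forall>\<epsilon>>0. \<exists>\<delta>>0. \<forall>(n::nat) (t::nat \<Rightarrow> real) (\<tau>::nat \<Rightarrow> real).
        t 0 = a \<and> t n = b \<and>
        (\<forall>i<n. t i < t (Suc i) \<and> t (Suc i) - t i < \<delta> \<and> t i \<le> \<tau> i \<and> \<tau> i \<le> t (Suc i))
        \<longrightarrow> norm ((\<Sum>i<n. f (\<tau> i) *v (g (t (Suc i)) - g (t i))) - I) < \<epsilon>)"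

definition is_solution ::
  "'a measure \<Rightarrow> real \<Rightarrow> (real \<Rightarrow> real^'d \<Rightarrow> real^'d) \<Rightarrow> (real \<Rightarrow> real^'d^'d)
    \<Rightarrow> (real \<Rightarrow> 'a \<Rightarrow> real^'d) \<Rightarrow> real^'d \<Rightarrow> (real \<Rightarrow> 'a \<Rightarrow> real^'d) \<Rightarrow> bool" where
  "is_solution M T b \<sigma> B x Y \<longleftrightarrow>
     (\<forall>t\<in>{0..T}. Y t \<in> borel_measurable M) \<and>
     (AE \<omega> in M. continuous_on {0..T} (\<lambda>t. Y t \<omega>) \<and>
        (\<forall>t\<in>{0..T}. has_RS_integral \<sigma> (\<lambda>s. B s \<omega>) 0 t
                        (Y t \<omega> - x - integral {0..t} (\<lambda>s. b s (Y s \<omega>)))))"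

definition PT_kernel :: "'a measure \<Rightarrow> (real^'d \<Rightarrow> real \<Rightarrow> 'a \<Rightarrow> real^'d) \<Rightarrow> real
    \<Rightarrow> real^'d \<Rightarrow> (real^'d) measure" where
  "PT_kernel M X T x = distr M borel (X x T)"

definition PT_op :: "'a measure \<Rightarrow> (real^'d \<Rightarrow> real \<Rightarrow> 'a \<Rightarrow> real^'d) \<Rightarrow> real
    \<Rightarrow> (real^'d \<Rightarrow> real) \<Rightarrow> real^'d \<Rightarrow> real" where
  "PT_op M X T f x = (\<integral>y. f y \<partial>(PT_kernel M X T x))"

end

theory Submission
  imports Defs "HOL-Real_Asymp.Real_Asymp"
begin

text \<open>
  By the moment bound, \<open>V x = (norm x)\<^sup>2\<close> is a Lyapunov function of the kernel, so Harris' theorem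
  yields existence and uniqueness once the kernel is minorized, uniformly for \<open>x\<close> in a ball, by a
  multiple of Lebesgue measure on the unit ball.

  For the minorization, let \<open>G = B T - 2 B (T - e) + B (T - 2 e)\<close> and write
  \<open>B t = R t + \<phi> t G\<close> with \<open>R\<close> independent of \<open>G\<close>. For small \<open>e\<close> the deterministic
  \<open>\<phi>\<close> only varies near \<open>T\<close>, where neither the drift nor the variation of \<open>\<sigma>\<close> has time to
  act: for fixed \<open>R\<close>, the solution at time \<open>T\<close> is a Lipschitz perturbation of
  \<open>g \<mapsto> \<phi> T \<cdot> \<sigma> T g\<close> with small Lipschitz constant, hence a bi-Lipschitz map of
  the Gaussian vector \<open>G\<close>. The solution is handled as a limit of Euler schemes,
  which depend on finitely many values of the noise only.
\<close>

section \<open>Harris' theorem\<close>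

text \<open>The obstacle is that \<open>X x\<close> is only known to solve the equation almost
  surely along \<open>B\<close> itself, with a null set depending on \<open>x\<close>. Replacing the
  value of G by an arbitrary g changes the path, and nothing is assumed about solutions along the
  changed path. Euler schemes exist for every path and every g, depend on x and g with Lipschitz
  constants free of the step size, and converge almost surely to the solution at T. All estimates
  are proved for them and survive the limit. The relative size matters: as e tends to 0, \<phi> T
  tends to a nonzero constant, while the errors caused by the drift and by freezing \<sigma> at T
  tend to 0. So the expansion constant can be fixed first and e afterwards; that the variance of G
  shrinks with e does no harm. The minorization uses no Jacobian. If F is onto and bi-Lipschitz, the
  preimage of the unit ball lies in a fixed ball, where the Gaussian density is bounded below, and
  the volume of a set is at most a constant times that of its preimage.\<close>

definition markov_op :: "('a \<Rightarrow> 'a measure) \<Rightarrow> ('a \<Rightarrow> real) \<Rightarrow> 'a \<Rightarrow> real" where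
  "markov_op K f x = (\<integral>y. f y \<partial>K x)"

text \<open>Every \<open>f z - W z\<close> lies below every \<open>f x + W x\<close>, so the
  supremum of the former separates the two families. This replaces a bound on differences, the form
  that contracts, by a bound on the single function \<open>f - c\<close>, the form that can be
  integrated against one measure.\<close>

lemma center_of_weighted_oscillation:
  fixes f W :: "'a \<Rightarrow> real"
  assumes "\<And>x y. \<bar>f x - f y\<bar> \<le> W x + W y"
  obtains c where "\<And>x. \<bar>f x - c\<bar> \<le> W x"
proof
  fix x
  have le: "f z - W z \<le> f x + W x" for z
    using assms[of z x] by linarith
  have bdd: "bdd_above (range (\<lambda>z. f z - W z))"
    by (rule bdd_aboveI2[OF le])
  have "f x - W x \<le> (SUP z. f z - W z)"
    by (rule cSUP_upper[OF _ bdd]) simp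
  moreover have "(SUP z. f z - W z) \<le> f x + W x"
    by (rule cSUP_least) (auto intro: le)
  ultimately show "\<bar>f x - (SUP z. f z - W z)\<bar> \<le> W x"
    by linarith
qed

section \<open>Iterates of a Markov kernel on bounded measurable functions\<close>

locale markov_kernel =
  fixes N :: "'a measure" and K :: "'a \<Rightarrow> 'a measure"
  assumes space_N: "space N = UNIV"
    and kernel: "K \<in> N \<rightarrow>\<^sub>M prob_algebra N"
begin

abbreviation iter :: "nat \<Rightarrow> ('a \<Rightarrow> real) \<Rightarrow> 'a \<Rightarrow> real" where
  "iter n \<equiv> markov_op K ^^ n"

lemma prob_space_kernel: "prob_space (K x)"
  and sets_kernel [measurable_cong]: "sets (K x) = sets N"
  using measurable_space[OF kernel, of x] by (auto simp: space_N space_prob_algebra)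

lemma integrable_kernel:
  fixes f :: "'a \<Rightarrow> real"
  assumes "f \<in> borel_measurable N" "\<And>x. \<bar>f x\<bar> \<le> c"
  shows "integrable (K x) f"
proof -
  interpret prob_space "K x" by (rule prob_space_kernel)
  show ?thesis
    by (rule integrable_const_bound[of _ c])
       (use assms measurable_cong_sets[OF sets_kernel refl] in auto)
qed

lemma markov_op_measurable:
  assumes "f \<in> borel_measurable N"
  shows "markov_op K f \<in> borel_measurable N"
  unfolding markov_op_def
  using measurable_compose[OF measurable_prob_algebraD[OF kernel]
      integral_measurable_subprob_algebra[OF assms]] .

lemma markov_op_bound:
  assumes "f \<in> borel_measurable N" "\<And>x. \<bar>f x\<bar> \<le> c"
  shows "\<bar>markov_op K f x\<bar> \<le> c"
proof -
  interpret prob_space "K x" by (rule prob_space_kernel)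
  have "\<bar>markov_op K f x\<bar> \<le> (\<integral>y. \<bar>f y\<bar> \<partial>K x)"
    unfolding markov_op_def by (rule integral_abs_bound)
  also have "\<dots> \<le> (\<integral>y. c \<partial>K x)"
    using integrable_kernel[OF assms] assms(2) by (intro integral_mono) auto
  finally show ?thesis by (simp add: prob_space)
qed

lemma iterate_Suc: "iter (Suc n) f x = (\<integral>y. iter n f y \<partial>K x)"
  by (simp add: markov_op_def[of K "iter n f"])

lemma iterate_measurable:
  "f \<in> borel_measurable N \<Longrightarrow> iter n f \<in> borel_measurable N"
  by (induction n) (auto intro: markov_op_measurable)

lemma iterate_bound:
  assumes "f \<in> borel_measurable N" "\<And>x. \<bar>f x\<bar> \<le> c"
  shows "\<bar>iter n f x\<bar> \<le> c"
  by (induction n arbitrary: x)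
     (auto intro: assms markov_op_bound iterate_measurable)

text \<open>Dominated convergence, once per application of the kernel. It becomes the
  \<sigma>-continuity of the limit functional in \<open>limit_functional_tendsto\<close>.\<close>

lemma iterate_tendsto:
  assumes "\<And>i. F i \<in> borel_measurable N" "f \<in> borel_measurable N"
    and "\<And>i x. \<bar>F i x\<bar> \<le> c" "\<And>x. (\<lambda>i. F i x) \<longlonglongrightarrow> f x"
  shows "(\<lambda>i. iter n (F i) x) \<longlonglongrightarrow> iter n f x"
proof (induction n arbitrary: x)
  case 0
  show ?case using assms by simp
next
  case (Suc n)
  interpret prob_space "K x" by (rule prob_space_kernel)
  have "(\<lambda>i. integral\<^sup>L (K x) (iter n (F i))) \<longlonglongrightarrow> integral\<^sup>L (K x) (iter n f)"
    by (rule integral_dominated_convergence[where w="\<lambda>_. c"])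
       (use Suc iterate_measurable[OF assms(1)] iterate_measurable[OF assms(2)]
          iterate_bound[OF assms(1) assms(3)] measurable_cong_sets[OF sets_kernel refl] in auto)
  then show ?case by (simp only: iterate_Suc)
qed

lemma iterate_add:
  assumes "f \<in> borel_measurable N" "\<And>x. \<bar>f x\<bar> \<le> c" "g \<in> borel_measurable N" "\<And>x. \<bar>g x\<bar> \<le> d"
  shows "iter n (\<lambda>x. f x + g x) x = iter n f x + iter n g x"
proof (induction n arbitrary: x)
  case (Suc n)
  have "integrable (K x) (iter n f)" "integrable (K x) (iter n g)"
    using integrable_kernel iterate_measurable iterate_bound assms by blast+
  then show ?case
    using Suc by (simp only: iterate_Suc) simp
qed simp

lemma iterate_mult:
  "iter n (\<lambda>x. c * f x) x = c * iter n f x"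
proof (induction n arbitrary: x)
  case (Suc n)
  then show ?case by (simp only: iterate_Suc) simp
qed simp

lemma iterate_one: "iter n (\<lambda>x. 1) x = 1"
proof (induction n arbitrary: x)
  case (Suc n)
  interpret prob_space "K x" by (rule prob_space_kernel)
  show ?case using Suc by (simp only: iterate_Suc) (simp add: prob_space)
qed simp

lemma iterate_nonneg:
  assumes "\<And>x. 0 \<le> f x"
  shows "0 \<le> iter n f x"
  by (induction n arbitrary: x) (auto simp: markov_op_def[of K "(markov_op K ^^ _) _"] assms)

end

text \<open>The size of \<open>f\<close> is measured by \<open>d\<close>, its oscillation relative
  to \<open>W\<close>, a seminorm that ignores constants; the bound \<open>c\<close> is qualitative
  and secures integrability.\<close>

locale contracting_kernel = markov_kernel +
  fixes W :: "'a \<Rightarrow> real" and \<alpha> :: real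
  assumes W_ge_1: "1 \<le> W x"
    and W_integrable: "integrable (K x) W"
    and alpha: "0 \<le> \<alpha>" "\<alpha> < 1"
    and contraction: "f \<in> borel_measurable N \<Longrightarrow> (\<And>x. \<bar>f x\<bar> \<le> c) \<Longrightarrow>
      (\<And>x y. \<bar>f x - f y\<bar> \<le> d * (W x + W y)) \<Longrightarrow> 0 \<le> d \<Longrightarrow>
      \<bar>markov_op K f x - markov_op K f y\<bar> \<le> \<alpha> * d * (W x + W y)"
begin

text \<open>Since \<open>W\<close> is at least 1, a function bounded by \<open>c\<close> has
  weighted oscillation at most \<open>c\<close>, which starts the induction.\<close>

lemma iterate_oscillation:
  assumes f: "f \<in> borel_measurable N" "\<And>x. \<bar>f x\<bar> \<le> c"
  shows "\<bar>iter n f x - iter n f y\<bar> \<le> \<alpha> ^ n * c * (W x + W y)"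
proof (induction n arbitrary: x y)
  case 0
  have c: "0 \<le> c" using f(2)[of x] by linarith
  have "c * (1 + 1) \<le> c * (W x + W y)"
    using c W_ge_1 by (intro mult_left_mono add_mono) auto
  then show ?case using f(2)[of x] f(2)[of y] by simp
next
  case (Suc n)
  have c: "0 \<le> c" using f(2)[of x] by linarith
  have "0 \<le> \<alpha> ^ n * c" using alpha c by simp
  from contraction[OF iterate_measurable[OF f(1)] iterate_bound[OF f] Suc this]
  show ?case by (simp add: mult.assoc)
qed

text \<open>\<open>K x\<close> is a probability measure, so the increment at \<open>x\<close> is the
  mean over \<open>K x\<close> of \<open>iter n f y - iter n f x\<close>, and the oscillation bound
  applies under the integral.\<close>

lemma iterate_increment:
  assumes f: "f \<in> borel_measurable N" "\<And>x. \<bar>f x\<bar> \<le> c"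
  shows "\<bar>iter (Suc n) f x - iter n f x\<bar> \<le> \<alpha> ^ n * (c * (markov_op K W x + W x))"
proof -
  interpret prob_space "K x" by (rule prob_space_kernel)
  let ?g = "iter n f"
  have int: "integrable (K x) ?g"
    using integrable_kernel iterate_measurable iterate_bound f by blast
  have "iter (Suc n) f x - ?g x = (\<integral>y. ?g y - ?g x \<partial>K x)"
    using int by (simp add: markov_op_def prob_space)
  also have "\<bar>\<dots>\<bar> \<le> (\<integral>y. \<bar>?g y - ?g x\<bar> \<partial>K x)" by (rule integral_abs_bound)
  also have "\<dots> \<le> (\<integral>y. \<alpha> ^ n * c * (W y + W x) \<partial>K x)"
    using int W_integrable[of x] iterate_oscillation[OF f] by (intro integral_mono) auto
  also have "\<dots> = \<alpha> ^ n * (c * (markov_op K W x + W x))"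
    using W_integrable[of x] by (simp add: markov_op_def prob_space)
  finally show ?thesis .
qed

text \<open>The base point \<open>undefined\<close> is arbitrary: the oscillation of the iterates
  vanishes, so the limit is the same from every point (\<open>iterate_convergent\<close>).\<close>

definition limit_functional :: "('a \<Rightarrow> real) \<Rightarrow> real" where
  "limit_functional f = lim (\<lambda>n. iter n f undefined)"

lemma iterate_convergent:
  assumes f: "f \<in> borel_measurable N" "\<And>x. \<bar>f x\<bar> \<le> c"
  shows "(\<lambda>n. iter n f x) \<longlonglongrightarrow> limit_functional f"
proof -
  have conv: "convergent (\<lambda>n. iter n f x)" for x
  proof -
    let ?u = "\<lambda>n. iter (Suc n) f x - iter n f x"
    have "summable (\<lambda>n. \<alpha> ^ n * (c * (markov_op K W x + W x)))"
      using alpha by (intro summable_mult2 summable_geometric) auto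
    then have "summable ?u"
      by (rule summable_comparison_test'[of _ 0]) (use iterate_increment[OF f] in auto)
    then have "convergent (\<lambda>n. \<Sum>k<n. ?u k)"
      by (simp add: summable_iff_convergent)
    then have "convergent (\<lambda>n. (\<Sum>k<n. ?u k) + f x)"
      by (intro convergent_add convergent_const)
    moreover have "(\<Sum>k<n. ?u k) + f x = iter n f x" for n
      using sum_lessThan_telescope[of "\<lambda>k. iter k f x" n] by simp
    ultimately show ?thesis by simp
  qed
  have "(\<lambda>n. \<alpha> ^ n * (c * (W x + W undefined))) \<longlonglongrightarrow> 0"
    using alpha by (intro tendsto_mult_left_zero LIMSEQ_power_zero) auto
  then have "(\<lambda>n. iter n f x - iter n f undefined) \<longlonglongrightarrow> 0"
    by (rule Lim_null_comparison[rotated])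
       (use iterate_oscillation[OF f] in \<open>auto intro!: always_eventually simp: mult.assoc\<close>)
  from tendsto_add[OF this conv[of undefined, unfolded convergent_LIMSEQ_iff]]
  show ?thesis by (simp add: limit_functional_def)
qed

text \<open>The rate depends on \<open>f\<close> only through its bound \<open>c\<close>. This
  uniformity permits the exchange of limits in \<open>limit_functional_tendsto\<close>.\<close>

lemma iterate_rate:
  assumes f: "f \<in> borel_measurable N" "\<And>x. \<bar>f x\<bar> \<le> c"
  shows "\<bar>iter n f x - limit_functional f\<bar>
    \<le> \<alpha> ^ n * (c * (markov_op K W x + W x)) / (1 - \<alpha>)"
proof -
  define D where "D = c * (markov_op K W x + W x)"
  have "iter (n + m) f x - iter n f x
      = (\<Sum>k<m. iter (Suc (n + k)) f x - iter (n + k) f x)" for m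
    using sum_lessThan_telescope[of "\<lambda>k. iter (n + k) f x" m] by simp
  then have "\<bar>iter (n + m) f x - iter n f x\<bar> \<le> \<alpha> ^ n * D / (1 - \<alpha>)" for m
  proof (simp only:)
    have "\<bar>\<Sum>k<m. iter (Suc (n + k)) f x - iter (n + k) f x\<bar>
        \<le> (\<Sum>k<m. \<alpha> ^ (n + k) * D)"
      unfolding D_def by (rule order_trans[OF sum_abs sum_mono]) (rule iterate_increment[OF f])
    also have "\<dots> = \<alpha> ^ n * D * (\<Sum>k<m. \<alpha> ^ k)"
      by (simp add: sum_distrib_left power_add mult_ac)
    also have "\<dots> = \<alpha> ^ n * D * ((1 - \<alpha> ^ m) / (1 - \<alpha>))"
      using alpha by (simp add: sum_gp_strict)
    also have "\<dots> \<le> \<alpha> ^ n * D * (1 / (1 - \<alpha>))"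
    proof -
      have "0 \<le> \<bar>iter (Suc 0) f x - iter 0 f x\<bar>" by simp
      also have "\<dots> \<le> D" using iterate_increment[OF f, of 0 x] by (simp add: D_def)
      finally show ?thesis
        using alpha by (intro mult_left_mono divide_right_mono) auto
    qed
    finally show "\<bar>\<Sum>k<m. iter (Suc (n + k)) f x - iter (n + k) f x\<bar>
        \<le> \<alpha> ^ n * D / (1 - \<alpha>)" by simp
  qed
  moreover have "(\<lambda>m. \<bar>iter (n + m) f x - iter n f x\<bar>)
      \<longlonglongrightarrow> \<bar>limit_functional f - iter n f x\<bar>"
    using LIMSEQ_ignore_initial_segment[OF iterate_convergent[OF f], of n]
    by (intro tendsto_intros) (simp add: add.commute)
  ultimately have "\<bar>limit_functional f - iter n f x\<bar> \<le> \<alpha> ^ n * D / (1 - \<alpha>)"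
    by (intro LIMSEQ_le_const2[of _ _ "\<alpha> ^ n * D / (1 - \<alpha>)"]) auto
  then show ?thesis by (simp add: D_def abs_minus_commute)
qed

lemma limit_functional_eqI:
  assumes f: "f \<in> borel_measurable N" "\<And>x. \<bar>f x\<bar> \<le> c"
    and "(\<lambda>n. iter n f x) \<longlonglongrightarrow> l"
  shows "limit_functional f = l"
  using LIMSEQ_unique[OF iterate_convergent[OF f, of x] assms(3)] .

text \<open>For a large fixed \<open>n\<close> each functional is within r/3 of its n-th iterate,
  uniformly in \<open>i\<close>, and the n-th iterates converge in \<open>i\<close>. This continuity
  makes the functional a countably additive measure without any tightness argument.\<close>

lemma limit_functional_tendsto:
  assumes F: "\<And>i. F i \<in> borel_measurable N" "f \<in> borel_measurable N"
    and b: "\<And>i x. \<bar>F i x\<bar> \<le> c" and lim: "\<And>x. (\<lambda>i. F i x) \<longlonglongrightarrow> f x"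
  shows "(\<lambda>i. limit_functional (F i)) \<longlonglongrightarrow> limit_functional f"
proof (rule LIMSEQ_I)
  fix r :: real assume r: "0 < r"
  have bf: "\<bar>f x\<bar> \<le> c" for x
    using b by (intro LIMSEQ_le_const2[OF tendsto_rabs[OF lim[of x]]]) auto
  define D where "D = c * (markov_op K W undefined + W undefined)"
  have "(\<lambda>n. \<alpha> ^ n * D / (1 - \<alpha>)) \<longlonglongrightarrow> 0"
    using alpha by (auto intro!: tendsto_eq_intros LIMSEQ_power_zero)
  then obtain n where n: "\<alpha> ^ n * D / (1 - \<alpha>) < r / 3"
    using r order_tendstoD(2)[of "\<lambda>n. \<alpha> ^ n * D / (1 - \<alpha>)" 0 sequentially "r/3"]
    unfolding eventually_sequentially by (meson divide_pos_pos order_refl zero_less_numeral)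
  have "(\<lambda>i. iter n (F i) undefined) \<longlonglongrightarrow> iter n f undefined"
    by (rule iterate_tendsto[OF F b lim])
  from LIMSEQ_D[OF this, of "r/3"] r obtain i0 where
    i0: "\<And>i. i \<ge> i0 \<Longrightarrow> \<bar>iter n (F i) undefined - iter n f undefined\<bar> < r / 3"
    by auto
  have "\<bar>limit_functional (F i) - limit_functional f\<bar> < r" if "i \<ge> i0" for i
    using iterate_rate[OF F(1)[of i] b[of i], of n undefined] iterate_rate[OF F(2) bf, of n undefined] n i0[OF that]
    unfolding D_def[symmetric] by linarith
  then show "\<exists>no. \<forall>n\<ge>no. norm (limit_functional (F n) - limit_functional f) < r" by auto
qed

section \<open>The limit functional as the unique invariant probability measure\<close>

definition limit_measure :: "'a measure" where
  "limit_measure = measure_of UNIV (sets N) (\<lambda>A. ennreal (limit_functional (indicator A)))"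

lemma limit_functional_add:
  assumes f: "f \<in> borel_measurable N" "\<And>x. \<bar>f x\<bar> \<le> c" and g: "g \<in> borel_measurable N" "\<And>x. \<bar>g x\<bar> \<le> d"
  shows "limit_functional (\<lambda>x. f x + g x) = limit_functional f + limit_functional g"
proof (rule limit_functional_eqI[of _ "c + d" undefined])
  show "\<bar>f x + g x\<bar> \<le> c + d" for x using f(2)[of x] g(2)[of x] by linarith
  show "(\<lambda>n. iter n (\<lambda>x. f x + g x) undefined)
      \<longlonglongrightarrow> limit_functional f + limit_functional g"
    using tendsto_add[OF iterate_convergent[OF f] iterate_convergent[OF g]]
    by (simp add: iterate_add[OF f g])
qed (use f g in auto)

lemma limit_functional_mult:
  assumes f: "f \<in> borel_measurable N" "\<And>x. \<bar>f x\<bar> \<le> c"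
  shows "limit_functional (\<lambda>x. d * f x) = d * limit_functional f"
proof (rule limit_functional_eqI[of _ "\<bar>d\<bar> * c" undefined])
  show "\<bar>d * f x\<bar> \<le> \<bar>d\<bar> * c" for x using f(2)[of x] by (simp add: abs_mult mult_left_mono)
  show "(\<lambda>n. iter n (\<lambda>x. d * f x) undefined) \<longlonglongrightarrow> d * limit_functional f"
    using tendsto_mult_left[OF iterate_convergent[OF f]] by (simp add: iterate_mult)
qed (use f in auto)

lemma limit_functional_nonneg:
  assumes f: "f \<in> borel_measurable N" "\<And>x. \<bar>f x\<bar> \<le> c" "\<And>x. 0 \<le> f x"
  shows "0 \<le> limit_functional f"
  using iterate_nonneg[OF f(3)] by (intro LIMSEQ_le_const[OF iterate_convergent[OF f(1,2)]]) auto

lemma sets_limit_measure [simp, measurable_cong]: "sets limit_measure = sets N"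
  using sets.space_closed[of N] sets.sigma_sets_eq[of N] by (simp add: limit_measure_def space_N)

lemma emeasure_limit_measure:
  assumes A: "A \<in> sets N"
  shows "emeasure limit_measure A = ennreal (limit_functional (indicator A))"
proof (rule emeasure_measure_of[OF limit_measure_def])
  let ?m = "\<lambda>A. ennreal (limit_functional (indicator A))"
  have nn: "0 \<le> limit_functional (indicator A)" if "A \<in> sets N" for A
    using that by (intro limit_functional_nonneg[of _ 1]) auto
  show "sets N \<subseteq> Pow UNIV" by simp
  have z: "limit_functional (indicator {}) = 0"
    using limit_functional_mult[of "\<lambda>_. 0" 0 0] by (simp add: indicator_def[abs_def])
  show pos: "positive (sets limit_measure) ?m"
    using z by (simp add: positive_def)
  show "countably_additive (sets limit_measure) ?m"
    unfolding sets_limit_measure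
  proof (rule sets.empty_continuous_imp_countably_additive)
    show "positive (sets N) ?m" using pos by simp
    show "additive (sets N) ?m"
      unfolding additive_def
    proof (intro ballI impI)
      fix A B assume AB: "A \<in> sets N" "B \<in> sets N" "A \<inter> B = {}"
      have "(indicator (A \<union> B) :: _ \<Rightarrow> real) = (\<lambda>x. indicator A x + indicator B x)"
        using AB by (auto simp: indicator_def fun_eq_iff)
      then have "limit_functional (indicator (A \<union> B)) =
          limit_functional (indicator A) + limit_functional (indicator B)"
        using AB limit_functional_add[of "indicator A" 1 "indicator B" 1] by simp
      then show "?m (A \<union> B) = ?m A + ?m B"
        using nn AB by (simp add: ennreal_plus)
    qed
    show "\<forall>A\<in>sets N. ?m A \<noteq> \<infinity>" by simp
    fix A :: "nat \<Rightarrow> 'a set"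
    assume A: "range A \<subseteq> sets N" "decseq A" "(\<Inter>i. A i) = {}"
    have "(\<lambda>i. limit_functional (indicator (A i))) \<longlonglongrightarrow> limit_functional (indicator {})"
    proof (rule limit_functional_tendsto[of _ _ 1])
      show "(\<lambda>i. indicator (A i) x :: real) \<longlonglongrightarrow> indicator {} x" for x
        using LIMSEQ_indicator_decseq[OF A(2), of x] A(3) by simp
    qed (use A in auto)
    then show "(\<lambda>i. ?m (A i)) \<longlonglongrightarrow> 0"
      unfolding z using tendsto_ennrealI by fastforce
  qed
  show "A \<in> sets limit_measure" using A by simp
qed

lemma prob_space_limit_measure: "prob_space limit_measure"
proof
  have "limit_functional (indicator UNIV) = 1"
    by (rule limit_functional_eqI[of _ 1 undefined])
       (use sets.top[of N] space_N in \<open>auto simp: indicator_def[abs_def] iterate_one\<close>)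
  then show "emeasure limit_measure (space limit_measure) = 1"
    using sets.top[of N] space_N sets_eq_imp_space_eq[OF sets_limit_measure]
    by (simp add: emeasure_limit_measure)
qed

lemma integral_limit_measure:
  assumes f: "f \<in> borel_measurable N" "\<And>x. \<bar>f x\<bar> \<le> c"
  shows "(\<integral>x. f x \<partial>limit_measure) = limit_functional f"
proof -
  interpret L: prob_space limit_measure by (rule prob_space_limit_measure)
  have int: "integrable limit_measure f" if "f \<in> borel_measurable N" "\<And>x. \<bar>f x\<bar> \<le> c"
    for f :: "'a \<Rightarrow> real" and c
    by (rule L.integrable_const_bound[of _ c])
       (use that measurable_cong_sets[OF sets_limit_measure refl] in auto)
  \<comment> \<open>The upper bound is quantified inside the induction claim because the summands,
    multiples and approximants met on the way need bounds of their own.\<close>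
  have nonneg: "\<forall>c. (\<forall>x. u x \<le> c) \<longrightarrow> (\<integral>x. u x \<partial>limit_measure) = limit_functional u"
    if "u \<in> borel_measurable N" "\<And>x. 0 \<le> u x" for u
    using that
  proof (induction rule: borel_measurable_induct_real)
    case (set A)
    have "0 \<le> limit_functional (indicator A)"
      using set by (intro limit_functional_nonneg[of _ 1]) auto
    then show ?case
      using set emeasure_limit_measure[OF set] by (simp add: measure_def space_N)
  next
    case (mult u d)
    show ?case
    proof (intro allI impI)
      fix c assume c: "\<forall>x. d * u x \<le> c"
      show "(\<integral>x. d * u x \<partial>limit_measure) = limit_functional (\<lambda>x. d * u x)"
      proof (cases "d = 0")
        case True
        then show ?thesis using limit_functional_mult[of "\<lambda>_. 0" 0 0] by simp
      next
        case False
        then have "u x \<le> c / d" for x using c mult(1) by (simp add: field_simps)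
        moreover from this have "\<bar>u x\<bar> \<le> c / d" for x using mult(3)[of x] by simp
        ultimately show ?thesis
          using mult(4)[rule_format, of "c / d"] limit_functional_mult[OF mult(2), of "c / d" d] by simp
      qed
    qed
  next
    case (add u v)
    show ?case
    proof (intro allI impI)
      fix c assume c: "\<forall>x. v x + u x \<le> c"
      have *: "u x \<le> c" "v x \<le> c" "\<bar>u x\<bar> \<le> c" "\<bar>v x\<bar> \<le> c" for x
        using c[rule_format, of x] add.hyps(2)[of x] add.hyps(4)[of x] by auto
      have "(\<integral>x. u x \<partial>limit_measure) = limit_functional u"
        "(\<integral>x. v x \<partial>limit_measure) = limit_functional v"
        using add.IH * by blast+
      then show "(\<integral>x. v x + u x \<partial>limit_measure) = limit_functional (\<lambda>x. v x + u x)"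
        using int[OF add.hyps(1) *(3)] int[OF add.hyps(3) *(4)]
          limit_functional_add[OF add.hyps(3) *(4) add.hyps(1) *(3)] by simp
    qed
  next
    case (seq U)
    show ?case
    proof (intro allI impI)
      fix c assume c: "\<forall>x. u x \<le> c"
      have lim: "(\<lambda>i. U i x) \<longlonglongrightarrow> u x" for x using seq.hyps(4) by (simp add: space_N)
      have "U i x \<le> u x" for i x
        using seq.hyps(3) lim[of x] by (auto intro!: incseq_le simp: incseq_def le_fun_def)
      then have Uc: "U i x \<le> c" "\<bar>U i x\<bar> \<le> c" for i x
        using c seq.hyps(2)[of i x] by (auto intro: order_trans)
      have um: "u \<in> borel_measurable N"
        by (rule borel_measurable_LIMSEQ_real[of _ U]) (use seq.hyps(1) lim in auto)
      have "(\<lambda>i. \<integral>x. U i x \<partial>limit_measure) \<longlonglongrightarrow> (\<integral>x. u x \<partial>limit_measure)"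
        by (rule integral_dominated_convergence[where w="\<lambda>_. c"])
           (use Uc lim um seq.hyps(1) measurable_cong_sets[OF sets_limit_measure refl] in auto)
      moreover have "(\<lambda>i. limit_functional (U i)) \<longlonglongrightarrow> limit_functional u"
        by (rule limit_functional_tendsto[OF seq.hyps(1) um Uc(2) lim])
      moreover have "(\<integral>x. U i x \<partial>limit_measure) = limit_functional (U i)" for i
        using seq.IH[of i] Uc(1) by blast
      ultimately show "(\<integral>x. u x \<partial>limit_measure) = limit_functional u"
        by (simp add: LIMSEQ_unique)
    qed
  qed
  \<comment> \<open>The shift by \<open>c\<close> makes \<open>f\<close> nonnegative and reduces the
    general case to the previous one.\<close>
  have pos: "0 \<le> f x + c" "f x + c \<le> 2 * c" "\<bar>f x + c\<bar> \<le> 2 * c" for x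
    using f(2)[of x] by linarith+
  have one: "limit_functional (\<lambda>x. 1) = 1"
    by (rule limit_functional_eqI[of _ 1 undefined]) (auto simp: iterate_one)
  have "(\<integral>x. f x + c \<partial>limit_measure) = limit_functional (\<lambda>x. f x + c)"
    by (rule nonneg[rule_format, OF _ pos(1,2)]) (use f in auto)
  moreover have "(\<integral>x. f x + c \<partial>limit_measure) = (\<integral>x. f x \<partial>limit_measure) + c"
    using int[OF f] by (simp add: L.prob_space)
  moreover have "limit_functional (\<lambda>x. f x + c) = limit_functional f + c"
    using limit_functional_add[OF f, of "\<lambda>x. c * 1" "\<bar>c\<bar>"] limit_functional_mult[of "\<lambda>x. 1" 1 c] one
    by simp
  ultimately show ?thesis by simp
qed

theorem ex1_invariant:
  "\<exists>!\<mu>. prob_space \<mu> \<and> sets \<mu> = sets N \<and>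
    (\<forall>f\<in>borel_measurable N. bounded (range f) \<longrightarrow> (\<integral>x. markov_op K f x \<partial>\<mu>) = (\<integral>x. f x \<partial>\<mu>))"
proof (intro ex1I conjI ballI impI)
  show "prob_space limit_measure" "sets limit_measure = sets N"
    by (simp_all add: prob_space_limit_measure)
  fix f :: "'a \<Rightarrow> real" assume f: "f \<in> borel_measurable N" "bounded (range f)"
  then obtain c where c: "\<And>x. \<bar>f x\<bar> \<le> c" by (auto simp: bounded_iff)
  \<comment> \<open>Applying the kernel first only shifts the sequence of iterates by one, so the
    limit is unchanged; this is invariance.\<close>
  have "(\<lambda>n. iter n (markov_op K f) undefined) \<longlonglongrightarrow> limit_functional f"
    using LIMSEQ_ignore_initial_segment[OF iterate_convergent[OF f(1) c, of undefined], of 1]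
    by (simp add: funpow_Suc_right del: funpow.simps(2))
  then have "limit_functional (markov_op K f) = limit_functional f"
    by (intro limit_functional_eqI[OF markov_op_measurable[OF f(1)] markov_op_bound[OF f(1) c]])
  then show "(\<integral>x. markov_op K f x \<partial>limit_measure) = (\<integral>x. f x \<partial>limit_measure)"
    using integral_limit_measure[OF f(1) c]
      integral_limit_measure[OF markov_op_measurable[OF f(1)] markov_op_bound[OF f(1) c]] by simp
next
  fix \<mu> assume *: "prob_space \<mu> \<and> sets \<mu> = sets N \<and>
    (\<forall>f\<in>borel_measurable N. bounded (range f) \<longrightarrow> (\<integral>x. markov_op K f x \<partial>\<mu>) = (\<integral>x. f x \<partial>\<mu>))"
  interpret prob_space \<mu> using * by simp
  have sp: "space \<mu> = UNIV" using sets_eq_imp_space_eq[of \<mu> N] * space_N by simp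
  have inv: "(\<integral>x. iter n f x \<partial>\<mu>) = (\<integral>x. f x \<partial>\<mu>)"
    if f: "f \<in> borel_measurable N" "\<And>x. \<bar>f x\<bar> \<le> c" for f c n
  proof (induction n)
    case (Suc n)
    have "bounded (range (iter n f))"
      using iterate_bound[OF f] by (auto simp: bounded_iff)
    then show ?case using * iterate_measurable[OF f(1)] Suc by simp
  qed simp
  show "\<mu> = limit_measure"
  proof (rule measure_eqI)
    show "sets \<mu> = sets limit_measure" using * by simp
    fix A assume "A \<in> sets \<mu>"
    then have A: "A \<in> sets N" using * by simp
    have ind: "indicator A \<in> borel_measurable N" "\<bar>indicator A x :: real\<bar> \<le> 1" for x
      using A by auto
    \<comment> \<open>By invariance the left side is constantly \<open>measure \<mu> A\<close>,
      while the integrand tends to a constant; hence \<mu> is determined on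
      \<open>A\<close>.\<close>
    have "(\<lambda>n. \<integral>x. iter n (indicator A) x \<partial>\<mu>) \<longlonglongrightarrow>
        (\<integral>x. limit_functional (indicator A) \<partial>\<mu>)"
      by (rule integral_dominated_convergence[where w="\<lambda>_. 1"])
         (use iterate_convergent[OF ind] iterate_bound[OF ind] iterate_measurable[OF ind(1)]
           measurable_cong_sets[of \<mu> N borel borel] * in auto)
    then have "measure \<mu> A = limit_functional (indicator A)"
      using inv[OF ind] LIMSEQ_unique[OF tendsto_const] prob_space by (simp add: sp)
    then show "emeasure \<mu> A = emeasure limit_measure A"
      using A by (simp add: emeasure_limit_measure emeasure_eq_measure)
  qed
qed

end

text \<open>The weight \<open>1 + \<beta> V\<close>, with \<open>\<beta>\<close> of the order of the mass of the minorizing measure, is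
  the one of Hairer and Mattingly.\<close>

theorem (in markov_kernel) ex1_invariant_if_drift_minorization:
  fixes V :: "'a \<Rightarrow> real" and a :: real
  assumes V: "V \<in> borel_measurable N" "\<And>x. 0 \<le> V x"
    and a: "0 < a" "a < 1"
    and drift: "\<And>x. (\<integral>\<^sup>+y. ennreal (V y) \<partial>K x) \<le> ennreal (a * (1 + V x))"
    and nu: "sets \<nu> = sets N" "finite_measure \<nu>" "emeasure \<nu> UNIV \<noteq> 0"
    and minorization: "\<And>x A. V x \<le> 4 * a / (1 - a) \<Longrightarrow> A \<in> sets N \<Longrightarrow> emeasure \<nu> A \<le> emeasure (K x) A"
  shows "\<exists>!\<mu>. prob_space \<mu> \<and> sets \<mu> = sets N \<and>
    (\<forall>f\<in>borel_measurable N. bounded (range f) \<longrightarrow> (\<integral>x. markov_op K f x \<partial>\<mu>) = (\<integral>x. f x \<partial>\<mu>))"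
proof -
  interpret nu: finite_measure \<nu> by fact
  have sp_nu: "space \<nu> = UNIV" using sets_eq_imp_space_eq[OF nu(1)] space_N by simp
  define \<epsilon> where "\<epsilon> = measure \<nu> UNIV"
  have eps: "0 < \<epsilon>"
    using nu(3) by (simp add: \<epsilon>_def nu.emeasure_eq_measure zero_less_measure_iff)
  \<comment> \<open>Chosen so that \<open>2 * a * \<beta> = \<epsilon>\<close>: the drift then adds
    \<epsilon> to the constant 2 of the two weights, half of the 2 \<epsilon> that the minorization
    gains.\<close>
  define \<beta> where "\<beta> = \<epsilon> / (2 * a)"
  have beta: "0 < \<beta>" "2 * a * \<beta> = \<epsilon>" using eps a by (auto simp: \<beta>_def)
  define W where "W x = 1 + \<beta> * V x" for x
  \<comment> \<open>Beyond this level the drift wins: if \<open>V x + V y\<close> exceeds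
    \<open>R\<close>, then (1 - a) / 2 times the \<beta>-weighted sum exceeds \<epsilon> and absorbs
    the added constant.\<close>
  define R where "R = 4 * a / (1 - a)"
  have R: "0 < R" using a by (simp add: R_def)
  define q where "q = \<beta> * R"
  have q: "0 < q" using beta R by (simp add: q_def)
  define a' where "a' = (1 + a) / 2"
  have a': "0 < a'" "a' < 1" using a by (auto simp: a'_def)
  \<comment> \<open>Three competing rates. The first governs pairs with \<open>V x + V y\<close>
    above \<open>R\<close>; for the other pairs the constant part 2 contracts by
    \<open>1 - \<epsilon> / 2\<close> and the part \<open>\<beta> * S\<close> by
    \<open>a\<close>.\<close>
  define \<alpha> where "\<alpha> = max (max ((2 + a' * q) / (2 + q)) (1 - \<epsilon> / 2)) a"
  have al: "(2 + a' * q) / (2 + q) \<le> \<alpha>" "1 - \<epsilon> / 2 \<le> \<alpha>" "a \<le> \<alpha>"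
    by (auto simp: \<alpha>_def)
  have al1: "\<alpha> < 1" using a' q eps a by (simp add: \<alpha>_def)
  have Vint: "integrable (K x) V" and Vdrift: "(\<integral>y. V y \<partial>K x) \<le> a * (1 + V x)" for x
  proof -
    have fin: "(\<integral>\<^sup>+y. ennreal (V y) \<partial>K x) < \<infinity>"
      using drift[of x] by (rule order.strict_trans1) simp
    show i: "integrable (K x) V"
      using fin V measurable_cong_sets[OF sets_kernel refl] by (intro integrableI_nonneg) auto
    have "ennreal (\<integral>y. V y \<partial>K x) \<le> ennreal (a * (1 + V x))"
      using drift[of x] nn_integral_eq_integral[OF i] V by simp
    then show "(\<integral>y. V y \<partial>K x) \<le> a * (1 + V x)"
      using a V(2)[of x] by (simp add: ennreal_le_iff)
  qed
  have W1: "1 \<le> W x" for x using beta V(2)[of x] by (simp add: W_def)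
  have Wint: "integrable (K x) W" for x
  proof -
    interpret prob_space "K x" by (rule prob_space_kernel)
    show ?thesis unfolding W_def using Vint[of x] by (intro Bochner_Integration.integrable_add) auto
  qed
  have PW: "(\<integral>y. W y \<partial>K x) \<le> 1 + \<beta> * (a * (1 + V x))" for x
  proof -
    interpret prob_space "K x" by (rule prob_space_kernel)
    have "(\<integral>y. W y \<partial>K x) = 1 + \<beta> * (\<integral>y. V y \<partial>K x)"
      unfolding W_def using Vint[of x] by (simp add: prob_space)
    then show ?thesis using Vdrift[of x] beta by (simp add: mult_left_mono)
  qed
  have comp: "integrable \<nu> h \<and> (\<integral>y. h y \<partial>\<nu>) \<le> (\<integral>y. h y \<partial>K x)"
    if x: "V x \<le> R" and h: "h \<in> borel_measurable N" "\<And>y. 0 \<le> h y" "integrable (K x) h" for x and h :: "'a \<Rightarrow> real"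
  proof -
    have "\<nu> \<le> K x"
      unfolding le_measure[OF trans[OF nu(1) sets_kernel[of x, symmetric]]]
      using minorization[of x] x nu(1) by (auto simp: R_def)
    then have le: "(\<integral>\<^sup>+y. ennreal (h y) \<partial>\<nu>) \<le> (\<integral>\<^sup>+y. ennreal (h y) \<partial>K x)"
      using nu(1) sets_kernel by (intro nn_integral_mono_measure) auto
    also have "\<dots> = ennreal (\<integral>y. h y \<partial>K x)"
      using h by (intro nn_integral_eq_integral) auto
    finally have le': "(\<integral>\<^sup>+y. ennreal (h y) \<partial>\<nu>) \<le> ennreal (\<integral>y. h y \<partial>K x)" .
    have "h \<in> borel_measurable \<nu>" using h(1) measurable_cong_sets[OF nu(1) refl] by auto
    then have i: "integrable \<nu> h"
      using h(2) le' by (intro integrableI_nonneg) (auto intro: order.strict_trans1)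
    moreover have "ennreal (\<integral>y. h y \<partial>\<nu>) \<le> ennreal (\<integral>y. h y \<partial>K x)"
      using le' nn_integral_eq_integral[OF i] h by simp
    ultimately show ?thesis using h by (simp add: ennreal_le_iff integral_nonneg)
  qed
  have key: "markov_op K f x - markov_op K f y \<le> \<alpha> * (W x + W y)"
    if f: "f \<in> borel_measurable N" "\<And>x. \<bar>f x\<bar> \<le> c" and osc: "\<And>x y. \<bar>f x - f y\<bar> \<le> W x + W y"
    for f c x y
  proof -
    interpret X: prob_space "K x" by (rule prob_space_kernel)
    interpret Y: prob_space "K y" by (rule prob_space_kernel)
    obtain d where d: "\<And>x. \<bar>f x - d\<bar> \<le> W x"
      using center_of_weighted_oscillation[of f W] osc by blast
    let ?g = "\<lambda>x. f x - d"
    have fi: "integrable (K x) f" for x by (rule integrable_kernel[OF f])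
    have gi: "integrable (K x) ?g" for x
    proof -
      interpret prob_space "K x" by (rule prob_space_kernel)
      show ?thesis using fi by auto
    qed
    have diff: "markov_op K f x - markov_op K f y = (\<integral>z. ?g z \<partial>K x) - (\<integral>z. ?g z \<partial>K y)"
      using fi by (simp add: markov_op_def X.prob_space Y.prob_space)
    have Wm: "W \<in> borel_measurable N" using V unfolding W_def by measurable
    define S where "S = V x + V y"
    have Wxy: "W x + W y = 2 + \<beta> * S" by (simp add: W_def S_def algebra_simps)
    have PWxy: "(\<integral>z. W z \<partial>K x) + (\<integral>z. W z \<partial>K y) \<le> 2 + \<epsilon> + a * (\<beta> * S)"
      using PW[of x] PW[of y] beta(2) by (simp add: S_def algebra_simps)
    have S0: "0 \<le> \<beta> * S" using V beta by (simp add: S_def)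
    show ?thesis
    proof (cases "S \<le> R")
      case True
      then have xy: "V x \<le> R" "V y \<le> R" using V(2)[of x] V(2)[of y] by (auto simp: S_def)
      \<comment> \<open>The centring makes \<open>W + g\<close> and \<open>W - g\<close>
        nonnegative, so the minorization applies to each. Their sum is 2 W, at least 2, which is the
        source of the gain 2 \<epsilon>.\<close>
      have 1: "integrable \<nu> (\<lambda>z. W z + ?g z) \<and> (\<integral>z. W z + ?g z \<partial>\<nu>) \<le> (\<integral>z. W z + ?g z \<partial>K y)"
      proof (rule comp[OF xy(2)])
        show "0 \<le> W z + (f z - d)" for z using d[of z] by linarith
      qed (use Wm f Wint gi in auto)
      have 2: "integrable \<nu> (\<lambda>z. W z - ?g z) \<and> (\<integral>z. W z - ?g z \<partial>\<nu>) \<le> (\<integral>z. W z - ?g z \<partial>K x)"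
      proof (rule comp[OF xy(1)])
        show "0 \<le> W z - (f z - d)" for z using d[of z] by linarith
      qed (use Wm f Wint gi in auto)
      have 3: "integrable \<nu> (\<lambda>z. 1) \<and> integrable \<nu> W"
        using comp[OF xy(1) Wm _ Wint] W1 by (force intro: order_trans[of 0 1])
      have "2 * \<epsilon> = (\<integral>z. 2 \<partial>\<nu>)" by (simp add: \<epsilon>_def sp_nu)
      also have "\<dots> \<le> (\<integral>z. 2 * W z \<partial>\<nu>)"
        using 3 W1 by (intro integral_mono) auto
      also have "\<dots> = (\<integral>z. (W z + ?g z) + (W z - ?g z) \<partial>\<nu>)" by simp
      also have "\<dots> = (\<integral>z. W z + ?g z \<partial>\<nu>) + (\<integral>z. W z - ?g z \<partial>\<nu>)"
        using 1 2 by (intro Bochner_Integration.integral_add) auto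
      also have "\<dots> \<le> (\<integral>z. W z + ?g z \<partial>K y) + (\<integral>z. W z - ?g z \<partial>K x)"
        using 1 2 by linarith
      also have "\<dots> = ((\<integral>z. W z \<partial>K x) + (\<integral>z. W z \<partial>K y)) - ((\<integral>z. ?g z \<partial>K x) - (\<integral>z. ?g z \<partial>K y))"
        by (subst Bochner_Integration.integral_add[OF Wint gi],
            subst Bochner_Integration.integral_diff[OF Wint gi]) linarith
      finally have "markov_op K f x - markov_op K f y \<le> 2 * (1 - \<epsilon> / 2) + a * (\<beta> * S)"
        using diff PWxy by (simp add: algebra_simps)
      also have "\<dots> \<le> 2 * \<alpha> + \<alpha> * (\<beta> * S)"
        using al S0 by (intro add_mono mult_left_mono mult_right_mono) auto
      finally show ?thesis by (simp add: Wxy algebra_simps)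
    next
      case False
      have "(\<integral>z. ?g z \<partial>K x) \<le> (\<integral>z. W z \<partial>K x)" "- (\<integral>z. W z \<partial>K y) \<le> (\<integral>z. ?g z \<partial>K y)"
      proof -
        show "(\<integral>z. ?g z \<partial>K x) \<le> (\<integral>z. W z \<partial>K x)"
          by (rule integral_mono[OF gi Wint]) (use d abs_le_D1 in blast)
        have "(\<integral>z. - W z \<partial>K y) \<le> (\<integral>z. ?g z \<partial>K y)"
        proof (rule integral_mono[OF _ gi])
          show "- W z \<le> f z - d" for z using d[of z] by linarith
        qed (use Wint in auto)
        then show "- (\<integral>z. W z \<partial>K y) \<le> (\<integral>z. ?g z \<partial>K y)" by simp
      qed
      then have 1: "markov_op K f x - markov_op K f y \<le> 2 + \<epsilon> + a * (\<beta> * S)"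
        using diff PWxy by linarith
      have SR: "R * (1 - a) = 4 * a" using a by (simp add: R_def)
      have "4 * a \<le> (1 - a) * S" using False a SR
        by (metis less_eq_real_def linorder_not_less mult.commute mult_le_cancel_left_pos diff_gt_0_iff_gt)
      then have "\<beta> * (4 * a) \<le> \<beta> * ((1 - a) * S)" using beta by (simp add: mult_left_mono)
      then have "\<epsilon> \<le> (1 - a) / 2 * (\<beta> * S)"
        using beta(2) by (simp add: algebra_simps)
      then have 2: "2 + \<epsilon> + a * (\<beta> * S) \<le> 2 + a' * (\<beta> * S)"
        by (simp add: a'_def algebra_simps add_divide_distrib diff_divide_distrib)
      have qS: "q \<le> \<beta> * S" using False beta by (simp add: q_def)
      \<comment> \<open>As \<open>a' < 1\<close>, the quotient of \<open>2 + a' * s\<close> by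
        \<open>2 + s\<close> decreases in s, so among all s from \<open>q\<close> on the value at
        \<open>q\<close> is the worst.\<close>
      have "2 + a' * (\<beta> * S) \<le> (2 + a' * q) / (2 + q) * (2 + \<beta> * S)"
      proof -
        have "(2 + a' * (\<beta> * S)) * (2 + q) \<le> (2 + a' * q) * (2 + \<beta> * S)"
        proof -
          have "a' * (\<beta> * S - q) \<le> 1 * (\<beta> * S - q)"
            using qS a' by (intro mult_right_mono) auto
          then show ?thesis by (simp add: algebra_simps)
        qed
        then show ?thesis using q by (simp add: field_simps)
      qed
      also have "\<dots> \<le> \<alpha> * (2 + \<beta> * S)"
        using al S0 by (intro mult_right_mono) auto
      finally show ?thesis using 1 2 unfolding Wxy by linarith
    qed
  qed
  interpret contracting_kernel N K W \<alpha>
  proof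
    show "1 \<le> W x" "integrable (K x) W" for x by (rule W1, rule Wint)
    show "0 \<le> \<alpha>" "\<alpha> < 1" using al a al1 by auto
    fix f c d x y
    assume f: "f \<in> borel_measurable N" "\<And>x. \<bar>f x\<bar> \<le> c"
      and osc: "\<And>x y. \<bar>f x - f y\<bar> \<le> d * (W x + W y)" and d: "0 \<le> d"
    show "\<bar>markov_op K f x - markov_op K f y\<bar> \<le> \<alpha> * d * (W x + W y)"
    proof (cases "d = 0")
      case True
      then have "f = (\<lambda>z. f undefined)" using osc by fastforce
      then have "markov_op K f x = f undefined" for x
      proof -
        interpret prob_space "K x" by (rule prob_space_kernel)
        show ?thesis using \<open>f = _\<close> unfolding markov_op_def
          by (metis lebesgue_integral_const prob_space real_scaleR_def mult_1)
      qed
      then show ?thesis using True by simp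
    next
      case False
      let ?h = "\<lambda>z. f z / d"
      have h: "?h \<in> borel_measurable N" "\<And>x. \<bar>?h x\<bar> \<le> c / d"
        using f d False by (auto simp: divide_right_mono)
      have osc': "\<bar>?h x - ?h y\<bar> \<le> W x + W y" for x y
      proof -
        have "\<bar>?h x - ?h y\<bar> = \<bar>f x - f y\<bar> / d" using d by (simp add: diff_divide_distrib[symmetric])
        also have "\<dots> \<le> W x + W y" using osc[of x y] d False by (simp add: field_simps)
        finally show ?thesis .
      qed
      have op: "markov_op K ?h z = markov_op K f z / d" for z by (simp add: markov_op_def)
      have "\<bar>markov_op K f x / d - markov_op K f y / d\<bar> \<le> \<alpha> * (W x + W y)"
        using key[OF h osc', of x y] key[OF h osc', of y x] unfolding op by (simp add: add.commute)
      then have "\<bar>markov_op K f x - markov_op K f y\<bar> / d \<le> \<alpha> * (W x + W y)"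
        using d by (simp add: diff_divide_distrib[symmetric])
      then show ?thesis using d False by (simp add: field_simps)
    qed
  qed
  show ?thesis by (rule ex1_invariant)
qed

section \<open>Uniqueness of Fourier transforms for finite families\<close>

context prob_space
begin

text \<open>By the case a = 0, U has mean zero, so \<open>1 + U / (c + 1)\<close> is a probability
  density with respect to M. The trigonometric hypothesis says that Y has the same characteristic
  function under this density and under M, and Levy's uniqueness theorem makes the laws equal.
  Dividing by \<open>c + 1\<close> also covers \<open>c = 0\<close>.\<close>

lemma integral_indicator_eq_0_if_trig_eq_0_real:
  fixes U Y :: "'a \<Rightarrow> real"
  assumes U: "U \<in> borel_measurable M" "\<And>x. \<bar>U x\<bar> \<le> c"
    and Y [measurable]: "Y \<in> borel_measurable M"
    and trig: "\<And>a. (\<integral>x. complex_of_real (U x) * cis (a * Y x) \<partial>M) = 0"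
    and A [measurable]: "A \<in> sets borel"
  shows "(\<integral>x. U x * indicator A (Y x) \<partial>M) = 0"
proof -
  note U(1)[measurable]
  define f where "f x = 1 + U x / (c + 1)" for x
  have c: "0 < c + 1"
  proof -
    obtain x where "x \<in> space M" using not_empty by blast
    then show ?thesis using U(2)[of x] by linarith
  qed
  have f0: "0 \<le> f x" for x
  proof -
    have "\<bar>U x / (c + 1)\<bar> \<le> 1" using U(2)[of x] c by (simp add: field_simps)
    then show ?thesis unfolding f_def by linarith
  qed
  have fm [measurable]: "f \<in> borel_measurable M" unfolding f_def by measurable
  have Ui: "integrable M U"
    by (rule integrable_const_bound[of _ c]) (use U in auto)
  have "complex_of_real (\<integral>x. U x \<partial>M) = 0" using trig[of 0] by simp
  then have U0: "(\<integral>x. U x \<partial>M) = 0" by simp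
  have fi: "integrable M f" unfolding f_def using Ui by auto
  have f1: "(\<integral>x. f x \<partial>M) = 1"
    unfolding f_def using Ui U0 by (simp add: prob_space)
  let ?D = "density M (\<lambda>x. ennreal (f x))"
  have "emeasure ?D (space ?D) = (\<integral>\<^sup>+x. ennreal (f x) \<partial>M)"
    by (simp add: emeasure_density cong: nn_integral_cong)
  also have "\<dots> = 1" using nn_integral_eq_integral[OF fi] f0 f1 by simp
  finally interpret D: prob_space ?D by (rule prob_spaceI)
  let ?\<mu> = "distr ?D borel Y" and ?\<nu> = "distr M borel Y"
  have trigi: "integrable M (\<lambda>x. cis (a * Y x))" "integrable M (\<lambda>x. complex_of_real (U x) * cis (a * Y x))" for a
  proof -
    have [measurable]: "(\<lambda>x. cis (a * Y x)) \<in> borel_measurable M"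
      unfolding cis_conv_exp by measurable
    show "integrable M (\<lambda>x. cis (a * Y x))"
      by (rule integrable_const_bound[of _ 1]) auto
    show "integrable M (\<lambda>x. complex_of_real (U x) * cis (a * Y x))"
      by (rule integrable_const_bound[of _ c]) (use U in \<open>auto simp: norm_mult\<close>)
  qed
  have "char ?\<mu> t = char ?\<nu> t" for t
  proof -
    have [measurable]: "(\<lambda>x::real. cis (t * x)) \<in> borel_measurable borel"
      unfolding cis_conv_exp by measurable
    have "char ?\<mu> t = (\<integral>x. cis (t * Y x) \<partial>?D)"
      by (simp add: char_def cis_conv_exp integral_distr)
    also have "\<dots> = (\<integral>x. f x *\<^sub>R cis (t * Y x) \<partial>M)"
      by (rule integral_density) (auto simp: f0)
    also have "\<dots> = (\<integral>x. cis (t * Y x) + complex_of_real (1 / (c + 1)) * (complex_of_real (U x) * cis (t * Y x)) \<partial>M)"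
      by (rule Bochner_Integration.integral_cong) (auto simp: f_def scaleR_conv_of_real algebra_simps)
    also have "\<dots> = (\<integral>x. cis (t * Y x) \<partial>M)"
      by (subst Bochner_Integration.integral_add) (use trigi trig in auto)
    also have "\<dots> = char ?\<nu> t"
      by (simp add: char_def cis_conv_exp integral_distr)
    finally show ?thesis .
  qed
  then have "char ?\<mu> = char ?\<nu>" by auto
  moreover have "real_distribution ?\<mu>" "real_distribution ?\<nu>"
    by (auto intro!: D.real_distribution_distr real_distribution_distr)
  ultimately have eq: "?\<mu> = ?\<nu>" by (intro Levy_uniqueness)
  have "(\<integral>x. f x *\<^sub>R (indicator A (Y x) :: real) \<partial>M) = (\<integral>x. indicator A (Y x) \<partial>?D)"
    by (rule integral_density[symmetric]) (auto simp: f0)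
  also have "\<dots> = (\<integral>x. indicator A x \<partial>?\<mu>)" by (rule integral_distr[symmetric]) auto
  also have "\<dots> = (\<integral>x. indicator A (Y x) \<partial>M)" unfolding eq by (rule integral_distr) auto
  finally have "(\<integral>x. f x *\<^sub>R (indicator A (Y x) :: real) \<partial>M) = (\<integral>x. indicator A (Y x) \<partial>M)" .
  moreover have "integrable M (\<lambda>x. U x * indicator A (Y x))" "integrable M (\<lambda>x. indicator A (Y x) :: real)"
  proof -
    show "integrable M (\<lambda>x. U x * indicator A (Y x))"
      by (rule integrable_const_bound[of _ c]) (use U in \<open>auto simp: indicator_def intro: order_trans[OF abs_ge_zero]\<close>)
    show "integrable M (\<lambda>x. indicator A (Y x) :: real)"
      by (rule integrable_const_bound[of _ 1]) auto
  qed
  moreover have "f x *\<^sub>R (indicator A (Y x) :: real) = indicator A (Y x) + (U x * indicator A (Y x)) / (c + 1)" for x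
    by (simp add: f_def algebra_simps)
  ultimately show ?thesis using c by simp
qed

text \<open>Conjugation changes a into -a, so the hypothesis passes to the conjugate of U and hence
  to its real and imaginary parts.\<close>

lemma integral_indicator_eq_0_if_trig_eq_0:
  fixes U :: "'a \<Rightarrow> complex" and Y :: "'a \<Rightarrow> real"
  assumes U [measurable]: "U \<in> borel_measurable M" and Uc: "\<And>x. cmod (U x) \<le> c"
    and Y [measurable]: "Y \<in> borel_measurable M"
    and trig: "\<And>a. (\<integral>x. U x * cis (a * Y x) \<partial>M) = 0"
    and A [measurable]: "A \<in> sets borel"
  shows "(\<integral>x. U x * indicator A (Y x) \<partial>M) = 0"
proof -
  have cm [measurable]: "(\<lambda>x. cis (a * Y x)) \<in> borel_measurable M" for a
    unfolding cis_conv_exp by measurable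
  have i1: "integrable M (\<lambda>x. U x * cis (a * Y x))" for a
    by (rule integrable_const_bound[of _ c]) (use Uc in \<open>auto simp: norm_mult\<close>)
  have [measurable]: "(\<lambda>x. cnj (U x)) \<in> borel_measurable M"
    by (rule measurable_compose[OF U])
       (intro borel_measurable_continuous_onI continuous_intros)
  have i2: "integrable M (\<lambda>x. cnj (U x) * cis (a * Y x))" for a
    by (rule integrable_const_bound[of _ c]) (use Uc in \<open>auto simp: norm_mult\<close>)
  have conj: "(\<integral>x. cnj (U x) * cis (a * Y x) \<partial>M) = 0" for a
  proof -
    have "(\<integral>x. cnj (U x) * cis (a * Y x) \<partial>M) = (\<integral>x. cnj (U x * cis ((- a) * Y x)) \<partial>M)"
      by (rule Bochner_Integration.integral_cong) (auto simp: cis_cnj)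
    then show ?thesis using trig[of "- a"] by (simp del: complex_cnj_mult)
  qed
  have re: "(\<integral>x. Re (U x) * indicator A (Y x) \<partial>M) = 0"
  proof (rule integral_indicator_eq_0_if_trig_eq_0_real[OF _ _ Y _ A])
    show "\<bar>Re (U x)\<bar> \<le> c" for x using abs_Re_le_cmod Uc order_trans by blast
    show "(\<integral>x. complex_of_real (Re (U x)) * cis (a * Y x) \<partial>M) = 0" for a
    proof -
      have "complex_of_real (Re (U x)) * cis (a * Y x)
          = (U x * cis (a * Y x) + cnj (U x) * cis (a * Y x)) / 2" for x
        by (simp add: complex_eq_iff algebra_simps)
      then show ?thesis using i1 i2 trig conj by (simp only: integral_divide_zero) simp
    qed
  qed auto
  have im: "(\<integral>x. Im (U x) * indicator A (Y x) \<partial>M) = 0"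
  proof (rule integral_indicator_eq_0_if_trig_eq_0_real[OF _ _ Y _ A])
    show "\<bar>Im (U x)\<bar> \<le> c" for x using abs_Im_le_cmod Uc order_trans by blast
    show "(\<integral>x. complex_of_real (Im (U x)) * cis (a * Y x) \<partial>M) = 0" for a
    proof -
      have "complex_of_real (Im (U x)) * cis (a * Y x)
          = (U x * cis (a * Y x) - cnj (U x) * cis (a * Y x)) / (2 * \<i>)" for x
        by (simp add: complex_eq_iff Re_divide Im_divide algebra_simps power2_eq_square)
      then show ?thesis using i1 i2 trig conj by (simp only: integral_divide_zero) simp
    qed
  qed auto
  have i: "integrable M (\<lambda>x. U x * indicator A (Y x))"
  proof (rule integrable_const_bound[of _ c])
    show "AE x in M. cmod (U x * indicator A (Y x)) \<le> c"
      using Uc order_trans[OF norm_ge_zero Uc] by (auto simp: norm_mult indicator_def)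
  qed simp
  have ind: "Re (U x * indicator A (Y x)) = Re (U x) * indicator A (Y x)"
    "Im (U x * indicator A (Y x)) = Im (U x) * indicator A (Y x)" for x
    by (auto simp: indicator_def)
  show ?thesis
    using re im integral_Re[OF i] integral_Im[OF i] by (simp add: complex_eq_iff ind del: times_complex.sel)
qed

text \<open>One variable at a time: the factor \<open>cis (t * Y k x)\<close> is absorbed into the
  weight, which is why weights are complex; the induction hypothesis replaces the other characters
  by indicators, and the one-dimensional lemma treats \<open>Y k\<close>. Multivariate uniqueness is
  thus reduced to the real line.\<close>

lemma integral_prod_indicator_eq_0_if_trig_eq_0:
  fixes U :: "'a \<Rightarrow> complex" and Y :: "'i \<Rightarrow> 'a \<Rightarrow> real"
  assumes "finite J" and "U \<in> borel_measurable M" "\<And>x. cmod (U x) \<le> c"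
    and "\<And>j. j \<in> J \<Longrightarrow> Y j \<in> borel_measurable M"
    and "\<And>a. (\<integral>x. U x * cis (\<Sum>j\<in>J. a j * Y j x) \<partial>M) = 0"
    and "\<And>j. j \<in> J \<Longrightarrow> A j \<in> sets borel"
  shows "(\<integral>x. U x * (\<Prod>j\<in>J. indicator (A j) (Y j x)) \<partial>M) = 0"
  using assms
proof (induction J arbitrary: U rule: finite_induct)
  case empty
  then show ?case by (simp add: zero_complex.code[symmetric])
next
  case (insert k J)
  note [measurable] = insert.prems(1)
  have Yk [measurable]: "Y k \<in> borel_measurable M" and Ak: "A k \<in> sets borel"
    using insert.prems by auto
  have YJ [measurable]: "\<And>j. j \<in> J \<Longrightarrow> Y j \<in> borel_measurable M" and AJ [measurable]: "\<And>j. j \<in> J \<Longrightarrow> A j \<in> sets borel"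
    using insert.prems by auto
  have cm [measurable]: "(\<lambda>x. cis (t * Y k x)) \<in> borel_measurable M" for t
    unfolding cis_conv_exp by measurable
  have step: "(\<integral>x. (U x * cis (t * Y k x)) * (\<Prod>j\<in>J. indicator (A j) (Y j x)) \<partial>M) = 0" for t
  proof (rule insert.IH)
    show "cmod (U x * cis (t * Y k x)) \<le> c" for x
      using insert.prems(2) by (simp add: norm_mult)
    fix a
    let ?a = "a(k := t)"
    have "(\<Sum>j\<in>insert k J. ?a j * Y j x) = t * Y k x + (\<Sum>j\<in>J. a j * Y j x)" for x
    proof -
      have "(\<Sum>j\<in>J. ?a j * Y j x) = (\<Sum>j\<in>J. a j * Y j x)"
        by (rule sum.cong) (use insert.hyps in auto)
      then show ?thesis using insert.hyps by simp
    qed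
    then show "(\<integral>x. U x * cis (t * Y k x) * cis (\<Sum>j\<in>J. a j * Y j x) \<partial>M) = 0"
      using insert.prems(4)[of ?a] by (simp add: cis_mult mult.assoc)
  qed (use insert.prems in auto)
  have "(\<integral>x. (U x * (\<Prod>j\<in>J. indicator (A j) (Y j x))) * indicator (A k) (Y k x) \<partial>M) = 0"
  proof (rule integral_indicator_eq_0_if_trig_eq_0[OF _ _ Yk _ Ak])
    show "(\<lambda>x. U x * (\<Prod>j\<in>J. indicator (A j) (Y j x))) \<in> borel_measurable M"
      by (intro borel_measurable_times borel_measurable_prod insert.prems(1)
          measurable_compose[OF YJ borel_measurable_indicator[OF AJ]])
    show "cmod (U x * (\<Prod>j\<in>J. indicator (A j) (Y j x))) \<le> c" for x
    proof -
      have "cmod (\<Prod>j\<in>J. indicator (A j) (Y j x)) \<le> 1"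
        unfolding prod_norm[symmetric] by (rule prod_le_1) (auto simp: indicator_def)
      then have "cmod (U x) * cmod (\<Prod>j\<in>J. indicator (A j) (Y j x)) \<le> cmod (U x) * 1"
        by (intro mult_left_mono) auto
      then show ?thesis using insert.prems(2)[of x] by (simp add: norm_mult)
    qed
    show "(\<integral>x. U x * (\<Prod>j\<in>J. indicator (A j) (Y j x)) * cis (a * Y k x) \<partial>M) = 0" for a
      using step[of a] by (simp add: mult_ac)
  qed
  then show ?case using insert.hyps by (simp add: mult_ac)
qed

text \<open>The previous lemma is used twice. A character of Z minus its mean annihilates the
  characters of Y, hence the event about Y; then the indicator of that event minus its probability
  annihilates the characters of Z.\<close>

lemma prob_factor_if_trig_factor:
  fixes Y :: "'i \<Rightarrow> 'a \<Rightarrow> real" and Z :: "'j \<Rightarrow> 'a \<Rightarrow> real"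
  assumes J: "finite J" "\<And>j. j \<in> J \<Longrightarrow> Y j \<in> borel_measurable M" "\<And>j. j \<in> J \<Longrightarrow> A j \<in> sets borel"
    and I: "finite I" "\<And>i. i \<in> I \<Longrightarrow> Z i \<in> borel_measurable M" "\<And>i. i \<in> I \<Longrightarrow> C i \<in> sets borel"
    and factor: "\<And>a u. (\<integral>x. cis ((\<Sum>j\<in>J. a j * Y j x) + (\<Sum>i\<in>I. u i * Z i x)) \<partial>M)
      = (\<integral>x. cis (\<Sum>j\<in>J. a j * Y j x) \<partial>M) * (\<integral>x. cis (\<Sum>i\<in>I. u i * Z i x) \<partial>M)"
  shows "prob {x\<in>space M. (\<forall>j\<in>J. Y j x \<in> A j) \<and> (\<forall>i\<in>I. Z i x \<in> C i)}
    = prob {x\<in>space M. \<forall>j\<in>J. Y j x \<in> A j} * prob {x\<in>space M. \<forall>i\<in>I. Z i x \<in> C i}"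
proof -
  note [measurable] = J(2,3) I(2,3)
  define S where "S = {x\<in>space M. \<forall>j\<in>J. Y j x \<in> A j}"
  define Q where "Q = {x\<in>space M. \<forall>i\<in>I. Z i x \<in> C i}"
  have [measurable]: "S \<in> sets M" "Q \<in> sets M" unfolding S_def Q_def using J(1) I(1) by measurable
  have cisZ [measurable]: "(\<lambda>x. cis (\<Sum>i\<in>I. u i * Z i x)) \<in> borel_measurable M" for u
    unfolding cis_conv_exp using I(2) by measurable
  have cisY [measurable]: "(\<lambda>x. cis (\<Sum>j\<in>J. a j * Y j x)) \<in> borel_measurable M" for a
    unfolding cis_conv_exp using J(2) by measurable
  have iZ: "integrable M (\<lambda>x. cis (\<Sum>i\<in>I. u i * Z i x))" for u
    by (rule integrable_const_bound[of _ 1]) auto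
  have iY: "integrable M (\<lambda>x. cis (\<Sum>j\<in>J. a j * Y j x))" for a
    by (rule integrable_const_bound[of _ 1]) auto
  have prodS: "(\<Prod>j\<in>J. indicator (A j) (Y j x)) = (indicator S x :: complex)" if "x \<in> space M" for x
    using J(1) that by (auto simp: S_def indicator_def prod_zero_iff intro!: prod.neutral)
  have prodQ: "(\<Prod>i\<in>I. indicator (C i) (Z i x)) = (indicator Q x :: complex)" if "x \<in> space M" for x
    using I(1) that by (auto simp: Q_def indicator_def prod_zero_iff intro!: prod.neutral)
  have 1: "(\<integral>x. cis (\<Sum>i\<in>I. u i * Z i x) * indicator S x \<partial>M)
      = (\<integral>x. cis (\<Sum>i\<in>I. u i * Z i x) \<partial>M) * prob S" for u
  proof -
    define p where "p = (\<integral>x. cis (\<Sum>i\<in>I. u i * Z i x) \<partial>M)"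
    let ?U = "\<lambda>x. cis (\<Sum>i\<in>I. u i * Z i x) - p"
    have "(\<integral>x. ?U x * (\<Prod>j\<in>J. indicator (A j) (Y j x)) \<partial>M) = 0"
    proof (rule integral_prod_indicator_eq_0_if_trig_eq_0[of J _ "1 + cmod p"])
      show "cmod (?U x) \<le> 1 + cmod p" for x
        using norm_triangle_ineq4[of "cis (\<Sum>i\<in>I. u i * Z i x)" p] by simp
      show "(\<integral>x. ?U x * cis (\<Sum>j\<in>J. a j * Y j x) \<partial>M) = 0" for a
      proof -
        have i: "integrable M (\<lambda>x. cis (\<Sum>i\<in>I. u i * Z i x) * cis (\<Sum>j\<in>J. a j * Y j x))"
          by (rule integrable_const_bound[of _ 1]) (auto simp: norm_mult)
        have "(\<integral>x. ?U x * cis (\<Sum>j\<in>J. a j * Y j x) \<partial>M) =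
          (\<integral>x. cis (\<Sum>i\<in>I. u i * Z i x) * cis (\<Sum>j\<in>J. a j * Y j x) - p * cis (\<Sum>j\<in>J. a j * Y j x) \<partial>M)"
          by (rule Bochner_Integration.integral_cong) (auto simp: algebra_simps)
        also have "\<dots> = (\<integral>x. cis (\<Sum>i\<in>I. u i * Z i x) * cis (\<Sum>j\<in>J. a j * Y j x) \<partial>M)
            - p * (\<integral>x. cis (\<Sum>j\<in>J. a j * Y j x) \<partial>M)"
          using i iY by simp
        also have "(\<integral>x. cis (\<Sum>i\<in>I. u i * Z i x) * cis (\<Sum>j\<in>J. a j * Y j x) \<partial>M)
            = (\<integral>x. cis ((\<Sum>j\<in>J. a j * Y j x) + (\<Sum>i\<in>I. u i * Z i x)) \<partial>M)"
          by (simp add: cis_mult add.commute)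
        finally show ?thesis by (simp add: factor p_def)
      qed
    qed (use J in auto)
    then have 0: "(\<integral>x. ?U x * indicator S x \<partial>M) = 0"
      by (simp add: prodS cong: Bochner_Integration.integral_cong)
    have i1: "integrable M (\<lambda>x. cis (\<Sum>i\<in>I. u i * Z i x) * indicator S x)"
      by (rule integrable_const_bound[of _ 1]) (auto simp: norm_mult indicator_def)
    have i2: "integrable M (\<lambda>x. p * indicator S x)"
      by (rule integrable_const_bound[of _ "cmod p"]) (auto simp: norm_mult indicator_def)
    have "(\<integral>x. indicator S x \<partial>M) = complex_of_real (prob S)"
      using integral_complex_of_real[of M "indicator S"] by (simp add: of_real_indicator)
    then have "(\<integral>x. p * indicator S x \<partial>M) = p * prob S" by simp
    then show ?thesis
      using 0 Bochner_Integration.integral_diff[OF i1 i2]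
      unfolding left_diff_distrib p_def[symmetric] by simp
  qed
  let ?V = "\<lambda>x. indicator S x - complex_of_real (prob S)"
  have "(\<integral>x. ?V x * (\<Prod>i\<in>I. indicator (C i) (Z i x)) \<partial>M) = 0"
  proof (rule integral_prod_indicator_eq_0_if_trig_eq_0[of I _ "1 + 1"])
    show "cmod (?V x) \<le> 1 + 1" for x
      by (rule order_trans[OF norm_triangle_ineq4 add_mono]) (auto simp: indicator_def)
    fix u
    have i: "integrable M (\<lambda>x. cis (\<Sum>i\<in>I. u i * Z i x) * indicator S x)"
      by (rule integrable_const_bound[of _ 1]) (auto simp: norm_mult indicator_def)
    have "(\<integral>x. ?V x * cis (\<Sum>i\<in>I. u i * Z i x) \<partial>M)
       = (\<integral>x. cis (\<Sum>i\<in>I. u i * Z i x) * indicator S x - complex_of_real (prob S) * cis (\<Sum>i\<in>I. u i * Z i x) \<partial>M)"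
      by (rule Bochner_Integration.integral_cong) (auto simp: algebra_simps)
    also have "\<dots> = 0" using i iZ 1[of u] by simp
    finally show "(\<integral>x. ?V x * cis (\<Sum>i\<in>I. u i * Z i x) \<partial>M) = 0" .
  qed (use I in auto)
  then have "(\<integral>x. ?V x * indicator Q x \<partial>M) = 0"
    by (simp add: prodQ cong: Bochner_Integration.integral_cong)
  then have "(\<integral>x. complex_of_real ((indicator S x - prob S) * indicator Q x) \<partial>M) = 0"
    by (simp add: of_real_indicator)
  then have "(\<integral>x. (indicator S x - prob S) * indicator Q x \<partial>M) = 0"
    by (simp only: integral_complex_of_real of_real_eq_0_iff)
  moreover have "(indicator S x - prob S) * indicator Q x = indicator (S \<inter> Q) x - prob S * indicator Q x" for x :: 'a
    by (auto simp: indicator_def)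
  moreover have "integrable M (indicator (S \<inter> Q) :: _ \<Rightarrow> real)" "integrable M (indicator Q :: _ \<Rightarrow> real)"
    by (auto simp: emeasure_eq_measure)
  ultimately have "prob (S \<inter> Q) = prob S * prob Q" by simp
  moreover have "S \<inter> Q = {x\<in>space M. (\<forall>j\<in>J. Y j x \<in> A j) \<and> (\<forall>i\<in>I. Z i x \<in> C i)}"
    by (auto simp: S_def Q_def)
  ultimately show ?thesis by (simp add: S_def Q_def)
qed

end

section \<open>Conditioning a fractional Brownian motion on one Gaussian vector\<close>

text \<open>Together with \<open>cov_form\<close> below, these are the terms \<open>Y\<close> and
  \<open>v\<close> of \<open>fBm\<close>, with the variance read as the diagonal of a bilinear form,
  so that orthogonality can be computed on lists.\<close>

definition gauss_comb :: "(real \<Rightarrow> 'a \<Rightarrow> real^'d) \<Rightarrow> (real \<times> (real^'d)) list \<Rightarrow> 'a \<Rightarrow> real" where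
  "gauss_comb B ps \<omega> = (\<Sum>p\<leftarrow>ps. snd p \<bullet> B (fst p) \<omega>)"

definition cov_form :: "real \<Rightarrow> (real \<times> (real^'d)) list \<Rightarrow> (real \<times> (real^'d)) list \<Rightarrow> real" where
  "cov_form H ps qs = (\<Sum>p\<leftarrow>ps. \<Sum>q\<leftarrow>qs. (snd p \<bullet> snd q) * fbm_cov H (fst p) (fst q))"

lemma fbm_cov_commute: "fbm_cov H s t = fbm_cov H t s"
  by (simp add: fbm_cov_def abs_minus_commute)

lemma gauss_comb_append: "gauss_comb B (ps @ qs) \<omega> = gauss_comb B ps \<omega> + gauss_comb B qs \<omega>"
  by (simp add: gauss_comb_def)

lemma cov_form_append1: "cov_form H (ps @ qs) rs = cov_form H ps rs + cov_form H qs rs"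
  by (simp add: cov_form_def)

lemma cov_form_append2: "cov_form H rs (ps @ qs) = cov_form H rs ps + cov_form H rs qs"
  by (induction rs) (simp_all add: cov_form_def)

lemma cov_form_commute: "cov_form H ps qs = cov_form H qs ps"
proof (induction ps)
  case Nil
  show ?case by (induction qs) (simp_all add: cov_form_def)
next
  case (Cons p ps)
  have "cov_form H [p] qs = cov_form H qs [p]"
    by (simp add: cov_form_def fbm_cov_commute[of H "fst p"] inner_commute[of "snd p"])
  then show ?case
    using Cons cov_form_append1[of H "[p]" ps qs] cov_form_append2[of H qs "[p]" ps] by simp
qed

definition neg_coeffs :: "(real \<times> (real^'d)) list \<Rightarrow> (real \<times> (real^'d)) list" where
  "neg_coeffs = map (\<lambda>p. (fst p, - snd p))"

lemma gauss_comb_neg: "gauss_comb B (neg_coeffs ps) \<omega> = - gauss_comb B ps \<omega>"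
  by (induction ps) (simp_all add: gauss_comb_def neg_coeffs_def)

lemma cov_form_neg2:
  fixes ps qs :: "(real \<times> (real^'d)) list"
  shows "cov_form H ps (neg_coeffs qs) = - cov_form H ps qs"
proof -
  have "(\<Sum>q\<leftarrow>neg_coeffs qs. (snd p \<bullet> snd q) * fbm_cov H (fst p) (fst q))
      = - (\<Sum>q\<leftarrow>qs. (snd p \<bullet> snd q) * fbm_cov H (fst p) (fst q))" for p :: "real \<times> (real^'d)"
    by (induction qs) (simp_all add: neg_coeffs_def)
  then show ?thesis
    by (induction ps) (simp_all add: cov_form_def)
qed

lemma cov_form_neg: "cov_form H (neg_coeffs ps) (neg_coeffs qs) = cov_form H ps qs"
  by (simp add: cov_form_neg2 cov_form_commute[of H "neg_coeffs ps"] cov_form_commute[of H qs])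

lemma Int_stable_boxes: "Int_stable (range (\<lambda>(a, b). box a b :: 'a::euclidean_space set))"
proof (rule Int_stableI)
  fix S S' :: "'a set" assume "S \<in> range (\<lambda>(a, b). box a b)" "S' \<in> range (\<lambda>(a, b). box a b)"
  then obtain a b a' b' where "S = box a b" "S' = box a' b'" by auto
  then have "S \<inter> S' = (\<lambda>(a, b). box a b) (\<Sum>i\<in>Basis. max (a \<bullet> i) (a' \<bullet> i) *\<^sub>R i, \<Sum>i\<in>Basis. min (b \<bullet> i) (b' \<bullet> i) *\<^sub>R i)"
    by (simp add: box_Int_box)
  then show "S \<inter> S' \<in> range (\<lambda>(a, b). box a b)" by (rule range_eqI)
qed

section \<open>Characteristic functions and variances of Gaussian combinations\<close>

locale fbm_process =
  fixes M :: "'a measure" and H :: real and B :: "real \<Rightarrow> 'a \<Rightarrow> real^'d"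
  assumes fBm: "fBm M H B"

sublocale fbm_process \<subseteq> prob_space M
  using fBm by (simp add: fBm_def)

context fbm_process
begin

lemma fbm_measurable [measurable (raw)]: "0 \<le> t \<Longrightarrow> B t \<in> borel_measurable M"
  using fBm by (simp add: fBm_def)

lemma gauss_comb_measurable:
  assumes "\<forall>p\<in>set ps. 0 \<le> fst p"
  shows "gauss_comb B ps \<in> borel_measurable M"
  using assms
proof (induction ps)
  case (Cons p ps)
  have "(\<lambda>\<omega>. snd p \<bullet> B (fst p) \<omega> + gauss_comb B ps \<omega>) \<in> borel_measurable M"
    using Cons by (intro borel_measurable_add borel_measurable_inner) (auto intro: fbm_measurable)
  then show ?case by (simp add: gauss_comb_def[abs_def])
qed (simp add: gauss_comb_def[abs_def])

lemma gauss_comb_distributed: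
  assumes "\<forall>p\<in>set ps. 0 \<le> fst p" "cov_form H ps ps \<noteq> 0"
  shows "distributed M lborel (gauss_comb B ps) (\<lambda>y. ennreal (normal_density 0 (sqrt (cov_form H ps ps)) y))"
  using fBm assms by (simp add: fBm_def Let_def gauss_comb_def[abs_def] cov_form_def split: if_splits)

text \<open>\<open>sqrt\<close> of a negative number is negative, and the normal density depends on
  its scale only through the square. Hence the absolute value gives the standard deviation whatever
  the sign of the form.\<close>

lemma gauss_comb_std:
  assumes ps: "\<forall>p\<in>set ps. 0 \<le> fst p" and v: "cov_form H ps ps \<noteq> 0"
  shows "distributed M lborel (\<lambda>\<omega>. gauss_comb B ps \<omega> / sqrt \<bar>cov_form H ps ps\<bar>) std_normal_density"
proof -
  let ?v = "cov_form H ps ps"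
  have "distributed M lborel (gauss_comb B ps) (\<lambda>y. ennreal (normal_density 0 (sqrt ?v) y))"
    by (rule gauss_comb_distributed[OF ps v])
  moreover have "normal_density 0 (sqrt ?v) y = normal_density 0 (sqrt \<bar>?v\<bar>) y" for y
  proof -
    have "(sqrt ?v)\<^sup>2 = (sqrt \<bar>?v\<bar>)\<^sup>2" by (simp add: real_sqrt_power[symmetric] del: real_sqrt_pow2)
    then show ?thesis by (simp add: normal_density_def)
  qed
  ultimately have "distributed M lborel (gauss_comb B ps) (\<lambda>y. ennreal (normal_density 0 (sqrt \<bar>?v\<bar>) y))"
    by simp
  then show ?thesis
    using normal_standard_normal_convert[of "sqrt \<bar>?v\<bar>" "gauss_comb B ps" 0] v by simp
qed

lemma gauss_comb_trig:
  assumes ps: "\<forall>p\<in>set ps. 0 \<le> fst p"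
  shows "(\<integral>\<omega>. cis (gauss_comb B ps \<omega>) \<partial>M) = complex_of_real (exp (- \<bar>cov_form H ps ps\<bar> / 2))"
proof (cases "cov_form H ps ps = 0")
  case True
  have [measurable]: "gauss_comb B ps \<in> borel_measurable M" by (rule gauss_comb_measurable[OF ps])
  have "AE \<omega> in M. gauss_comb B ps \<omega> = 0"
    using fBm ps True by (simp add: fBm_def Let_def gauss_comb_def[abs_def] cov_form_def split: if_splits)
  then have "(\<integral>\<omega>. cis (gauss_comb B ps \<omega>) \<partial>M) = (\<integral>\<omega>. 1 \<partial>M)"
    by (intro integral_cong_AE) (auto simp: cis_conv_exp)
  then show ?thesis using True by (simp add: prob_space)
next
  case False
  define s where "s = sqrt \<bar>cov_form H ps ps\<bar>"
  have s: "s \<noteq> 0" "s\<^sup>2 = \<bar>cov_form H ps ps\<bar>" using False by (auto simp: s_def)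
  let ?Z = "\<lambda>\<omega>. gauss_comb B ps \<omega> / s"
  have D: "distributed M lborel ?Z std_normal_density"
    using gauss_comb_std[OF ps False] by (simp add: s_def)
  have [measurable]: "gauss_comb B ps \<in> borel_measurable M" by (rule gauss_comb_measurable[OF ps])
  have [measurable]: "(\<lambda>x::real. iexp (s * x)) \<in> borel_measurable borel" by measurable
  have "(\<integral>\<omega>. cis (gauss_comb B ps \<omega>) \<partial>M) = (\<integral>\<omega>. iexp (s * ?Z \<omega>) \<partial>M)"
    using s(1) by (simp add: cis_conv_exp)
  also have "\<dots> = (\<integral>x. iexp (s * x) \<partial>distr M lborel ?Z)"
    by (rule integral_distr[symmetric]) auto
  also have "\<dots> = char std_normal_distribution s"
    unfolding distributed_distr_eq_density[OF D] char_def ..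
  also have "\<dots> = complex_of_real (exp (- \<bar>cov_form H ps ps\<bar> / 2))"
    by (simp add: char_std_normal_distribution s)
  finally show ?thesis .
qed

lemma gauss_comb_second_moment:
  assumes ps: "\<forall>p\<in>set ps. 0 \<le> fst p"
  shows "integrable M (\<lambda>\<omega>. (gauss_comb B ps \<omega>)\<^sup>2)"
    and "(\<integral>\<omega>. (gauss_comb B ps \<omega>)\<^sup>2 \<partial>M) = \<bar>cov_form H ps ps\<bar>"
proof -
  have gm [measurable]: "gauss_comb B ps \<in> borel_measurable M" by (rule gauss_comb_measurable[OF ps])
  have "integrable M (\<lambda>\<omega>. (gauss_comb B ps \<omega>)\<^sup>2) \<and>
     (\<integral>\<omega>. (gauss_comb B ps \<omega>)\<^sup>2 \<partial>M) = \<bar>cov_form H ps ps\<bar>"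
  proof (cases "cov_form H ps ps = 0")
    case True
    have "AE \<omega> in M. gauss_comb B ps \<omega> = 0"
      using fBm ps True by (simp add: fBm_def Let_def gauss_comb_def[abs_def] cov_form_def split: if_splits)
    then have ae: "AE \<omega> in M. (gauss_comb B ps \<omega>)\<^sup>2 = 0" by auto
    then have "integrable M (\<lambda>\<omega>. (gauss_comb B ps \<omega>)\<^sup>2) = integrable M (\<lambda>\<omega>. 0 :: real)"
      by (intro integrable_cong_AE) auto
    moreover have "(\<integral>\<omega>. (gauss_comb B ps \<omega>)\<^sup>2 \<partial>M) = (\<integral>\<omega>. 0 \<partial>M)"
      using ae by (intro integral_cong_AE) auto
    ultimately show ?thesis using True by simp
  next
    case False
    define s where "s = sqrt \<bar>cov_form H ps ps\<bar>"
    have s: "s \<noteq> 0" "s\<^sup>2 = \<bar>cov_form H ps ps\<bar>" using False by (auto simp: s_def)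
    let ?Z = "\<lambda>\<omega>. gauss_comb B ps \<omega> / s"
    have D: "distributed M lborel ?Z std_normal_density"
      using gauss_comb_std[OF ps False] by (simp add: s_def)
    have i: "integrable std_normal_distribution (\<lambda>x. x\<^sup>2)"
      "(\<integral>x. x\<^sup>2 \<partial>std_normal_distribution) = 1"
      using integrable_std_normal_distribution_moment[of 2]
        std_normal_distribution_even_moments[of 1] by (auto simp: fact_numeral)
    have "integrable M (\<lambda>\<omega>. (?Z \<omega>)\<^sup>2)"
      using i(1) unfolding distributed_distr_eq_density[OF D, symmetric]
      by (subst (asm) integrable_distr_eq) auto
    then have "integrable M (\<lambda>\<omega>. s\<^sup>2 * (?Z \<omega>)\<^sup>2)" by (rule integrable_mult_right)
    moreover have "(\<integral>\<omega>. (?Z \<omega>)\<^sup>2 \<partial>M) = 1"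
      using i(2) unfolding distributed_distr_eq_density[OF D, symmetric]
      by (subst (asm) integral_distr) auto
    then have "(\<integral>\<omega>. s\<^sup>2 * (?Z \<omega>)\<^sup>2 \<partial>M) = s\<^sup>2" by simp
    moreover have "s\<^sup>2 * (?Z \<omega>)\<^sup>2 = (gauss_comb B ps \<omega>)\<^sup>2" for \<omega>
      using s(1) by (simp add: power_divide)
    ultimately show ?thesis unfolding s(2)[symmetric] by (simp only: simp_thms)
  qed
  then show "integrable M (\<lambda>\<omega>. (gauss_comb B ps \<omega>)\<^sup>2)"
    "(\<integral>\<omega>. (gauss_comb B ps \<omega>)\<^sup>2 \<partial>M) = \<bar>cov_form H ps ps\<bar>" by auto
qed

text \<open>The definition of \<^const>\<open>fBm\<close> only determines the absolute value of the variance (a density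
  with negative scale parameter is still normal), so the signs are recovered from the
  parallelogram identity.\<close>

lemma abs_cov_form_add:
  fixes ps qs :: "(real \<times> (real^'d)) list"
  assumes ps: "\<forall>p\<in>set ps. 0 \<le> fst p" and qs: "\<forall>p\<in>set qs. 0 \<le> fst p"
    and orth: "cov_form H ps qs = 0"
  shows "\<bar>cov_form H (ps @ qs) (ps @ qs)\<bar> = \<bar>cov_form H ps ps\<bar> + \<bar>cov_form H qs qs\<bar>"
proof -
  let ?X = "gauss_comb B ps" and ?Y = "gauss_comb B qs"
  have nq: "\<forall>p\<in>set (neg_coeffs qs). 0 \<le> fst p" using qs by (auto simp: neg_coeffs_def)
  have pq: "\<forall>p\<in>set (ps @ qs). 0 \<le> fst p" "\<forall>p\<in>set (ps @ neg_coeffs qs). 0 \<le> fst p"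
    using ps qs nq by auto
  have v: "cov_form H (ps @ neg_coeffs qs) (ps @ neg_coeffs qs) = cov_form H (ps @ qs) (ps @ qs)"
    using orth by (simp add: cov_form_append1 cov_form_append2 cov_form_neg cov_form_neg2
        cov_form_commute[of H "neg_coeffs qs"] cov_form_commute[of H qs ps])
  note mX = gauss_comb_second_moment[OF ps] and mY = gauss_comb_second_moment[OF qs]
  have 1: "integrable M (\<lambda>\<omega>. (?X \<omega> + ?Y \<omega>)\<^sup>2)"
    "(\<integral>\<omega>. (?X \<omega> + ?Y \<omega>)\<^sup>2 \<partial>M) = \<bar>cov_form H (ps @ qs) (ps @ qs)\<bar>"
    using gauss_comb_second_moment[OF pq(1)] by (simp_all add: gauss_comb_append)
  have 2: "integrable M (\<lambda>\<omega>. (?X \<omega> - ?Y \<omega>)\<^sup>2)"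
    "(\<integral>\<omega>. (?X \<omega> - ?Y \<omega>)\<^sup>2 \<partial>M) = \<bar>cov_form H (ps @ qs) (ps @ qs)\<bar>"
    using gauss_comb_second_moment[OF pq(2)] by (simp_all add: gauss_comb_append gauss_comb_neg v)
  have "(\<integral>\<omega>. (?X \<omega> + ?Y \<omega>)\<^sup>2 + (?X \<omega> - ?Y \<omega>)\<^sup>2 \<partial>M) = (\<integral>\<omega>. 2 * (?X \<omega>)\<^sup>2 + 2 * (?Y \<omega>)\<^sup>2 \<partial>M)"
    by (rule Bochner_Integration.integral_cong) (auto simp: power2_eq_square algebra_simps)
  then show ?thesis using 1 2 mX mY by simp
qed

text \<open>Orthogonal lists have additive variances by \<open>abs_cov_form_add\<close>, so the
  Gaussian exponents add: uncorrelated combinations are independent at the level of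
  characters.\<close>

lemma gauss_comb_trig_factor:
  assumes ps: "\<forall>p\<in>set ps. 0 \<le> fst p" and qs: "\<forall>p\<in>set qs. 0 \<le> fst p"
    and orth: "cov_form H ps qs = 0"
  shows "(\<integral>\<omega>. cis (gauss_comb B ps \<omega> + gauss_comb B qs \<omega>) \<partial>M)
    = (\<integral>\<omega>. cis (gauss_comb B ps \<omega>) \<partial>M) * (\<integral>\<omega>. cis (gauss_comb B qs \<omega>) \<partial>M)"
proof -
  have pq: "\<forall>p\<in>set (ps @ qs). 0 \<le> fst p" using ps qs by auto
  show ?thesis
    using gauss_comb_trig[OF pq] gauss_comb_trig[OF ps] gauss_comb_trig[OF qs] abs_cov_form_add[OF assms]
    by (simp add: gauss_comb_append exp_add[symmetric] add_divide_distrib flip: of_real_mult)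
qed

end

text \<open>Entries of \<open>ts\<close> are pairs of a time and a scalar weight. Scalar weights
  treat all coordinates alike, so the pivot has independent coordinates of equal variance, and
  regression on it needs one scalar per time rather than a matrix.\<close>

locale fbm_conditioning = fbm_process M H B
  for M :: "'a measure" and H :: real and B :: "real \<Rightarrow> 'a \<Rightarrow> real^'d" +
  fixes ts :: "(real \<times> real) list"
  assumes times: "\<forall>p\<in>set ts. 0 \<le> fst p"
begin

definition pivot :: "'a \<Rightarrow> real^'d" where
  "pivot \<omega> = (\<Sum>p\<leftarrow>ts. snd p *\<^sub>R B (fst p) \<omega>)"

definition pivot_cov :: "real \<Rightarrow> real" where
  "pivot_cov t = (\<Sum>p\<leftarrow>ts. snd p * fbm_cov H (fst p) t)"

definition pivot_var :: real where
  "pivot_var = (\<Sum>p\<leftarrow>ts. snd p * pivot_cov (fst p))"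

text \<open>The remainder of linear regression on the pivot: \<open>pivot_cov t\<close> is the
  covariance of a coordinate of the pivot with the same coordinate of \<open>B t\<close>, and
  \<open>pivot_var\<close> is the variance of that coordinate.\<close>

definition residual :: "real \<Rightarrow> 'a \<Rightarrow> real^'d" where
  "residual t \<omega> = B t \<omega> - (pivot_cov t / pivot_var) *\<^sub>R pivot \<omega>"

definition pivot_list :: "real^'d \<Rightarrow> (real \<times> (real^'d)) list" where
  "pivot_list u = map (\<lambda>p. (fst p, snd p *\<^sub>R u)) ts"

lemma pivot_list_times: "\<forall>p\<in>set (pivot_list u). 0 \<le> fst p"
  using times by (auto simp: pivot_list_def)

lemma gauss_comb_pivot_list: "gauss_comb B (pivot_list u) \<omega> = u \<bullet> pivot \<omega>"
  unfolding gauss_comb_def pivot_list_def pivot_def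
  by (induction ts) (simp_all add: inner_add_right)

lemma cov_form_pivot_single: "cov_form H (pivot_list u) [q] = (u \<bullet> snd q) * pivot_cov (fst q)"
  unfolding cov_form_def pivot_list_def pivot_cov_def
  by (induction ts) (simp_all add: algebra_simps)

lemma cov_form_pivot: "cov_form H (pivot_list u) qs = (\<Sum>q\<leftarrow>qs. (u \<bullet> snd q) * pivot_cov (fst q))"
proof (induction qs)
  case Nil
  show ?case by (simp add: cov_form_commute[of H _ "[]"]) (simp add: cov_form_def)
next
  case (Cons q qs)
  then show ?case
    using cov_form_append2[of H "pivot_list u" "[q]" qs] cov_form_pivot_single by simp
qed

lemma cov_form_pivot_pivot: "cov_form H (pivot_list u) (pivot_list w) = (u \<bullet> w) * pivot_var"
  unfolding cov_form_pivot
  by (simp add: pivot_var_def pivot_list_def comp_def sum_list_const_mult[symmetric] mult_ac)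

lemma pivot_measurable [measurable]: "pivot \<in> borel_measurable M"
proof -
  have "(\<lambda>\<omega>. \<Sum>p\<leftarrow>xs. snd p *\<^sub>R B (fst p) \<omega>) \<in> borel_measurable M"
    if "\<forall>p\<in>set xs. 0 \<le> fst p" for xs
    using that
  proof (induction xs)
    case (Cons p xs)
    then show ?case
      by (auto intro!: borel_measurable_add borel_measurable_scaleR fbm_measurable)
  qed simp
  from this[OF times] show ?thesis by (simp add: pivot_def[abs_def])
qed

lemma residual_measurable [measurable (raw)]: "0 \<le> t \<Longrightarrow> residual t \<in> borel_measurable M"
  unfolding residual_def[abs_def] by (auto intro!: borel_measurable_diff borel_measurable_scaleR fbm_measurable)

text \<open>An entry (t, v) of \<open>js\<close> stands for the component of
  \<open>residual t\<close> along v. Unfolding it into values of B makes weighted sums of such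
  components accessible to \<open>gauss_comb_trig_factor\<close>.\<close>

definition residual_list :: "(real \<times> (real^'d) \<Rightarrow> real) \<Rightarrow> (real \<times> (real^'d)) list \<Rightarrow> (real \<times> (real^'d)) list" where
  "residual_list a js = concat (map (\<lambda>j. (fst j, a j *\<^sub>R snd j) #
     pivot_list (- (a j * (pivot_cov (fst j) / pivot_var)) *\<^sub>R snd j)) js)"

lemma residual_list_times:
  "\<forall>j\<in>set js. 0 \<le> fst j \<Longrightarrow> \<forall>p\<in>set (residual_list a js). 0 \<le> fst p"
  using pivot_list_times by (fastforce simp: residual_list_def)

lemma gauss_comb_residual_list:
  "gauss_comb B (residual_list a js) \<omega> = (\<Sum>j\<leftarrow>js. a j * (residual (fst j) \<omega> \<bullet> snd j))"
proof (induction js)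
  case (Cons j js)
  have "gauss_comb B (residual_list a (j # js)) \<omega>
      = (a j *\<^sub>R snd j) \<bullet> B (fst j) \<omega>
        + gauss_comb B (pivot_list (- (a j * (pivot_cov (fst j) / pivot_var)) *\<^sub>R snd j)) \<omega>
        + gauss_comb B (residual_list a js) \<omega>"
    by (simp add: residual_list_def gauss_comb_append) (simp add: gauss_comb_def)
  then show ?case
    using Cons by (simp add: gauss_comb_pivot_list residual_def algebra_simps inner_diff_left inner_commute)
qed (simp add: residual_list_def gauss_comb_def)

text \<open>The normal equation of regression: in each entry the covariance with the value of B
  cancels against that with the subtracted multiple of the pivot.\<close>

lemma cov_form_pivot_residual:
  assumes "pivot_var \<noteq> 0"
  shows "cov_form H (pivot_list u) (residual_list a js) = 0"
proof (induction js)
  case Nil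
  show ?case by (simp add: residual_list_def cov_form_pivot)
next
  case (Cons j js)
  let ?w = "- (a j * (pivot_cov (fst j) / pivot_var)) *\<^sub>R snd j"
  have "residual_list a (j # js) = [(fst j, a j *\<^sub>R snd j)] @ (pivot_list ?w @ residual_list a js)"
    by (simp add: residual_list_def)
  then have "cov_form H (pivot_list u) (residual_list a (j # js))
     = (u \<bullet> (a j *\<^sub>R snd j)) * pivot_cov (fst j) + (u \<bullet> ?w) * pivot_var"
    by (simp only: cov_form_append2 cov_form_pivot_single cov_form_pivot_pivot Cons fst_conv snd_conv add_0_right)
  also have "\<dots> = 0" using assms by simp
  finally show ?case .
qed

lemma inner_pivot_eq_sum: "finite I \<Longrightarrow> (\<Sum>i\<in>I. u i * (pivot \<omega> \<bullet> i)) = gauss_comb B (pivot_list (\<Sum>i\<in>I. u i *\<^sub>R i)) \<omega>"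
  by (simp add: gauss_comb_pivot_list inner_sum_left inner_commute[of "pivot \<omega>"])

lemma prob_residual_pivot:
  assumes v: "pivot_var \<noteq> 0" and J: "finite J" "\<And>j. j \<in> J \<Longrightarrow> 0 \<le> fst j"
    and A: "\<And>j. j \<in> J \<Longrightarrow> A j \<in> sets borel" and C: "\<And>i. i \<in> Basis \<Longrightarrow> C i \<in> sets borel"
  shows "prob {\<omega>\<in>space M. (\<forall>j\<in>J. residual (fst j) \<omega> \<bullet> snd j \<in> A j) \<and> (\<forall>i\<in>Basis. pivot \<omega> \<bullet> i \<in> C i)}
    = prob {\<omega>\<in>space M. \<forall>j\<in>J. residual (fst j) \<omega> \<bullet> snd j \<in> A j}
      * prob {\<omega>\<in>space M. \<forall>i\<in>Basis. pivot \<omega> \<bullet> i \<in> C i}"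
proof (rule prob_factor_if_trig_factor[where Y="\<lambda>j \<omega>. residual (fst j) \<omega> \<bullet> snd j" and Z="\<lambda>i \<omega>. pivot \<omega> \<bullet> i"])
  fix a u
  obtain js where js: "set js = J" "distinct js" using finite_distinct_list[OF J(1)] by blast
  have Y: "(\<Sum>j\<in>J. a j * (residual (fst j) \<omega> \<bullet> snd j)) = gauss_comb B (residual_list a js) \<omega>" for \<omega>
    using js by (simp add: gauss_comb_residual_list sum_list_distinct_conv_sum_set)
  have t: "\<forall>p\<in>set (residual_list a js). 0 \<le> fst p"
    using J(2) js by (intro residual_list_times) auto
  show "(\<integral>x. cis ((\<Sum>j\<in>J. a j * (residual (fst j) x \<bullet> snd j)) + (\<Sum>i\<in>Basis. u i * (pivot x \<bullet> i))) \<partial>M)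
      = (\<integral>x. cis (\<Sum>j\<in>J. a j * (residual (fst j) x \<bullet> snd j)) \<partial>M) * (\<integral>x. cis (\<Sum>i\<in>Basis. u i * (pivot x \<bullet> i)) \<partial>M)"
    unfolding Y inner_pivot_eq_sum[OF finite_Basis]
    by (rule gauss_comb_trig_factor[OF t pivot_list_times])
       (simp add: cov_form_commute[of H "residual_list a js"] cov_form_pivot_residual[OF v])
qed (use assms in \<open>auto intro!: borel_measurable_inner residual_measurable\<close>)

text \<open>Different basis vectors are orthogonal, so the corresponding coordinates are
  uncorrelated and can be split off one at a time.\<close>

lemma prob_pivot_coordinates:
  assumes I: "finite I" "I \<subseteq> Basis" and C: "\<And>i. i \<in> Basis \<Longrightarrow> C i \<in> sets borel"
  shows "prob {\<omega>\<in>space M. \<forall>i\<in>I. pivot \<omega> \<bullet> i \<in> C i} = (\<Prod>i\<in>I. prob {\<omega>\<in>space M. pivot \<omega> \<bullet> i \<in> C i})"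
  using I
proof (induction I rule: finite_induct)
  case empty
  then show ?case by (simp add: prob_space)
next
  case (insert k I)
  have "prob {\<omega>\<in>space M. (\<forall>j\<in>{k}. pivot \<omega> \<bullet> j \<in> C j) \<and> (\<forall>i\<in>I. pivot \<omega> \<bullet> i \<in> C i)}
    = prob {\<omega>\<in>space M. \<forall>j\<in>{k}. pivot \<omega> \<bullet> j \<in> C j} * prob {\<omega>\<in>space M. \<forall>i\<in>I. pivot \<omega> \<bullet> i \<in> C i}"
  proof (rule prob_factor_if_trig_factor[where Y="\<lambda>j \<omega>. pivot \<omega> \<bullet> j" and Z="\<lambda>i \<omega>. pivot \<omega> \<bullet> i"])
    fix a u :: "real^'d \<Rightarrow> real"
    have "k \<bullet> i = 0" if "i \<in> I" for i
      using that insert.hyps insert.prems by (intro inner_not_same_Basis) auto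
    then have "(\<Sum>i\<in>{k}. a i *\<^sub>R i) \<bullet> (\<Sum>i\<in>I. u i *\<^sub>R i) = 0"
      by (simp add: inner_sum_right)
    then show "(\<integral>x. cis ((\<Sum>j\<in>{k}. a j * (pivot x \<bullet> j)) + (\<Sum>i\<in>I. u i * (pivot x \<bullet> i))) \<partial>M)
      = (\<integral>x. cis (\<Sum>j\<in>{k}. a j * (pivot x \<bullet> j)) \<partial>M) * (\<integral>x. cis (\<Sum>i\<in>I. u i * (pivot x \<bullet> i)) \<partial>M)"
      unfolding inner_pivot_eq_sum[OF insert.hyps(1)] inner_pivot_eq_sum[OF finite.insertI[OF finite.emptyI]]
      by (intro gauss_comb_trig_factor pivot_list_times) (simp add: cov_form_pivot_pivot)
  qed (use insert C in auto)
  then show ?case using insert by simp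
qed

lemma pivot_coordinate_distributed:
  assumes v: "0 < pivot_var" and i: "i \<in> Basis"
  shows "distributed M lborel (\<lambda>\<omega>. pivot \<omega> \<bullet> i) (\<lambda>y. ennreal (normal_density 0 (sqrt pivot_var) y))"
proof -
  have c: "cov_form H (pivot_list i) (pivot_list i) = pivot_var"
    using i by (simp add: cov_form_pivot_pivot)
  have eq: "gauss_comb B (pivot_list i) = (\<lambda>\<omega>. pivot \<omega> \<bullet> i)"
    by (auto simp: gauss_comb_pivot_list inner_commute)
  show ?thesis
    using gauss_comb_distributed[OF pivot_list_times, of i] v unfolding c eq by simp
qed

definition pivot_density :: "real^'d \<Rightarrow> real" where
  "pivot_density g = (\<Prod>i\<in>Basis. normal_density 0 (sqrt pivot_var) (g \<bullet> i))"

lemma pivot_density_measurable [measurable]: "pivot_density \<in> borel_measurable borel"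
  unfolding pivot_density_def[abs_def] by measurable

lemma pivot_law:
  assumes v: "0 < pivot_var"
  shows "distr M borel pivot = density lborel (\<lambda>g. ennreal (pivot_density g))"
proof -
  let ?D = "density lborel (\<lambda>g. ennreal (pivot_density g))"
  let ?E = "range (\<lambda>(a, b). box a b :: (real^'d) set)"
  have nd: "0 \<le> normal_density 0 (sqrt pivot_var) y" for y by simp
  have box: "emeasure (distr M borel pivot) (box a b) = emeasure ?D (box a b)" for a b
  proof -
    have boxI: "x \<in> box a b \<longleftrightarrow> (\<forall>i\<in>Basis. x \<bullet> i \<in> {a \<bullet> i<..<b \<bullet> i})" for x by (auto simp: mem_box)
    have "emeasure (distr M borel pivot) (box a b) = prob {\<omega>\<in>space M. \<forall>i\<in>Basis. pivot \<omega> \<bullet> i \<in> {a \<bullet> i<..<b \<bullet> i}}"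
      by (subst emeasure_distr) (auto simp: emeasure_eq_measure boxI intro!: arg_cong[where f=prob])
    also have "\<dots> = ennreal (\<Prod>i\<in>Basis. prob {\<omega>\<in>space M. pivot \<omega> \<bullet> i \<in> {a \<bullet> i<..<b \<bullet> i}})"
      by (subst prob_pivot_coordinates) auto
    also have "\<dots> = (\<Prod>i\<in>Basis. emeasure M {\<omega>\<in>space M. pivot \<omega> \<bullet> i \<in> {a \<bullet> i<..<b \<bullet> i}})"
      by (simp add: prod_ennreal emeasure_eq_measure)
    also have "\<dots> = (\<Prod>i\<in>Basis. \<integral>\<^sup>+y. ennreal (normal_density 0 (sqrt pivot_var) y) * indicator {a \<bullet> i<..<b \<bullet> i} y \<partial>lborel)"
    proof (rule prod.cong)
      fix i :: "real^'d" assume i: "i \<in> Basis"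
      have "{\<omega>\<in>space M. pivot \<omega> \<bullet> i \<in> {a \<bullet> i<..<b \<bullet> i}} = (\<lambda>\<omega>. pivot \<omega> \<bullet> i) -` {a \<bullet> i<..<b \<bullet> i} \<inter> space M" by auto
      then show "emeasure M {\<omega>\<in>space M. pivot \<omega> \<bullet> i \<in> {a \<bullet> i<..<b \<bullet> i}} =
        (\<integral>\<^sup>+y. ennreal (normal_density 0 (sqrt pivot_var) y) * indicator {a \<bullet> i<..<b \<bullet> i} y \<partial>lborel)"
        using distributed_emeasure[OF pivot_coordinate_distributed[OF v i], of "{a \<bullet> i<..<b \<bullet> i}"] by simp
    qed simp
    also have "\<dots> = (\<integral>\<^sup>+x. (\<Prod>i\<in>Basis. ennreal (normal_density 0 (sqrt pivot_var) (x \<bullet> i)) * indicator {a \<bullet> i<..<b \<bullet> i} (x \<bullet> i)) \<partial>lborel)"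
      by (rule nn_integral_lborel_prod[symmetric]) auto
    also have "\<dots> = (\<integral>\<^sup>+x. ennreal (pivot_density x) * indicator (box a b) x \<partial>lborel)"
    proof (rule nn_integral_cong)
      fix x :: "real^'d"
      have "(\<Prod>i\<in>Basis. indicator {a \<bullet> i<..<b \<bullet> i} (x \<bullet> i)) = (indicator (box a b) x :: ennreal)"
        by (auto simp: indicator_def mem_box prod_zero_iff intro!: prod.neutral)
      then show "(\<Prod>i\<in>Basis. ennreal (normal_density 0 (sqrt pivot_var) (x \<bullet> i)) * indicator {a \<bullet> i<..<b \<bullet> i} (x \<bullet> i))
          = ennreal (pivot_density x) * indicator (box a b) x"
        by (simp add: prod.distrib pivot_density_def prod_ennreal)
    qed
    also have "\<dots> = emeasure ?D (box a b)"
      by (simp add: emeasure_density)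
    finally show ?thesis .
  qed
  show ?thesis
  proof (rule measure_eqI_generator_eq[where E="?E" and \<Omega>=UNIV and A="\<lambda>n. box (- real n *\<^sub>R One) (real n *\<^sub>R One)"])
    show "Int_stable ?E"
      by (rule Int_stable_boxes)
    show "sets (distr M borel pivot) = sigma_sets UNIV ?E" "sets ?D = sigma_sets UNIV ?E"
      by (simp_all add: borel_eq_box)
    show "(\<Union>n. box (- real n *\<^sub>R One) (real n *\<^sub>R One)) = (UNIV :: (real^'d) set)"
      using UN_box_eq_UNIV by auto
    show "emeasure (distr M borel pivot) (box (- real n *\<^sub>R One) (real n *\<^sub>R One)) \<noteq> \<infinity>" for n
      using finite_measure.emeasure_finite[OF prob_space.finite_measure[OF prob_space_distr[OF pivot_measurable]]]
      by simp
  qed (use box in auto)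
qed

text \<open>The \<sigma>-algebra generated by the residual process, kept on the original sample
  space: \<omega> itself stands for the residual path, which avoids a space of paths. The
  finite-dimensional cylinders form an intersection-stable generator.\<close>

definition residual_algebra :: "'a measure" where
  "residual_algebra = sigma (space M)
    {{\<omega>\<in>space M. \<forall>j\<in>J. residual (fst j) \<omega> \<bullet> snd j \<in> A j} | J A.
      finite J \<and> (\<forall>j\<in>J. 0 \<le> fst j) \<and> (\<forall>j. A j \<in> sets borel)}"

lemma space_residual_algebra [simp]: "space residual_algebra = space M"
  by (simp add: residual_algebra_def space_measure_of_conv)

lemma residual_algebra_generator_events:
  assumes "finite J" "\<forall>j\<in>J. 0 \<le> fst j" "\<forall>j. A j \<in> sets borel"
  shows "{\<omega>\<in>space M. \<forall>j\<in>J. residual (fst j) \<omega> \<bullet> snd j \<in> A j} \<in> events"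
proof -
  have "(\<lambda>\<omega>. residual (fst j) \<omega> \<bullet> snd j) \<in> borel_measurable M" if "j \<in> J" for j
    using that assms(2) by (intro borel_measurable_inner residual_measurable) auto
  then have "{\<omega>\<in>space M. residual (fst j) \<omega> \<bullet> snd j \<in> A j} \<in> events" if "j \<in> J" for j
    using that assms(3) by measurable
  then show ?thesis using assms(1) by (intro sets.sets_Collect_finite_All) auto
qed

lemma residual_measurable_algebra:
  assumes "0 \<le> t"
  shows "residual t \<in> borel_measurable residual_algebra"
proof (rule borel_measurable_euclidean_space[THEN iffD2], intro ballI measurableI)
  fix i :: "real^'d" and S :: "real set" assume "S \<in> sets borel"
  then have "{\<omega>\<in>space M. \<forall>j\<in>{(t, i)}. residual (fst j) \<omega> \<bullet> snd j \<in> (\<lambda>_. S) j} \<in> sets residual_algebra"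
    unfolding residual_algebra_def using assms
    by (intro in_measure_of CollectI exI[of _ "{(t, i)}"] exI[of _ "\<lambda>_. S"]) auto
  moreover have "(\<lambda>\<omega>. residual t \<omega> \<bullet> i) -` S \<inter> space residual_algebra = {\<omega>\<in>space M. \<forall>j\<in>{(t, i)}. residual (fst j) \<omega> \<bullet> snd j \<in> (\<lambda>_. S) j}"
    by auto
  ultimately show "(\<lambda>\<omega>. residual t \<omega> \<bullet> i) -` S \<inter> space residual_algebra \<in> sets residual_algebra" by simp
qed auto

text \<open>Independence on two intersection-stable generators, the cylinders and the preimages of
  boxes, extends to the generated \<sigma>-algebras. Stated as a product law, it allows the pivot to
  be integrated out while \<omega> is held fixed.\<close>

lemma joint_law_residual_pivot:
  assumes v: "0 < pivot_var"
  shows "id \<in> measurable M residual_algebra"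
    and "distr M (residual_algebra \<Otimes>\<^sub>M borel) (\<lambda>\<omega>. (\<omega>, pivot \<omega>))
      = distr M residual_algebra id \<Otimes>\<^sub>M distr M borel pivot"
proof -
  define \<G> where "\<G> = {{\<omega>\<in>space M. \<forall>j\<in>J. residual (fst j) \<omega> \<bullet> snd j \<in> A j} | J A.
      finite J \<and> (\<forall>j\<in>J. 0 \<le> fst j) \<and> (\<forall>j. A j \<in> sets borel)}"
  define \<E> where "\<E> = {pivot -` X \<inter> space M | X. X \<in> range (\<lambda>(a, b). box a b)}"
  have GP: "\<G> \<subseteq> Pow (space M)" by (auto simp: \<G>_def)
  have setsN: "sets residual_algebra = sigma_sets (space M) \<G>"
    using GP by (simp add: residual_algebra_def \<G>_def)
  have Gev: "\<G> \<subseteq> events" using residual_algebra_generator_events by (auto simp: \<G>_def)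
  show idm: "id \<in> measurable M residual_algebra"
    using sets.sigma_sets_subset[OF Gev] setsN by (intro measurableI) (auto simp: sets.Int_space_eq2)
  have EP: "\<E> \<subseteq> events" by (auto simp: \<E>_def intro!: measurable_sets[OF pivot_measurable])
  have "indep_set \<G> \<E>"
  proof (rule indep_setI[OF Gev EP])
    fix S Q assume "S \<in> \<G>" "Q \<in> \<E>"
    then obtain J A a b where JA: "S = {\<omega>\<in>space M. \<forall>j\<in>J. residual (fst j) \<omega> \<bullet> snd j \<in> A j}"
      "finite J" "\<forall>j\<in>J. 0 \<le> fst j" "\<forall>j. A j \<in> sets borel" and Q: "Q = pivot -` box a b \<inter> space M"
      by (auto simp: \<G>_def \<E>_def)
    have Q': "Q = {\<omega>\<in>space M. \<forall>i\<in>Basis. pivot \<omega> \<bullet> i \<in> {a \<bullet> i<..<b \<bullet> i}}"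
      by (auto simp: Q mem_box)
    have "S \<inter> Q = {\<omega>\<in>space M. (\<forall>j\<in>J. residual (fst j) \<omega> \<bullet> snd j \<in> A j) \<and> (\<forall>i\<in>Basis. pivot \<omega> \<bullet> i \<in> {a \<bullet> i<..<b \<bullet> i})}"
      by (auto simp: JA(1) Q')
    also have "prob \<dots> = prob S * prob Q"
      unfolding JA(1) Q' by (rule prob_residual_pivot) (use JA v in auto)
    finally show "prob (S \<inter> Q) = prob S * prob Q" .
  qed
  moreover have "Int_stable \<G>"
  proof (rule Int_stableI)
    fix S S' assume "S \<in> \<G>" "S' \<in> \<G>"
    then obtain J A J' A' where S: "S = {\<omega>\<in>space M. \<forall>j\<in>J. residual (fst j) \<omega> \<bullet> snd j \<in> A j}"
      "finite J" "\<forall>j\<in>J. 0 \<le> fst j" "\<forall>j. A j \<in> sets borel"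
      and S': "S' = {\<omega>\<in>space M. \<forall>j\<in>J'. residual (fst j) \<omega> \<bullet> snd j \<in> A' j}"
      "finite J'" "\<forall>j\<in>J'. 0 \<le> fst j" "\<forall>j. A' j \<in> sets borel"
      by (auto simp: \<G>_def)
    \<comment> \<open>Padding with \<open>UNIV\<close> lets both cylinders be read over the common
      index set.\<close>
    let ?A = "\<lambda>j. (if j \<in> J then A j else UNIV) \<inter> (if j \<in> J' then A' j else UNIV)"
    have "S \<inter> S' = {\<omega>\<in>space M. \<forall>j\<in>J \<union> J'. residual (fst j) \<omega> \<bullet> snd j \<in> ?A j}"
      unfolding S(1) S'(1) by auto
    moreover have "finite (J \<union> J')" "\<forall>j\<in>J \<union> J'. 0 \<le> fst j" "\<forall>j. ?A j \<in> sets borel"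
      using S S' by auto
    ultimately show "S \<inter> S' \<in> \<G>"
      unfolding \<G>_def by - (rule CollectI, rule exI[of _ "J \<union> J'"], rule exI[of _ ?A], intro conjI, assumption+)
  qed
  moreover have "Int_stable \<E>"
  proof (rule Int_stableI)
    fix S S' assume "S \<in> \<E>" "S' \<in> \<E>"
    then obtain X X' where X: "X \<in> range (\<lambda>(a, b). box a b)" "X' \<in> range (\<lambda>(a, b). box a b)"
      "S = pivot -` X \<inter> space M" "S' = pivot -` X' \<inter> space M"
      unfolding \<E>_def by blast
    then have "S \<inter> S' = pivot -` (X \<inter> X') \<inter> space M" by blast
    then show "S \<inter> S' \<in> \<E>" unfolding \<E>_def
      using Int_stableD[OF Int_stable_boxes X(1,2)] by - (rule CollectI, rule exI[of _ "X \<inter> X'"], intro conjI)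
  qed
  ultimately have ind: "indep_set (sigma_sets (space M) \<G>) (sigma_sets (space M) \<E>)"
    by (rule indep_set_sigma_sets)
  have 2: "{pivot -` A \<inter> space M | A. A \<in> sets borel} = sigma_sets (space M) \<E>"
    unfolding \<E>_def borel_eq_box by (simp add: sigma_sets_vimage_commute)
  interpret N: prob_space "distr M residual_algebra id" by (rule prob_space_distr[OF idm])
  interpret P: prob_space "distr M borel pivot" by (rule prob_space_distr[OF pivot_measurable])
  have pm: "(\<lambda>\<omega>. (\<omega>, pivot \<omega>)) \<in> measurable M (residual_algebra \<Otimes>\<^sub>M borel)"
    using measurable_Pair[OF idm pivot_measurable] by simp
  show "distr M (residual_algebra \<Otimes>\<^sub>M borel) (\<lambda>\<omega>. (\<omega>, pivot \<omega>))
      = distr M residual_algebra id \<Otimes>\<^sub>M distr M borel pivot"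
  proof (rule pair_measure_eqI[symmetric])
    show "sigma_finite_measure (distr M residual_algebra id)" "sigma_finite_measure (distr M borel pivot)"
      by unfold_locales
    fix A C assume "A \<in> sets (distr M residual_algebra id)" "C \<in> sets (distr M borel pivot)"
    then have A: "A \<in> sets residual_algebra" and C: "C \<in> sets borel" by auto
    have AM: "A \<subseteq> space M" using sets.sets_into_space[OF A] by simp
    have "prob (A \<inter> (pivot -` C \<inter> space M)) = prob A * prob (pivot -` C \<inter> space M)"
      using A C 2 by (intro indep_setD[OF ind]) (auto simp: setsN)
    moreover have "(\<lambda>\<omega>. (\<omega>, pivot \<omega>)) -` (A \<times> C) \<inter> space M = A \<inter> (pivot -` C \<inter> space M)"
      using AM by auto
    moreover have "id -` A \<inter> space M = A" using AM by auto
    ultimately show "emeasure (distr M residual_algebra id) A * emeasure (distr M borel pivot) C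
      = emeasure (distr M (residual_algebra \<Otimes>\<^sub>M borel) (\<lambda>\<omega>. (\<omega>, pivot \<omega>))) (A \<times> C)"
      using A C by (simp add: emeasure_distr[OF idm] emeasure_distr[OF pm] emeasure_distr[OF pivot_measurable]
          emeasure_eq_measure ennreal_mult)
  qed (auto intro!: sets_pair_measure_cong)
qed

end

section \<open>Covariance with a second difference near the endpoint\<close>

text \<open>The covariance of \<open>B t\<close> with \<open>B T - 2 B (T - e) + B (T - 2 e)\<close> is, up to normalization,
  \<open>second_diff\<close> at \<open>(T - t) / e\<close>. Its variation is integrable at infinity, which would fail for
  the first difference; hence it concentrates at \<open>t = T\<close> for small \<open>e\<close>.\<close>

definition second_diff :: "real \<Rightarrow> real \<Rightarrow> real" where
  "second_diff q z = \<bar>z\<bar> powr q - 2 * \<bar>z - 1\<bar> powr q + \<bar>z - 2\<bar> powr q"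

definition signed_powr :: "real \<Rightarrow> real \<Rightarrow> real" where
  "signed_powr q x = sgn x * \<bar>x\<bar> powr q"

text \<open>On each half-line the two sides agree; across 0 the absolute difference is at most the
  sum of the two powers. The increments of the majorant telescope, which the absolute differences do
  not.\<close>

lemma signed_powr_majorant:
  assumes q: "0 < q" and "x \<le> y"
  shows "\<bar>\<bar>x\<bar> powr q - \<bar>y\<bar> powr q\<bar> \<le> signed_powr q y - signed_powr q x"
proof -
  have mono: "a powr q \<le> b powr q" if "0 \<le> a" "a \<le> b" for a b :: real
    using that q by (intro powr_mono2) auto
  consider "0 \<le> x" | "x < 0" "0 \<le> y" | "y < 0" using \<open>x \<le> y\<close> by linarith
  then show ?thesis
  proof cases
    case 1
    then show ?thesis using mono[of x y] \<open>x \<le> y\<close> by (auto simp: signed_powr_def sgn_if)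
  next
    case 2
    have "0 \<le> \<bar>x\<bar> powr q" "0 \<le> \<bar>y\<bar> powr q" by simp_all
    moreover have "signed_powr q x = - (\<bar>x\<bar> powr q)" "signed_powr q y = \<bar>y\<bar> powr q"
      using 2 by (auto simp: signed_powr_def sgn_if)
    ultimately show ?thesis by linarith
  next
    case 3
    then show ?thesis using mono[of "- y" "- x"] \<open>x \<le> y\<close> by (auto simp: signed_powr_def sgn_if)
  qed
qed

text \<open>Concavity of the power. It is used with exponent 2 H - 1, which lies between 0 and
  1.\<close>

lemma powr_increment_antimono:
  fixes p :: real
  assumes p: "0 < p" "p < 1" and "0 < x" "x \<le> y"
  shows "(y + 1) powr p - y powr p \<le> (x + 1) powr p - x powr p"
proof (rule DERIV_nonpos_imp_nonincreasing[OF \<open>x \<le> y\<close>, of "\<lambda>w. (w + 1) powr p - w powr p"])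
  fix w assume w: "x \<le> w" "w \<le> y"
  then have w0: "0 < w" using \<open>0 < x\<close> by simp
  have "((\<lambda>w. (w + 1) powr p - w powr p) has_real_derivative
      p * (w + 1) powr (p - 1) * 1 - p * w powr (p - 1) * 1) (at w)"
    using w0 by (auto intro!: derivative_eq_intros)
  moreover have "(w + 1) powr (p - 1) \<le> w powr (p - 1)"
    using w0 p by (intro powr_mono2') auto
  then have "p * (w + 1) powr (p - 1) * 1 - p * w powr (p - 1) * 1 \<le> 0"
    using p by simp
  ultimately show "\<exists>d. ((\<lambda>w. (w + 1) powr p - w powr p) has_real_derivative d) (at w) \<and> d \<le> 0"
    by blast
qed

text \<open>The weight sits at the right end of each cell because \<open>rs_sum\<close> evaluates
  \<sigma> there and \<open>sum_sum_lessThan\<close> produces the time remaining after that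
  point.\<close>

definition weighted_variation :: "(real \<Rightarrow> real) \<Rightarrow> (real \<Rightarrow> real) \<Rightarrow> real \<Rightarrow> nat \<Rightarrow> real" where
  "weighted_variation \<rho> \<phi> T n = (\<Sum>j<n. \<rho> (real (Suc j) * T / real n)
    * \<bar>\<phi> (real (Suc j) * T / real n) - \<phi> (real j * T / real n)\<bar>)"

section \<open>The normalized second difference: variation, regression coefficient,
  concentration\<close>

locale hurst =
  fixes H :: real
  assumes H: "1/2 < H" "H < 1"
begin

abbreviation \<kappa> :: "real \<Rightarrow> real" where "\<kappa> \<equiv> second_diff (2 * H)"

text \<open>The derivative is 2 H times the second difference of the concave power with exponent 2 H
  - 1. From 3 on, the arguments stay away from the kinks at 0, 1 and 2, and the absolute values
  disappear.\<close>

lemma kappa_decreasing: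
  assumes "3 \<le> x" "x \<le> y"
  shows "\<kappa> y \<le> \<kappa> x"
proof -
  let ?f = "\<lambda>z. z powr (2 * H) - 2 * (z - 1) powr (2 * H) + (z - 2) powr (2 * H)"
  have eq: "\<kappa> z = ?f z" if "3 \<le> z" for z using that by (simp add: second_diff_def)
  have "?f y \<le> ?f x"
  proof (rule DERIV_nonpos_imp_nonincreasing[OF \<open>x \<le> y\<close>])
    fix z assume z: "x \<le> z" "z \<le> y"
    then have z3: "3 \<le> z" using assms by simp
    let ?d = "2 * H * z powr (2 * H - 1) * 1 - 2 * (2 * H * (z - 1) powr (2 * H - 1) * 1)
        + 2 * H * (z - 2) powr (2 * H - 1) * 1"
    have "(?f has_real_derivative ?d) (at z)"
      using z3 by (auto intro!: derivative_eq_intros)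
    moreover have "(z - 1 + 1) powr (2 * H - 1) - (z - 1) powr (2 * H - 1)
        \<le> (z - 2 + 1) powr (2 * H - 1) - (z - 2) powr (2 * H - 1)"
      using z3 H by (intro powr_increment_antimono) auto
    then have "z powr (2 * H - 1) - 2 * (z - 1) powr (2 * H - 1) + (z - 2) powr (2 * H - 1) \<le> 0"
      by simp
    then have "2 * H * (z powr (2 * H - 1) - 2 * (z - 1) powr (2 * H - 1) + (z - 2) powr (2 * H - 1)) \<le> 0"
      using H by (intro mult_nonneg_nonpos) auto
    then have "?d \<le> 0" by (simp add: algebra_simps)
    ultimately show "\<exists>d. (?f has_real_derivative d) (at z) \<and> d \<le> 0" by blast
  qed
  then show ?thesis using assms eq[of x] eq[of y] by simp
qed

lemma kappa_tendsto_0: "(\<kappa> \<longlongrightarrow> 0) at_top"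
proof -
  have "((\<lambda>z. z powr (2 * H) - 2 * (z - 1) powr (2 * H) + (z - 2) powr (2 * H)) \<longlongrightarrow> 0) at_top"
    using H by real_asymp
  moreover have "\<forall>\<^sub>F z in at_top. z powr (2 * H) - 2 * (z - 1) powr (2 * H) + (z - 2) powr (2 * H) = \<kappa> z"
    using eventually_ge_at_top[of "3::real"] by eventually_elim (simp add: second_diff_def)
  ultimately show ?thesis by (rule Lim_transform_eventually)
qed

lemma kappa_nonneg:
  assumes "3 \<le> x"
  shows "0 \<le> \<kappa> x"
  by (rule tendsto_upperbound[OF kappa_tendsto_0 eventually_mono[OF eventually_ge_at_top[of x]]])
     (use kappa_decreasing[OF assms] in auto)

text \<open>An increasing function whose increments dominate those of \<kappa>. Up to 3 the
  majorants of the three powers are added; beyond 3, where \<kappa> decreases, its own decrease is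
  used, which keeps the total finite.\<close>

definition kappa_majorant :: "real \<Rightarrow> real" where
  "kappa_majorant z = (let m = (\<lambda>z. signed_powr (2 * H) z + 2 * signed_powr (2 * H) (z - 1) + signed_powr (2 * H) (z - 2))
     in if z \<le> 3 then m z else m 3 + \<kappa> 3 - \<kappa> z)"

lemma kappa_majorant:
  assumes "x \<le> y"
  shows "\<bar>\<kappa> x - \<kappa> y\<bar> \<le> kappa_majorant y - kappa_majorant x"
proof -
  have low: "\<bar>\<kappa> x - \<kappa> y\<bar> \<le> kappa_majorant y - kappa_majorant x" if "x \<le> y" "y \<le> 3" for x y
  proof -
    have "\<bar>\<bar>x\<bar> powr (2 * H) - \<bar>y\<bar> powr (2 * H)\<bar> \<le> signed_powr (2 * H) y - signed_powr (2 * H) x"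
      "\<bar>\<bar>x - 1\<bar> powr (2 * H) - \<bar>y - 1\<bar> powr (2 * H)\<bar> \<le> signed_powr (2 * H) (y - 1) - signed_powr (2 * H) (x - 1)"
      "\<bar>\<bar>x - 2\<bar> powr (2 * H) - \<bar>y - 2\<bar> powr (2 * H)\<bar> \<le> signed_powr (2 * H) (y - 2) - signed_powr (2 * H) (x - 2)"
      using H that by (intro signed_powr_majorant; simp)+
    moreover have "\<bar>a - 2 * b + c - (a' - 2 * b' + c')\<bar> \<le> (u + 2 * v + w) - (u' + 2 * v' + w')"
      if "\<bar>a - a'\<bar> \<le> u - u'" "\<bar>b - b'\<bar> \<le> v - v'" "\<bar>c - c'\<bar> \<le> w - w'"
      for a b c a' b' c' u v w u' v' w' :: real
      using that by linarith
    ultimately show ?thesis using that unfolding kappa_majorant_def second_diff_def Let_def by simp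
  qed
  have high: "\<bar>\<kappa> x - \<kappa> y\<bar> \<le> kappa_majorant y - kappa_majorant x" if "3 \<le> x" "x \<le> y" for x y
  proof (cases "y = 3")
    case False
    then show ?thesis using kappa_decreasing[OF that] that by (auto simp: kappa_majorant_def Let_def)
  qed (use that in auto)
  consider "y \<le> 3" | "3 \<le> x" | "x \<le> 3" "3 \<le> y" using assms by linarith
  then show ?thesis
  proof cases
    case 3
    then show ?thesis using low[of x 3] high[of 3 y] by linarith
  qed (use low high assms in auto)
qed

lemma kappa_majorant_mono: "x \<le> y \<Longrightarrow> kappa_majorant x \<le> kappa_majorant y"
  using kappa_majorant[of x y] by linarith

lemma kappa_majorant_bounded:
  assumes "0 \<le> y"
  shows "kappa_majorant y - kappa_majorant 0 \<le> kappa_majorant 3 + \<kappa> 3 - kappa_majorant 0"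
proof (cases "y \<le> 3")
  case True
  then show ?thesis using kappa_majorant_mono[OF True] kappa_nonneg[of 3] by simp
next
  case False
  then show ?thesis using kappa_nonneg[of y] by (simp add: kappa_majorant_def Let_def)
qed

lemma kappa_majorant_tail:
  assumes "3 \<le> x" "x \<le> y"
  shows "kappa_majorant y - kappa_majorant x \<le> \<kappa> x"
proof (cases "y = 3")
  case True
  then show ?thesis using assms kappa_nonneg[of 3] by simp
next
  case False
  then show ?thesis using assms kappa_nonneg[of y] by (auto simp: kappa_majorant_def Let_def)
qed

text \<open>2 H > 1 makes \<open>\<kappa> 0\<close> positive, so that the coefficient at T does not
  vanish in the limit; 2 H < 2 makes the variance of the second difference positive.\<close>

lemma two_powr_bounds: "2 < 2 powr (2 * H)" "2 powr (2 * H) < (4::real)"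
proof -
  have "2 powr 1 < 2 powr (2 * H)" using H by (intro powr_less_mono) auto
  then show "2 < 2 powr (2 * H)" by simp
  have "2 powr (2 * H) < 2 powr (2::real)" using H by (intro powr_less_mono) auto
  then show "2 powr (2 * H) < (4::real)" by simp
qed

lemma kappa_values: "\<kappa> 0 = 2 powr (2 * H) - 2" "\<kappa> 1 = 2" "\<kappa> 2 = 2 powr (2 * H) - 2"
  by (simp_all add: second_diff_def)

text \<open>The regression coefficient of \<open>B t\<close> on the second difference with step e.
  By self-similarity the factor \<open>e powr (2 * H)\<close> cancels between covariance and
  variance (\<open>second_diff_cov\<close>, \<open>second_diff_var\<close>).\<close>

definition bump :: "real \<Rightarrow> real \<Rightarrow> real \<Rightarrow> real" where
  "bump T e t = (\<kappa> (T / e) - \<kappa> ((T - t) / e)) / (2 * (4 - 2 powr (2 * H)))"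

lemma bump_0: "bump T e 0 = 0"
  by (simp add: bump_def)

lemma kappa_small:
  assumes "0 < \<delta>" "0 < \<eta>"
  shows "\<forall>\<^sub>F e in at_right 0. 3 \<le> \<delta> / e \<and> \<kappa> (\<delta> / e) < \<eta>"
proof -
  have "filterlim (\<lambda>e. \<delta> / e) at_top (at_right 0)" using assms by real_asymp
  moreover have "\<forall>\<^sub>F z in at_top. 3 \<le> z \<and> \<kappa> z < \<eta>"
    using order_tendstoD(2)[OF kappa_tendsto_0 assms(2)] eventually_ge_at_top[of 3]
    by eventually_elim auto
  ultimately show ?thesis by (auto simp: filterlim_iff)
qed

text \<open>\<open>\<kappa> (T / e)\<close> vanishes in the limit and only the term with
  \<open>\<kappa> 0\<close> remains. The constant is half the absolute value of that limit, and it
  does not depend on e.\<close>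

lemma bump_end:
  assumes "0 < T"
  shows "\<forall>\<^sub>F e in at_right 0. (2 powr (2 * H) - 2) / 4 / (4 - 2 powr (2 * H)) \<le> \<bar>bump T e T\<bar>"
proof -
  have "\<forall>\<^sub>F e in at_right 0. 3 \<le> T / e \<and> \<kappa> (T / e) < (2 powr (2 * H) - 2) / 2"
    using assms two_powr_bounds by (intro kappa_small) auto
  then show ?thesis
  proof eventually_elim
    case (elim e)
    have "(2 powr (2 * H) - 2) / 2 \<le> - (\<kappa> (T / e) - \<kappa> 0)"
      using conjunct2[OF elim] unfolding kappa_values by (simp add: field_simps)
    also have "\<dots> \<le> \<bar>\<kappa> (T / e) - \<kappa> 0\<bar>" by (rule abs_ge_minus_self)
    finally have "(2 powr (2 * H) - 2) / 2 \<le> \<bar>\<kappa> (T / e) - \<kappa> 0\<bar>" .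
    then have "(2 powr (2 * H) - 2) / 2 / (2 * (4 - 2 powr (2 * H))) \<le> \<bar>\<kappa> (T / e) - \<kappa> 0\<bar> / (2 * (4 - 2 powr (2 * H)))"
      using two_powr_bounds by (intro divide_right_mono) auto
    then show ?case using two_powr_bounds by (simp add: bump_def)
  qed
qed

text \<open>Within \<delta> of T the weight is small and the total variation finite; farther away
  the weight is bounded and the variation belongs to the tail of \<kappa> beyond \<delta> / e, which
  tends to 0 with e. The majorant telescopes over any grid, hence the uniformity in n.\<close>

lemma bump_concentrates:
  assumes T: "0 < T" and \<rho>: "\<And>t. 0 \<le> t \<Longrightarrow> t \<le> T \<Longrightarrow> 0 \<le> \<rho> t \<and> \<rho> t \<le> \<rho>max"
    and vanish: "\<And>\<eta>. 0 < \<eta> \<Longrightarrow> \<exists>\<delta>>0. \<forall>t. 0 \<le> t \<and> t \<le> T \<and> T - \<delta> < t \<longrightarrow> \<rho> t \<le> \<eta>"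
    and \<eta>: "0 < \<eta>"
  shows "\<forall>\<^sub>F e in at_right 0. \<forall>n. weighted_variation \<rho> (bump T e) T n \<le> \<eta>"
proof -
  define c where "c = 2 * (4 - 2 powr (2 * H))"
  have c: "0 < c" using two_powr_bounds by (simp add: c_def)
  define D where "D = kappa_majorant 3 + \<kappa> 3 - kappa_majorant 0"
  have D: "0 \<le> D" using kappa_majorant_bounded[of 0] by (simp add: D_def)
  \<comment> \<open>Each of the two contributions gets half of \<open>\<eta> * c\<close>; the
    summand 1 prevents division by 0.\<close>
  define \<eta>1 where "\<eta>1 = \<eta> * c / (2 * (D + 1))"
  have \<eta>1: "0 < \<eta>1" using \<eta> c D by (simp add: \<eta>1_def)
  obtain \<delta> where \<delta>: "0 < \<delta>" "\<And>t. 0 \<le> t \<Longrightarrow> t \<le> T \<Longrightarrow> T - \<delta> < t \<Longrightarrow> \<rho> t \<le> \<eta>1"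
    using vanish[OF \<eta>1] by blast
  have \<rho>max: "0 \<le> \<rho>max" using \<rho>[of 0] T by linarith
  define \<eta>2 where "\<eta>2 = \<eta> * c / (2 * (\<rho>max + 1))"
  have \<eta>2: "0 < \<eta>2" using \<eta> c \<rho>max by (simp add: \<eta>2_def)
  have "\<forall>\<^sub>F e in at_right 0. 0 < e \<and> 3 \<le> \<delta> / e \<and> \<kappa> (\<delta> / e) < \<eta>2"
    using kappa_small[OF \<delta>(1) \<eta>2] eventually_at_right_less[of "0::real"] by eventually_elim auto
  then show ?thesis
  proof (eventually_elim, intro allI)
    fix e n assume e: "0 < e \<and> 3 \<le> \<delta> / e \<and> \<kappa> (\<delta> / e) < \<eta>2"
    define t where "t j = real j * T / real n" for j
    define z where "z j = (T - t j) / e" for j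
    \<comment> \<open>After clipping, the majorant grows only beyond \<delta> / e, that is, over
      times before T - \<delta>.\<close>
    define g where "g y = kappa_majorant (max y (\<delta> / e))" for y
    have step: "\<rho> (t (Suc j)) * \<bar>bump T e (t (Suc j)) - bump T e (t j)\<bar>
        \<le> (\<eta>1 * (kappa_majorant (z j) - kappa_majorant (z (Suc j))) + \<rho>max * (g (z j) - g (z (Suc j)))) / c"
      if j: "j < n" for j
    proof -
      have tj: "0 \<le> t (Suc j)" "t (Suc j) \<le> T" "t j \<le> t (Suc j)"
      proof -
        have "real (Suc j) \<le> real n" using j by simp
        then have "real (Suc j) * T \<le> real n * T" using T by (intro mult_right_mono) auto
        then show "t (Suc j) \<le> T" using j by (simp add: t_def field_simps)
        show "0 \<le> t (Suc j)" "t j \<le> t (Suc j)"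
          using j T by (auto simp: t_def intro!: divide_right_mono mult_right_mono)
      qed
      have zj: "z (Suc j) \<le> z j" using tj e by (simp add: z_def divide_right_mono)
      have b: "\<bar>bump T e (t (Suc j)) - bump T e (t j)\<bar> = \<bar>\<kappa> (z (Suc j)) - \<kappa> (z j)\<bar> / c"
        unfolding bump_def c_def[symmetric] z_def
        using c by (simp add: diff_divide_distrib[symmetric] abs_minus_commute)
      have g0: "0 \<le> g (z j) - g (z (Suc j))"
        using zj unfolding g_def by (simp add: kappa_majorant_mono)
      have k0: "0 \<le> kappa_majorant (z j) - kappa_majorant (z (Suc j))"
        using kappa_majorant_mono[OF zj] by simp
      have "\<rho> (t (Suc j)) * \<bar>\<kappa> (z (Suc j)) - \<kappa> (z j)\<bar>
          \<le> \<rho> (t (Suc j)) * (kappa_majorant (z j) - kappa_majorant (z (Suc j)))"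
        using kappa_majorant[OF zj] \<rho>[OF tj(1,2)] by (intro mult_left_mono) auto
      also have "\<dots> \<le> \<eta>1 * (kappa_majorant (z j) - kappa_majorant (z (Suc j))) + \<rho>max * (g (z j) - g (z (Suc j)))"
      proof (cases "T - \<delta> < t (Suc j)")
        case True
        then have "\<rho> (t (Suc j)) * (kappa_majorant (z j) - kappa_majorant (z (Suc j)))
            \<le> \<eta>1 * (kappa_majorant (z j) - kappa_majorant (z (Suc j)))"
          using \<delta>(2)[OF tj(1,2)] k0 by (intro mult_right_mono) auto
        then show ?thesis using \<rho>max g0 by (simp add: add_increasing2)
      next
        case False
        then have "\<delta> / e \<le> z (Suc j)" using e by (simp add: z_def divide_right_mono)
        then have "g (z j) - g (z (Suc j)) = kappa_majorant (z j) - kappa_majorant (z (Suc j))"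
          using zj by (simp add: g_def max_absorb1)
        moreover have "\<rho> (t (Suc j)) * (kappa_majorant (z j) - kappa_majorant (z (Suc j)))
            \<le> \<rho>max * (kappa_majorant (z j) - kappa_majorant (z (Suc j)))"
          using \<rho>[OF tj(1,2)] k0 by (intro mult_right_mono) auto
        ultimately show ?thesis using \<eta>1 k0 by (simp add: add_increasing)
      qed
      finally have "\<rho> (t (Suc j)) * \<bar>\<kappa> (z (Suc j)) - \<kappa> (z j)\<bar> / c
          \<le> (\<eta>1 * (kappa_majorant (z j) - kappa_majorant (z (Suc j))) + \<rho>max * (g (z j) - g (z (Suc j)))) / c"
        using c by (intro divide_right_mono) auto
      then show ?thesis unfolding b by simp
    qed
    have "(\<Sum>j<n. \<rho> (t (Suc j)) * \<bar>bump T e (t (Suc j)) - bump T e (t j)\<bar>)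
      \<le> (\<Sum>j<n. (\<eta>1 * (kappa_majorant (z j) - kappa_majorant (z (Suc j))) + \<rho>max * (g (z j) - g (z (Suc j)))) / c)"
      by (rule sum_mono) (use step in auto)
    also have "\<dots> = (\<eta>1 * (kappa_majorant (z 0) - kappa_majorant (z n)) + \<rho>max * (g (z 0) - g (z n))) / c"
      using sum_lessThan_telescope'[of "\<lambda>j. kappa_majorant (z j)" n] sum_lessThan_telescope'[of "\<lambda>j. g (z j)" n]
      by (simp add: sum_divide_distrib[symmetric] sum.distrib sum_distrib_left[symmetric])
    also have "\<dots> \<le> (\<eta>1 * D + \<rho>max * \<eta>2) / c"
    proof (cases "n = 0")
      case True
      then show ?thesis using \<eta>1 D \<rho>max \<eta>2 c by (simp add: add_nonneg_nonneg)
    next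
      case False
      have z0: "z 0 = T / e" "z n = 0" using False by (auto simp: z_def t_def)
      have "kappa_majorant (z 0) - kappa_majorant (z n) \<le> D"
        unfolding z0 D_def using T e by (intro kappa_majorant_bounded) auto
      moreover have "g (z 0) - g (z n) \<le> \<eta>2"
      proof -
        have "g (z 0) - g (z n) = kappa_majorant (max (T / e) (\<delta> / e)) - kappa_majorant (\<delta> / e)"
          using e unfolding z0 g_def by (simp add: max_def)
        also have "\<dots> \<le> \<kappa> (\<delta> / e)" using e by (intro kappa_majorant_tail) auto
        finally show ?thesis using e by simp
      qed
      ultimately show ?thesis using \<eta>1 \<rho>max c
        by (intro divide_right_mono add_mono mult_left_mono) auto
    qed
    also have "\<dots> \<le> \<eta>"
    proof -
      have "\<eta>1 * D \<le> \<eta>1 * (D + 1)" using \<eta>1 by simp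
      also have "\<dots> = \<eta> * c / 2" using D by (simp add: \<eta>1_def field_simps)
      finally have 1: "\<eta>1 * D \<le> \<eta> * c / 2" .
      have "\<rho>max * \<eta>2 \<le> (\<rho>max + 1) * \<eta>2" using \<eta>2 by simp
      also have "\<dots> = \<eta> * c / 2" using \<rho>max by (simp add: \<eta>2_def field_simps)
      finally have "\<eta>1 * D + \<rho>max * \<eta>2 \<le> \<eta> * c" using 1 by linarith
      then show ?thesis using c by (simp add: field_simps)
    qed
    finally show "weighted_variation \<rho> (bump T e) T n \<le> \<eta>"
      unfolding t_def weighted_variation_def .
  qed
qed

text \<open>The coefficients 1, -2, 1 sum to 0, which removes the term in t alone from the three
  covariances. The remaining terms are second differences at T and at T - t, and scaling by e gives
  \<kappa>.\<close>

lemma second_diff_cov: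
  assumes e: "0 < e" "2 * e \<le> T" and t: "0 \<le> t"
  shows "fbm_cov H T t - 2 * fbm_cov H (T - e) t + fbm_cov H (T - 2 * e) t
    = e powr (2 * H) * (4 - 2 powr (2 * H)) * bump T e t"
proof -
  have sc: "e powr (2 * H) * \<bar>z\<bar> powr (2 * H) = \<bar>e * z\<bar> powr (2 * H)" for z
    using e by (simp add: abs_mult powr_mult)
  have k: "e powr (2 * H) * \<kappa> (u / e) = \<bar>u\<bar> powr (2 * H) - 2 * \<bar>u - e\<bar> powr (2 * H) + \<bar>u - 2 * e\<bar> powr (2 * H)" for u
  proof -
    have "e * (u / e) = u" "e * (u / e - 1) = u - e" "e * (u / e - 2) = u - 2 * e"
      using e by (auto simp: field_simps)
    then show ?thesis
      unfolding second_diff_def using sc[of "u / e"] sc[of "u / e - 1"] sc[of "u / e - 2"]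
      by (simp add: algebra_simps)
  qed
  have "e powr (2 * H) * (4 - 2 powr (2 * H)) * bump T e t = (e powr (2 * H) * \<kappa> (T / e) - e powr (2 * H) * \<kappa> ((T - t) / e)) / 2"
    using two_powr_bounds by (simp add: bump_def field_simps)
  also have "\<dots> = fbm_cov H T t - 2 * fbm_cov H (T - e) t + fbm_cov H (T - 2 * e) t"
  proof -
    have "\<bar>t - T\<bar> = \<bar>T - t\<bar>" "\<bar>t - (T - e)\<bar> = \<bar>T - t - e\<bar>" "\<bar>t - (T - 2 * e)\<bar> = \<bar>T - t - 2 * e\<bar>"
      "\<bar>T\<bar> = T" "\<bar>T - e\<bar> = T - e" "\<bar>T - 2 * e\<bar> = T - 2 * e"
      using e by linarith+
    then show ?thesis unfolding k fbm_cov_def by (simp add: add_divide_distrib diff_divide_distrib)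
  qed
  finally show ?thesis ..
qed

text \<open>Applying the coefficients once more turns the covariance into the variance; the value 1
  expresses that \<open>bump\<close> is normalized as a regression coefficient.\<close>

lemma second_diff_var:
  assumes e: "0 < e" "2 * e \<le> T"
  shows "bump T e T - 2 * bump T e (T - e) + bump T e (T - 2 * e) = 1"
proof -
  have "(T - (T - e)) / e = 1" "(T - (T - 2 * e)) / e = 2" using e by auto
  then have "bump T e T - 2 * bump T e (T - e) + bump T e (T - 2 * e)
      = (2 * \<kappa> 1 - \<kappa> 0 - \<kappa> 2) / (2 * (4 - 2 powr (2 * H)))"
    unfolding bump_def by (simp add: diff_divide_distrib)
  also have "2 * \<kappa> 1 - \<kappa> 0 - \<kappa> 2 = 2 * (4 - 2 powr (2 * H))" unfolding kappa_values by simp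
  finally show ?thesis using two_powr_bounds by simp
qed

end

section \<open>The Euler scheme driven by Riemann--Stieltjes sums\<close>

lemma norm_matrix_vector_mult_le:
  fixes A :: "real^'n^'m" and x :: "real^'n"
  shows "norm (A *v x) \<le> norm A * norm x"
proof -
  have "norm (A *v x) \<le> L2_set (\<lambda>i. norm (A $ i) * norm x) UNIV"
    unfolding norm_vec_def[of "A *v x"]
    by (rule L2_set_mono) (auto simp: matrix_vector_mul_component Cauchy_Schwarz_ineq2)
  also have "\<dots> = norm A * norm x"
    by (simp add: norm_vec_def[of A] L2_set_left_distrib)
  finally show ?thesis .
qed

text \<open>The driving sequence \<open>s\<close> contains the starting point and the accumulated
  noise, so a change of either is a perturbation of \<open>s\<close>.\<close>

primrec euler :: "(real \<Rightarrow> 'v \<Rightarrow> 'v::real_vector) \<Rightarrow> real \<Rightarrow> (nat \<Rightarrow> 'v) \<Rightarrow> nat \<Rightarrow> 'v" where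
  "euler b h s 0 = s 0"
| "euler b h s (Suc k) = euler b h s k + h *\<^sub>R b (real k * h) (euler b h s k) + (s (Suc k) - s k)"

lemma euler_eq_sum: "euler b h s k = s k + (\<Sum>j<k. h *\<^sub>R b (real j * h) (euler b h s j))"
  by (induction k) auto

lemma discrete_gronwall:
  fixes S u :: "nat \<Rightarrow> real"
  assumes c: "0 \<le> c" and u: "\<And>k. k < n \<Longrightarrow> 0 \<le> u k"
    and S: "S 0 \<le> 0" "\<And>k. k < n \<Longrightarrow> S (Suc k) \<le> (1 + c) * S k + u k"
  shows "S n \<le> (1 + c) ^ n * (\<Sum>k<n. u k)"
  using u S
proof (induction n)
  case (Suc n)
  have IH: "S n \<le> (1 + c) ^ n * (\<Sum>k<n. u k)" using Suc by auto
  have "S (Suc n) \<le> (1 + c) * S n + u n" using Suc.prems by auto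
  also have "\<dots> \<le> (1 + c) * ((1 + c) ^ n * (\<Sum>k<n. u k)) + (1 + c) ^ Suc n * u n"
  proof (rule add_mono)
    show "(1 + c) * S n \<le> (1 + c) * ((1 + c) ^ n * (\<Sum>k<n. u k))"
      using IH c by (intro mult_left_mono) auto
    have "1 * u n \<le> (1 + c) ^ Suc n * u n"
      using c Suc.prems(1)[of n] by (intro mult_right_mono one_le_power) auto
    then show "u n \<le> (1 + c) ^ Suc n * u n" by simp
  qed
  also have "\<dots> = (1 + c) ^ Suc n * (\<Sum>k<Suc n. u k)" by (simp add: algebra_simps)
  finally show ?case .
qed simp

text \<open>Gronwall for the accumulated distance. The bound involves the sum of the earlier
  \<open>norm (d k)\<close>, not their maximum: a perturbation that is large only during the last
  few steps has little effect through the drift.\<close>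

lemma stability:
  fixes y y' d :: "nat \<Rightarrow> 'v::real_normed_vector"
  assumes c: "0 \<le> c" and diff: "\<And>k. k \<le> n \<Longrightarrow> norm (y k - y' k - d k) \<le> c * (\<Sum>j<k. norm (y j - y' j))"
  shows "norm (y n - y' n - d n) \<le> c * ((1 + c) ^ n * (\<Sum>k<n. norm (d k)))"
proof -
  let ?S = "\<lambda>k. \<Sum>j<k. norm (y j - y' j)"
  have "?S n \<le> (1 + c) ^ n * (\<Sum>k<n. norm (d k))"
  proof (rule discrete_gronwall[OF c])
    fix k assume "k < n"
    then have "norm (y k - y' k - d k) \<le> c * ?S k" using diff[of k] by simp
    then have "norm (y k - y' k) \<le> norm (d k) + c * ?S k"
      using norm_triangle_ineq[of "y k - y' k - d k" "d k"] by simp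
    then show "?S (Suc k) \<le> (1 + c) * ?S k + norm (d k)" by (simp add: algebra_simps)
  qed auto
  then show ?thesis using diff[of n] c by (meson mult_left_mono order_refl order_trans)
qed

lemma one_plus_power_le_exp:
  assumes "0 \<le> c" "0 < n"
  shows "(1 + c / real n) ^ n \<le> exp c"
proof -
  have "(1 + c / real n) ^ n \<le> exp (c / real n) ^ n"
    using assms by (intro power_mono exp_ge_add_one_self) auto
  also have "\<dots> = exp c" using assms by (simp add: exp_of_nat_mult[symmetric])
  finally show ?thesis .
qed

section \<open>Riemann--Stieltjes and Riemann sums on uniform grids\<close>

definition rs_sum :: "(real \<Rightarrow> real^'d^'d) \<Rightarrow> real \<Rightarrow> nat \<Rightarrow> (real \<Rightarrow> real^'d) \<Rightarrow> nat \<Rightarrow> real^'d" where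
  "rs_sum \<sigma> T n g k = (\<Sum>j<k. \<sigma> (real (Suc j) * T / real n) *v (g (real (Suc j) * T / real n) - g (real j * T / real n)))"

lemma sum_lessThan_add: "(\<Sum>i<m + p. f i) = (\<Sum>i<m. f i) + (\<Sum>i<p. f (m + i :: nat))"
  for f :: "nat \<Rightarrow> 'c::comm_monoid_add"
  by (induction p) (simp_all add: add.assoc)

definition rs_mesh :: "(real \<Rightarrow> real^'d^'d) \<Rightarrow> (real \<Rightarrow> real^'d) \<Rightarrow> real \<Rightarrow> real \<Rightarrow> real^'d \<Rightarrow> real \<Rightarrow> real \<Rightarrow> bool" where
  "rs_mesh f g a b I \<epsilon> \<delta> \<longleftrightarrow> (\<forall>(n::nat) (t::nat \<Rightarrow> real) (\<tau>::nat \<Rightarrow> real).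
        t 0 = a \<and> t n = b \<and>
        (\<forall>i<n. t i < t (Suc i) \<and> t (Suc i) - t i < \<delta> \<and> t i \<le> \<tau> i \<and> \<tau> i \<le> t (Suc i))
        \<longrightarrow> norm ((\<Sum>i<n. f (\<tau> i) *v (g (t (Suc i)) - g (t i))) - I) < \<epsilon>)"

lemma has_RS_integral_iff_mesh: "has_RS_integral f g a b I \<longleftrightarrow> (\<forall>\<epsilon>>0. \<exists>\<delta>>0. rs_mesh f g a b I \<epsilon> \<delta>)"
  unfolding has_RS_integral_def rs_mesh_def ..

lemma rs_meshD:
  assumes "rs_mesh f g a b I \<epsilon> \<delta>" "t 0 = a" "t n = b"
    and "\<And>i. i < n \<Longrightarrow> t i < t (Suc i) \<and> t (Suc i) - t i < \<delta>"
  shows "norm ((\<Sum>i<n. f (t (Suc i)) *v (g (t (Suc i)) - g (t i))) - I) < \<epsilon>"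
  using assms(1)[unfolded rs_mesh_def, rule_format, of t n "\<lambda>i. t (Suc i)"] assms(2-) by (simp add: less_imp_le)

text \<open>Two fine partitions of \<open>[0, s]\<close> continued by the same partition of \<open>[s, T]\<close> have close sums,
  so the mesh needed at the endpoint \<open>T\<close> serves all intermediate \<open>s\<close>.\<close>

lemma rs_sum_uniform:
  fixes \<sigma> :: "real \<Rightarrow> real^'d^'d"
  assumes T: "0 < T" and W: "\<And>t. t \<in> {0..T} \<Longrightarrow> has_RS_integral \<sigma> g 0 t (W t)" and \<epsilon>: "0 < \<epsilon>"
  shows "\<exists>n0>0. \<forall>n\<ge>n0. \<forall>k\<le>n. norm (rs_sum \<sigma> T n g k - W (real k * T / real n)) \<le> \<epsilon>"
proof -
  have e3: "0 < \<epsilon> / 3" using \<epsilon> by simp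
  have "has_RS_integral \<sigma> g 0 T (W T)" using W T by simp
  then obtain \<delta> where \<delta>: "0 < \<delta>" and rsT: "rs_mesh \<sigma> g 0 T (W T) (\<epsilon> / 3) \<delta>"
    using e3 unfolding has_RS_integral_iff_mesh by blast
  obtain n0 :: nat where n0: "T / \<delta> < real n0" using reals_Archimedean2 by blast
  have n0pos: "0 < n0" using n0 T \<delta> by (metis divide_pos_pos not_gr_zero of_nat_0 order_less_asym)
  have "norm (rs_sum \<sigma> T n g k - W (real k * T / real n)) \<le> \<epsilon>" if n: "n \<ge> n0" and k: "k \<le> n" for n k
  proof (cases "k = 0")
    case True
    \<comment> \<open>On the degenerate interval the empty partition is admissible, and its sum is
      0.\<close>
    have "norm (W 0) < \<epsilon>"
    proof -
      have "has_RS_integral \<sigma> g 0 0 (W 0)" using W T by simp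
      then obtain d where "rs_mesh \<sigma> g 0 0 (W 0) \<epsilon> d"
        using \<epsilon> unfolding has_RS_integral_iff_mesh by blast
      from rs_meshD[OF this, of "\<lambda>_. 0" 0] show ?thesis by simp
    qed
    then show ?thesis using True by (simp add: rs_sum_def)
  next
    case False
    have npos: "0 < n" using n n0pos by simp
    have mesh: "T / real n < \<delta>"
    proof -
      have "T < real n0 * \<delta>" using n0 \<delta> by (simp add: field_simps)
      also have "\<dots> \<le> real n * \<delta>" using n \<delta> by (intro mult_right_mono) auto
      finally show ?thesis using npos by (simp add: field_simps)
    qed
    define s where "s = real k * T / real n"
    have s: "0 < s" "s \<le> T"
      using False T npos k by (auto simp: s_def field_simps)
    have "has_RS_integral \<sigma> g 0 s (W s)" using W s by simp
    then obtain \<delta>' where \<delta>': "0 < \<delta>'" and rss: "rs_mesh \<sigma> g 0 s (W s) (\<epsilon> / 3) \<delta>'"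
      using e3 unfolding has_RS_integral_iff_mesh by blast
    \<comment> \<open>\<open>m\<close> depends on \<open>s\<close> through \<delta>', but it only
      serves the auxiliary fine partition; \<open>n0\<close> depends on \<delta> alone.\<close>
    obtain m :: nat where m: "s / min \<delta> \<delta>' < real m" using reals_Archimedean2 by blast
    have mpos: "0 < m"
    proof (rule ccontr)
      assume "\<not> 0 < m"
      moreover have "0 < s / min \<delta> \<delta>'" using s \<delta> \<delta>' by simp
      ultimately show False using m by simp
    qed
    have mm: "s / real m < \<delta>" "s / real m < \<delta>'"
    proof -
      define \<mu> where "\<mu> = min \<delta> \<delta>'"
      have \<mu>: "0 < \<mu>" "\<mu> \<le> \<delta>" "\<mu> \<le> \<delta>'" using \<delta> \<delta>' by (simp_all add: \<mu>_def)
      have "s / real m < \<mu>" using m \<mu>(1) mpos unfolding \<mu>_def[symmetric] by (simp add: field_simps)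
      then show "s / real m < \<delta>" "s / real m < \<delta>'" using \<mu> by linarith+
    qed
    define u where "u i = real i * s / real m" for i
    define v where "v i = real i * T / real n" for i
    have u: "u 0 = 0" "u m = s" "u i < u (Suc i)" "u (Suc i) - u i = s / real m" for i
    proof -
      have "u (Suc i) = u i + s / real m" for i by (simp add: u_def distrib_right add_divide_distrib)
      then show "u i < u (Suc i)" "u (Suc i) - u i = s / real m" for i using s mpos by simp_all
      show "u 0 = 0" "u m = s" using mpos by (auto simp: u_def)
    qed
    have v: "v 0 = 0" "v n = T" "v k = s" "v i < v (Suc i)" "v (Suc i) - v i = T / real n" for i
    proof -
      have "v (Suc i) = v i + T / real n" for i by (simp add: v_def distrib_right add_divide_distrib)
      then show "v i < v (Suc i)" "v (Suc i) - v i = T / real n" for i using T npos by auto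
      show "v 0 = 0" "v n = T" "v k = s" using npos by (auto simp: v_def s_def)
    qed
    define F where "F w i = \<sigma> (w (Suc i)) *v (g (w (Suc i)) - g (w i))" for w :: "nat \<Rightarrow> real" and i
    define w where "w i = (if i \<le> m then u i else v (k + (i - m)))" for i
    have Fw1: "F w i = F u i" if "i < m" for i using that by (simp add: F_def w_def)
    have wm: "w (m + i) = v (k + i)" for i using u v by (cases i) (auto simp: w_def)
    have Fw2: "F w (m + i) = F v (k + i)" for i
      using wm[of i] wm[of "Suc i"] by (simp add: F_def)
    have 1: "norm ((\<Sum>i<m. F u i) - W s) < \<epsilon> / 3"
      unfolding F_def by (rule rs_meshD[OF rss]) (use u mm in auto)
    have 2: "norm ((\<Sum>i<n. F v i) - W T) < \<epsilon> / 3"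
      unfolding F_def by (rule rs_meshD[OF rsT]) (use v mesh in auto)
    have 3: "norm ((\<Sum>i<m + (n - k). F w i) - W T) < \<epsilon> / 3"
      unfolding F_def
    proof (rule rs_meshD[OF rsT])
      show "w 0 = 0" using u by (simp add: w_def)
      show "w (m + (n - k)) = T" using wm[of "n - k"] k v by simp
      fix i
      show "w i < w (Suc i) \<and> w (Suc i) - w i < \<delta>"
      proof (cases "i < m")
        case True
        then show ?thesis using u mm by (simp add: w_def)
      next
        case False
        then obtain p where "i = m + p" by (metis le_add_diff_inverse not_less)
        then show ?thesis using wm[of p] wm[of "Suc p"] v mesh by simp
      qed
    qed
    have "(\<Sum>i<m + (n - k). F w i) = (\<Sum>i<m. F u i) + (\<Sum>i<n - k. F v (k + i))"
      unfolding sum_lessThan_add using Fw1 Fw2 by simp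
    moreover have "(\<Sum>i<n. F v i) = (\<Sum>i<k. F v i) + (\<Sum>i<n - k. F v (k + i))"
      using sum_lessThan_add[of "F v" k "n - k"] k by simp
    ultimately have "(\<Sum>i<k. F v i) - W s = (((\<Sum>i<n. F v i) - W T) - ((\<Sum>i<m + (n - k). F w i) - W T)) + ((\<Sum>i<m. F u i) - W s)"
      by simp
    also have "norm \<dots> \<le> (\<epsilon> / 3 + \<epsilon> / 3) + \<epsilon> / 3"
      by (rule order_trans[OF norm_triangle_ineq add_mono[OF order_trans[OF norm_triangle_ineq4 add_mono]]])
         (use 1 2 3 in auto)
    finally show ?thesis unfolding s_def[symmetric] by (simp add: rs_sum_def F_def v_def)
  qed
  then show ?thesis using n0pos by blast
qed

lemma riemann_sum_uniform:
  fixes F :: "real \<Rightarrow> 'v::banach"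
  assumes T: "0 < T" and F: "continuous_on {0..T} F" and \<epsilon>: "0 < \<epsilon>"
  shows "\<exists>n0>0. \<forall>n\<ge>n0. \<forall>k\<le>n. norm ((\<Sum>j<k. (T / real n) *\<^sub>R F (real j * T / real n)) - integral {0..real k * T / real n} F) \<le> \<epsilon> * T"
proof -
  have "uniformly_continuous_on {0..T} F"
    by (rule compact_uniformly_continuous[OF F]) simp
  then obtain \<delta> where \<delta>: "0 < \<delta>" "\<And>s t. s \<in> {0..T} \<Longrightarrow> t \<in> {0..T} \<Longrightarrow> dist t s < \<delta> \<Longrightarrow> dist (F t) (F s) < \<epsilon>"
    using \<epsilon> unfolding uniformly_continuous_on_def by metis
  obtain n0 :: nat where n0: "T / \<delta> < real n0" using reals_Archimedean2 by blast
  have n0pos: "0 < n0" using n0 T \<delta> by (metis divide_pos_pos not_gr_zero of_nat_0 order_less_asym)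
  have "norm ((\<Sum>j<k. (T / real n) *\<^sub>R F (real j * T / real n)) - integral {0..real k * T / real n} F) \<le> real k * (T / real n * \<epsilon>)"
    if n: "n \<ge> n0" and "k \<le> n" for n k
    using \<open>k \<le> n\<close>
  proof (induction k)
    case (Suc k)
    have npos: "0 < n" using n n0pos by simp
    have mesh: "T / real n < \<delta>"
    proof -
      have "T < real n0 * \<delta>" using n0 \<delta> by (simp add: field_simps)
      also have "\<dots> \<le> real n * \<delta>" using n \<delta> by (intro mult_right_mono) auto
      finally show ?thesis using npos by (simp add: field_simps)
    qed
    define a where "a = real k * T / real n"
    define c where "c = real (Suc k) * T / real n"
    have ac: "0 \<le> a" "a \<le> c" "c - a = T / real n"
    proof -
      have "c = a + T / real n" by (simp add: a_def c_def distrib_right add_divide_distrib)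
      then show "0 \<le> a" "a \<le> c" "c - a = T / real n" using T npos by (auto simp: a_def)
    qed
    have cT: "c \<le> T"
    proof -
      have "real (Suc k) * T \<le> real n * T" using Suc.prems T by (intro mult_right_mono) auto
      then show ?thesis using npos by (simp add: c_def field_simps)
    qed
    have Fc: "continuous_on {0..c} F" "continuous_on {a..c} F"
      using ac cT by (auto intro: continuous_on_subset[OF F])
    have "integral {0..a} F + integral {a..c} F = integral {0..c} F"
      by (rule Henstock_Kurzweil_Integration.integral_combine[OF ac(1,2) integrable_continuous_interval[OF Fc(1)]])
    then have eq: "(\<Sum>j<Suc k. (T / real n) *\<^sub>R F (real j * T / real n)) - integral {0..c} F
        = ((\<Sum>j<k. (T / real n) *\<^sub>R F (real j * T / real n)) - integral {0..a} F)
          + ((T / real n) *\<^sub>R F a - integral {a..c} F)"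
      by (simp add: a_def algebra_simps)
    have "norm (integral {a..c} (\<lambda>s. F s - F a)) \<le> \<epsilon> * (c - a)"
    proof (rule integral_bound[OF ac(2)])
      show "continuous_on {a..c} (\<lambda>s. F s - F a)" using Fc by (intro continuous_intros)
      fix s assume "s \<in> {a..c}"
      then have "dist (F s) (F a) < \<epsilon>" using ac cT mesh by (intro \<delta>(2)) (auto simp: dist_real_def)
      then show "norm (F s - F a) \<le> \<epsilon>" by (simp add: dist_norm)
    qed
    moreover have "integral {a..c} (\<lambda>s. F s - F a) = integral {a..c} F - (c - a) *\<^sub>R F a"
      using Henstock_Kurzweil_Integration.integral_diff[OF integrable_continuous_interval[OF Fc(2)] integrable_const_ivl[of "F a"]] ac
      by simp
    ultimately have "norm ((T / real n) *\<^sub>R F a - integral {a..c} F) \<le> T / real n * \<epsilon>"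
      using ac by (simp add: norm_minus_commute mult.commute)
    moreover have "norm ((\<Sum>j<k. (T / real n) *\<^sub>R F (real j * T / real n)) - integral {0..a} F) \<le> real k * (T / real n * \<epsilon>)"
      using Suc by (simp add: a_def)
    ultimately have "norm ((\<Sum>j<Suc k. (T / real n) *\<^sub>R F (real j * T / real n)) - integral {0..c} F) \<le> real k * (T / real n * \<epsilon>) + T / real n * \<epsilon>"
      unfolding eq by (intro order_trans[OF norm_triangle_ineq] add_mono)
    moreover have "real k * (T / real n * \<epsilon>) + T / real n * \<epsilon> = real (Suc k) * (T / real n * \<epsilon>)"
      by (simp add: distrib_right add_divide_distrib)
    ultimately show ?case unfolding c_def by (simp only:)
  qed simp
  moreover have "real k * (T / real n * \<epsilon>) \<le> \<epsilon> * T" if "n \<ge> n0" "k \<le> n" for n k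
  proof -
    have "real k * (T / real n * \<epsilon>) \<le> real n * (T / real n * \<epsilon>)"
      using that T \<epsilon> by (intro mult_right_mono) auto
    then show ?thesis using n0pos that by (simp add: mult.commute)
  qed
  ultimately show ?thesis using n0pos order_trans by blast
qed

section \<open>Stability and convergence of the Euler scheme for a Lipschitz drift\<close>

locale lipschitz_drift =
  fixes T K :: real and b :: "real \<Rightarrow> real^'d \<Rightarrow> real^'d"
  assumes T: "0 < T" and K: "0 \<le> K"
    and lip: "\<And>t x y. t \<in> {0..T} \<Longrightarrow> norm (b t x - b t y) \<le> K * norm (x - y)"
begin

lemma grid_mem: "0 < n \<Longrightarrow> j \<le> n \<Longrightarrow> real j * (T / real n) \<in> {0..T}"
  using T mult_right_mono[of "real j" "real n" "T / real n"] by simp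

lemma drift_measurable: "t \<in> {0..T} \<Longrightarrow> b t \<in> borel_measurable borel"
  by (rule borel_measurable_continuous_onI, rule lipschitz_on_continuous_on[of K])
     (use lip K in \<open>auto simp: lipschitz_on_def dist_norm\<close>)

lemma euler_measurable:
  assumes n: "0 < n" and s: "\<And>k. k \<le> n \<Longrightarrow> (\<lambda>\<omega>. s \<omega> k) \<in> borel_measurable N"
  shows "(\<lambda>\<omega>. euler b (T / real n) (s \<omega>) n) \<in> borel_measurable N"
proof -
  have "(\<lambda>\<omega>. euler b (T / real n) (s \<omega>) k) \<in> borel_measurable N" if "k \<le> n" for k
    using that
  proof (induction k)
    case (Suc k)
    have "(\<lambda>\<omega>. b (real k * (T / real n)) (euler b (T / real n) (s \<omega>) k)) \<in> borel_measurable N"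
      using Suc n by (intro measurable_compose[OF _ drift_measurable[OF grid_mem]]) auto
    then show ?case using Suc s by auto
  qed (use s in auto)
  then show ?thesis by simp
qed

text \<open>Neither sequence has to be a scheme: \<open>d\<close> collects the part of
  \<open>y - y'\<close> that the drift differences do not explain. In \<open>euler_diff\<close> it
  is the change of the driving sequence, in \<open>euler_converges\<close> the consistency
  error.\<close>

lemma perturbation:
  fixes y y' d :: "nat \<Rightarrow> real^'d"
  assumes n: "0 < n" and d: "\<And>k. k \<le> n \<Longrightarrow> y k - y' k - d k =
      (\<Sum>j<k. (T / real n) *\<^sub>R (b (real j * (T / real n)) (y j) - b (real j * (T / real n)) (y' j)))"
  shows "norm (y n - y' n - d n) \<le> K * exp (K * T) * (T / real n * (\<Sum>k<n. norm (d k)))"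
proof -
  let ?c = "K * T / real n"
  have c: "0 \<le> ?c" using K T by simp
  have "norm (y n - y' n - d n) \<le> ?c * ((1 + ?c) ^ n * (\<Sum>k<n. norm (d k)))"
  proof (rule stability[OF c])
    fix k assume k: "k \<le> n"
    have "norm (y k - y' k - d k) \<le> (\<Sum>j<k. norm ((T / real n) *\<^sub>R (b (real j * (T / real n)) (y j) - b (real j * (T / real n)) (y' j))))"
      unfolding d[OF k] by (rule norm_sum)
    also have "\<dots> \<le> (\<Sum>j<k. ?c * norm (y j - y' j))"
    proof (rule sum_mono)
      fix j assume "j \<in> {..<k}"
      then have "norm (b (real j * (T / real n)) (y j) - b (real j * (T / real n)) (y' j)) \<le> K * norm (y j - y' j)"
        using k n by (intro lip grid_mem) auto
      then have "(T / real n) * norm (b (real j * (T / real n)) (y j) - b (real j * (T / real n)) (y' j)) \<le> (T / real n) * (K * norm (y j - y' j))"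
        using T by (intro mult_left_mono) auto
      then show "norm ((T / real n) *\<^sub>R (b (real j * (T / real n)) (y j) - b (real j * (T / real n)) (y' j))) \<le> ?c * norm (y j - y' j)"
        using T by (simp add: mult_ac)
    qed
    finally show "norm (y k - y' k - d k) \<le> ?c * (\<Sum>j<k. norm (y j - y' j))"
      by (simp add: sum_distrib_left)
  qed
  also have "\<dots> \<le> ?c * (exp (K * T) * (\<Sum>k<n. norm (d k)))"
    using c K T n one_plus_power_le_exp[of "K * T" n]
    by (intro mult_left_mono mult_right_mono) (auto intro: sum_nonneg)
  finally show ?thesis by (simp add: mult_ac)
qed

lemma euler_diff:
  assumes n: "0 < n"
  shows "norm (euler b (T / real n) s n - euler b (T / real n) s' n - (s n - s' n))
    \<le> K * exp (K * T) * (T / real n * (\<Sum>k<n. norm (s k - s' k)))"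
proof (rule perturbation[OF n, of "euler b (T / real n) s" "euler b (T / real n) s'" "\<lambda>k. s k - s' k"])
  fix k
  show "euler b (T / real n) s k - euler b (T / real n) s' k - (s k - s' k) =
     (\<Sum>j<k. (T / real n) *\<^sub>R (b (real j * (T / real n)) (euler b (T / real n) s j) - b (real j * (T / real n)) (euler b (T / real n) s' j)))"
    using euler_eq_sum[of b "T / real n" s k] euler_eq_sum[of b "T / real n" s' k]
    by (simp add: sum_subtractf scaleR_diff_right)
qed

lemma euler_lipschitz_start:
  assumes n: "0 < n"
  shows "norm (euler b (T / real n) (\<lambda>k. x + s k) n - euler b (T / real n) (\<lambda>k. x' + s k) n)
    \<le> (1 + K * exp (K * T) * T) * norm (x - x')"
proof -
  have "norm (euler b (T / real n) (\<lambda>k. x + s k) n - euler b (T / real n) (\<lambda>k. x' + s k) n - (x - x'))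
     \<le> K * exp (K * T) * T * norm (x - x')"
    using euler_diff[OF n, of "\<lambda>k. x + s k" "\<lambda>k. x' + s k"] n by simp
  then show ?thesis
    using norm_triangle_ineq[of "euler b (T / real n) (\<lambda>k. x + s k) n - euler b (T / real n) (\<lambda>k. x' + s k) n - (x - x')" "x - x'"]
    by (simp add: algebra_simps)
qed

text \<open>Exchange of summation: \<open>a j\<close> is counted once for each k with j < k < n.
  Multiplied by T / n, this count is the time left from the grid point with index j + 1 until
  T.\<close>

lemma sum_sum_lessThan:
  fixes a :: "nat \<Rightarrow> real"
  shows "(\<Sum>k<n. \<Sum>j<k. a j) = (\<Sum>j<n. (real n - real (Suc j)) * a j)"
proof (induction n)
  case (Suc n)
  have "(\<Sum>j<n. (real (Suc n) - real (Suc j)) * a j) = (\<Sum>j<n. (real n - real (Suc j)) * a j) + (\<Sum>j<n. a j)"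
    by (simp add: sum.distrib[symmetric] algebra_simps)
  then show ?case using Suc by simp
qed simp

text \<open>Two errors disturb the linear term. The drift sees the perturbation only through its
  time integral, that is, through increments weighted by the remaining time (\<eta>1); freezing
  \<sigma> at T costs the modulus \<rho> (\<eta>2). The path \<open>r\<close> cancels from
  differences, so the bound is uniform in \<open>r\<close>.\<close>

lemma euler_near_linear:
  fixes \<sigma> :: "real \<Rightarrow> real^'d^'d" and r :: "real \<Rightarrow> real^'d" and x :: "real^'d" and \<phi> \<rho> :: "real \<Rightarrow> real"
  assumes n: "0 < n" and C: "\<And>t. t \<in> {0..T} \<Longrightarrow> norm (\<sigma> t) \<le> C"
    and \<rho>: "\<And>t v. t \<in> {0..T} \<Longrightarrow> norm (\<sigma> t *v v - \<sigma> T *v v) \<le> \<rho> t * norm v"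
    and \<phi>0: "\<phi> 0 = 0"
    and \<eta>1: "weighted_variation (\<lambda>t. T - t) \<phi> T n \<le> \<eta>1"
    and \<eta>2: "weighted_variation \<rho> \<phi> T n \<le> \<eta>2"
  defines "\<Phi> \<equiv> \<lambda>g. euler b (T / real n) (\<lambda>k. x + rs_sum \<sigma> T n (\<lambda>t. r t + \<phi> t *\<^sub>R g) k) n"
  shows "norm (\<Phi> g - \<Phi> g' - \<phi> T *\<^sub>R (\<sigma> T *v (g - g'))) \<le> (K * exp (K * T) * C * \<eta>1 + \<eta>2) * norm (g - g')"
proof -
  define t where "t j = real j * T / real n" for j
  define a where "a j = \<phi> (t (Suc j)) - \<phi> (t j)" for j
  have tm: "t j \<in> {0..T}" if "j \<le> n" for j using grid_mem[OF n that] by (simp add: t_def)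
  have "norm (\<sigma> T) \<le> C" using C T by simp
  then have C0: "0 \<le> C" using norm_ge_zero[of "\<sigma> T"] by linarith
  define s where "s = (\<lambda>g k. x + rs_sum \<sigma> T n (\<lambda>t. r t + \<phi> t *\<^sub>R g) k)"
  have sd: "s g k - s g' k = (\<Sum>j<k. a j *\<^sub>R (\<sigma> (t (Suc j)) *v (g - g')))" for k
  proof -
    have "s g k - s g' k = (\<Sum>j<k. \<sigma> (t (Suc j)) *v ((r (t (Suc j)) + \<phi> (t (Suc j)) *\<^sub>R g - (r (t j) + \<phi> (t j) *\<^sub>R g))
        - (r (t (Suc j)) + \<phi> (t (Suc j)) *\<^sub>R g' - (r (t j) + \<phi> (t j) *\<^sub>R g'))))"
      unfolding s_def rs_sum_def t_def[symmetric]
      by (simp only: matrix_vector_mult_diff_distrib sum_subtractf add_diff_cancel_left)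
    also have "\<dots> = (\<Sum>j<k. a j *\<^sub>R (\<sigma> (t (Suc j)) *v (g - g')))"
    proof (rule sum.cong)
      fix j
      have "(r (t (Suc j)) + \<phi> (t (Suc j)) *\<^sub>R g - (r (t j) + \<phi> (t j) *\<^sub>R g))
        - (r (t (Suc j)) + \<phi> (t (Suc j)) *\<^sub>R g' - (r (t j) + \<phi> (t j) *\<^sub>R g')) = a j *\<^sub>R (g - g')"
        by (simp add: a_def scaleR_diff_left scaleR_diff_right)
      then show "\<sigma> (t (Suc j)) *v ((r (t (Suc j)) + \<phi> (t (Suc j)) *\<^sub>R g - (r (t j) + \<phi> (t j) *\<^sub>R g))
        - (r (t (Suc j)) + \<phi> (t (Suc j)) *\<^sub>R g' - (r (t j) + \<phi> (t j) *\<^sub>R g'))) = a j *\<^sub>R (\<sigma> (t (Suc j)) *v (g - g'))"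
        by (simp only: matrix_vector_mult_scaleR)
    qed simp
    finally show ?thesis .
  qed
  have sn: "norm (s g k - s g' k) \<le> (\<Sum>j<k. \<bar>a j\<bar>) * (C * norm (g - g'))" if k: "k \<le> n" for k
  proof -
    have "norm (s g k - s g' k) \<le> (\<Sum>j<k. norm (a j *\<^sub>R (\<sigma> (t (Suc j)) *v (g - g'))))"
      unfolding sd by (rule norm_sum)
    also have "\<dots> \<le> (\<Sum>j<k. \<bar>a j\<bar> * (C * norm (g - g')))"
    proof (rule sum_mono)
      fix j assume "j \<in> {..<k}"
      then have "norm (\<sigma> (t (Suc j)) *v (g - g')) \<le> C * norm (g - g')"
        using k by (intro order_trans[OF norm_matrix_vector_mult_le mult_right_mono] C tm) auto
      then show "norm (a j *\<^sub>R (\<sigma> (t (Suc j)) *v (g - g'))) \<le> \<bar>a j\<bar> * (C * norm (g - g'))"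
        by (simp add: mult_left_mono)
    qed
    finally show ?thesis by (simp add: sum_distrib_right)
  qed
  have "T / real n * (\<Sum>k<n. norm (s g k - s g' k)) \<le> T / real n * (\<Sum>k<n. (\<Sum>j<k. \<bar>a j\<bar>) * (C * norm (g - g')))"
    using T by (intro mult_left_mono sum_mono sn) auto
  also have "\<dots> = (\<Sum>j<n. T / real n * (real n - real (Suc j)) * \<bar>a j\<bar>) * (C * norm (g - g'))"
    by (simp only: sum_distrib_right[symmetric] sum_sum_lessThan) (simp only: sum_distrib_left mult.assoc[symmetric])
  also have "\<dots> \<le> \<eta>1 * (C * norm (g - g'))"
  proof (rule mult_right_mono)
    have "T / real n * (real n - real (Suc j)) = T - real (Suc j) * T / real n" for j
      using n by (simp add: right_diff_distrib mult.commute)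
    then show "(\<Sum>j<n. T / real n * (real n - real (Suc j)) * \<bar>a j\<bar>) \<le> \<eta>1"
      using \<eta>1 by (simp only: a_def t_def weighted_variation_def)
  qed (use C0 in auto)
  finally have A: "T / real n * (\<Sum>k<n. norm (s g k - s g' k)) \<le> \<eta>1 * (C * norm (g - g'))" .
  have "norm (\<Phi> g - \<Phi> g' - (s g n - s g' n)) \<le> K * exp (K * T) * (T / real n * (\<Sum>k<n. norm (s g k - s g' k)))"
    unfolding \<Phi>_def using euler_diff[OF n, of "s g" "s g'"] by (simp add: s_def)
  also have "\<dots> \<le> K * exp (K * T) * (\<eta>1 * (C * norm (g - g')))"
    using A K by (intro mult_left_mono) auto
  finally have 1: "norm (\<Phi> g - \<Phi> g' - (s g n - s g' n)) \<le> K * exp (K * T) * (\<eta>1 * (C * norm (g - g')))" .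
  \<comment> \<open>As \<open>\<phi> 0 = 0\<close>, the increments sum to \<open>\<phi> T\<close>,
    so the linear term can be subtracted cell by cell.\<close>
  have tel: "\<phi> T = (\<Sum>j<n. a j)"
    using sum_lessThan_telescope[of "\<lambda>j. \<phi> (t j)" n] \<phi>0 n by (simp add: a_def t_def)
  have "s g n - s g' n - \<phi> T *\<^sub>R (\<sigma> T *v (g - g')) = (\<Sum>j<n. a j *\<^sub>R (\<sigma> (t (Suc j)) *v (g - g') - \<sigma> T *v (g - g')))"
    unfolding sd tel by (simp add: scaleR_sum_left scaleR_diff_right sum_subtractf)
  also have "norm \<dots> \<le> (\<Sum>j<n. norm (a j *\<^sub>R (\<sigma> (t (Suc j)) *v (g - g') - \<sigma> T *v (g - g'))))"
    by (rule norm_sum)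
  also have "\<dots> \<le> (\<Sum>j<n. \<rho> (t (Suc j)) * \<bar>a j\<bar> * norm (g - g'))"
  proof (rule sum_mono)
    fix j assume "j \<in> {..<n}"
    then have "norm (\<sigma> (t (Suc j)) *v (g - g') - \<sigma> T *v (g - g')) \<le> \<rho> (t (Suc j)) * norm (g - g')"
      by (intro \<rho> tm) auto
    then have "\<bar>a j\<bar> * norm (\<sigma> (t (Suc j)) *v (g - g') - \<sigma> T *v (g - g')) \<le> \<bar>a j\<bar> * (\<rho> (t (Suc j)) * norm (g - g'))"
      by (rule mult_left_mono) simp
    then show "norm (a j *\<^sub>R (\<sigma> (t (Suc j)) *v (g - g') - \<sigma> T *v (g - g'))) \<le> \<rho> (t (Suc j)) * \<bar>a j\<bar> * norm (g - g')"
      by (simp add: mult_ac)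
  qed
  also have "\<dots> \<le> \<eta>2 * norm (g - g')"
    using \<eta>2 by (simp add: sum_distrib_right[symmetric] a_def t_def weighted_variation_def mult_right_mono)
  finally have 2: "norm (s g n - s g' n - \<phi> T *\<^sub>R (\<sigma> T *v (g - g'))) \<le> \<eta>2 * norm (g - g')" .
  have "norm (\<Phi> g - \<Phi> g' - \<phi> T *\<^sub>R (\<sigma> T *v (g - g'))) \<le>
      norm (\<Phi> g - \<Phi> g' - (s g n - s g' n)) + norm (s g n - s g' n - \<phi> T *\<^sub>R (\<sigma> T *v (g - g')))"
    using dist_triangle[of "\<Phi> g - \<Phi> g'" "\<phi> T *\<^sub>R (\<sigma> T *v (g - g'))" "s g n - s g' n"] unfolding dist_norm .
  also have "\<dots> \<le> K * exp (K * T) * (\<eta>1 * (C * norm (g - g'))) + \<eta>2 * norm (g - g')" using 1 2 by (rule add_mono)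
  also have "\<dots> = (K * exp (K * T) * C * \<eta>1 + \<eta>2) * norm (g - g')"
    unfolding distrib_right by (simp only: mult_ac)
  finally show ?thesis .
qed

text \<open>The solution sampled on the grid satisfies the scheme up to \<open>d k\<close>, the
  error of the Stieltjes sum plus that of the Riemann sum of the drift. Both are small uniformly in
  k, and \<open>perturbation\<close> carries this to time T.\<close>

lemma euler_converges:
  assumes time: "\<And>x. continuous_on {0..T} (\<lambda>t. b t x)"
    and X: "continuous_on {0..T} X"
    and rs: "\<And>t. t \<in> {0..T} \<Longrightarrow> has_RS_integral \<sigma> g 0 t (X t - x - integral {0..t} (\<lambda>s. b s (X s)))"
  shows "(\<lambda>n. euler b (T / real (Suc n)) (\<lambda>k. x + rs_sum \<sigma> T (Suc n) g k) (Suc n)) \<longlonglongrightarrow> X T"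
proof (rule LIMSEQ_I)
  fix r :: real assume r: "0 < r"
  \<comment> \<open>Amplification of the error \<epsilon>: the factor 1 + T comes from the two
    consistency errors, the other from the feedback of the drift.\<close>
  define A where "A = (1 + T) * (1 + K * exp (K * T) * T)"
  have A: "0 < A" using T K by (auto simp: A_def intro!: mult_pos_pos add_pos_nonneg)
  define \<epsilon> where "\<epsilon> = r / (2 * A)"
  have \<epsilon>: "0 < \<epsilon>" using r A by (simp add: \<epsilon>_def)
  let ?F = "\<lambda>s. b s (X s)"
  \<comment> \<open>The drift is Lipschitz in space with a constant independent of time, and
    continuous in time at a fixed position; together this gives continuity along the path.\<close>
  have F: "continuous_on {0..T} ?F"
  proof (rule continuous_onI)
    fix s and e :: real assume s: "s \<in> {0..T}" and e: "0 < e"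
    have "0 < e / (2 * (K + 1))" using e K by simp
    with X s obtain d1 where d1: "0 < d1" "\<And>t. t \<in> {0..T} \<Longrightarrow> dist t s < d1 \<Longrightarrow> dist (X t) (X s) < e / (2 * (K + 1))"
      unfolding continuous_on_iff by metis
    from time[of "X s"] s e obtain d2 where d2: "0 < d2" "\<And>t. t \<in> {0..T} \<Longrightarrow> dist t s < d2 \<Longrightarrow> dist (b t (X s)) (b s (X s)) < e / 2"
      unfolding continuous_on_iff by (metis half_gt_zero)
    have "dist (?F t) (?F s) \<le> e" if t: "t \<in> {0..T}" "dist t s < min d1 d2" for t
    proof -
      have "dist (?F t) (b t (X s)) \<le> K * dist (X t) (X s)" using lip[OF t(1)] by (simp add: dist_norm)
      also have "\<dots> \<le> (K + 1) * (e / (2 * (K + 1)))"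
        using d1(2)[OF t(1)] t(2) K by (intro mult_mono) auto
      also have "\<dots> = e / 2" using K by (simp add: divide_simps)
      finally show ?thesis using d2(2)[OF t(1)] t(2) dist_triangle[of "?F t" "?F s" "b t (X s)"] by simp
    qed
    then show "\<exists>d>0. \<forall>x'\<in>{0..T}. dist x' s < d \<longrightarrow> dist (?F x') (?F s) \<le> e"
      using d1 d2 by (intro exI[of _ "min d1 d2"]) auto
  qed
  define W where "W t = X t - x - integral {0..t} ?F" for t
  obtain n1 where n1: "0 < n1" "\<And>n k. n \<ge> n1 \<Longrightarrow> k \<le> n \<Longrightarrow> norm (rs_sum \<sigma> T n g k - W (real k * T / real n)) \<le> \<epsilon>"
    using rs_sum_uniform[OF T _ \<epsilon>, of \<sigma> g W] rs unfolding W_def by blast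
  obtain n2 where n2: "0 < n2" "\<And>n k. n \<ge> n2 \<Longrightarrow> k \<le> n \<Longrightarrow>
      norm ((\<Sum>j<k. (T / real n) *\<^sub>R ?F (real j * T / real n)) - integral {0..real k * T / real n} ?F) \<le> \<epsilon> * T"
    using riemann_sum_uniform[OF T F \<epsilon>] by blast
  have "norm (euler b (T / real n) (\<lambda>k. x + rs_sum \<sigma> T n g k) n - X T) < r" if n: "n \<ge> max n1 n2" for n
  proof -
    have npos: "0 < n" using n n1 by simp
    define y where "y = euler b (T / real n) (\<lambda>k. x + rs_sum \<sigma> T n g k)"
    define y' where "y' k = X (real k * T / real n)" for k
    define d where "d k = (rs_sum \<sigma> T n g k - W (real k * T / real n)) +
      ((\<Sum>j<k. (T / real n) *\<^sub>R ?F (real j * T / real n)) - integral {0..real k * T / real n} ?F)" for k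
    have dk: "norm (d k) \<le> \<epsilon> * (1 + T)" if "k \<le> n" for k
    proof -
      have "norm (d k) \<le> \<epsilon> + \<epsilon> * T"
        unfolding d_def using n that by (intro order_trans[OF norm_triangle_ineq] add_mono n1(2) n2(2)) auto
      then show ?thesis by (simp add: algebra_simps)
    qed
    have "norm (y n - y' n - d n) \<le> K * exp (K * T) * (T / real n * (\<Sum>k<n. norm (d k)))"
    proof (rule perturbation[OF npos])
      fix k
      show "y k - y' k - d k = (\<Sum>j<k. (T / real n) *\<^sub>R (b (real j * (T / real n)) (y j) - b (real j * (T / real n)) (y' j)))"
        unfolding y_def
        by (subst euler_eq_sum) (simp add: d_def W_def y'_def sum_subtractf scaleR_diff_right)
    qed
    also have "\<dots> \<le> K * exp (K * T) * (T / real n * (\<Sum>k<n. \<epsilon> * (1 + T)))"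
      using K T dk by (intro mult_left_mono sum_mono) auto
    also have "\<dots> = K * exp (K * T) * T * (\<epsilon> * (1 + T))" using npos by simp
    finally have "norm (y n - y' n) \<le> K * exp (K * T) * T * (\<epsilon> * (1 + T)) + \<epsilon> * (1 + T)"
      using dk[of n] norm_triangle_ineq[of "y n - y' n - d n" "d n"] by simp
    also have "\<dots> = \<epsilon> * A" by (simp add: A_def algebra_simps)
    also have "\<dots> = r / 2" using A by (simp add: \<epsilon>_def)
    also have "\<dots> < r" using r by simp
    finally show ?thesis using npos by (simp add: y_def y'_def)
  qed
  then show "\<exists>no. \<forall>n\<ge>no. norm (euler b (T / real (Suc n)) (\<lambda>k. x + rs_sum \<sigma> T (Suc n) g k) (Suc n) - X T) < r"
    by (intro exI[of _ "max n1 n2"]) (metis le_SucI)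
qed

end

section \<open>Nearly linear maps\<close>

lemma near_linear_expanding:
  fixes F D :: "'v::real_normed_vector \<Rightarrow> 'w::real_normed_vector"
  assumes D: "\<And>v. m * norm v \<le> norm (D v)"
    and near: "norm (F g - F g' - D (g - g')) \<le> c * norm (g - g')"
  shows "(m - c) * norm (g - g') \<le> norm (F g - F g')"
proof -
  have "norm (D (g - g')) \<le> norm (F g - F g') + norm (F g - F g' - D (g - g'))"
    using norm_triangle_ineq4[of "F g - F g'" "F g - F g' - D (g - g')"] by simp
  then show ?thesis using D[of "g - g'"] near by (simp add: left_diff_distrib)
qed

text \<open>Solving \<open>F g = z\<close> means finding a fixed point of
  \<open>g + inv D (z - F g)\<close>. This map contracts with factor \<open>c / m\<close>, since
  \<open>inv D\<close> has norm at most \<open>1 / m\<close>.\<close>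

lemma near_linear_surj:
  fixes F D :: "'v::euclidean_space \<Rightarrow> 'v"
  assumes lin: "linear D" and m: "0 < m" and D: "\<And>v. m * norm v \<le> norm (D v)"
    and c: "0 \<le> c" "c < m"
    and near: "\<And>g g'. norm (F g - F g' - D (g - g')) \<le> c * norm (g - g')"
  shows "surj F"
proof -
  have inj: "inj D"
  proof (rule linear_injective_0[OF lin, THEN iffD2], intro allI impI)
    fix v assume "D v = 0"
    then have "m * norm v \<le> 0" using D[of v] by simp
    then show "v = 0" using m by (simp add: mult_le_0_iff)
  qed
  have surjD: "surj D" by (rule linear_injective_imp_surjective[OF lin inj refl])
  have DI: "D (inv D w) = w" for w by (rule surj_f_inv_f[OF surjD])
  have ID: "inv D (D w) = w" for w by (rule inv_f_f[OF inj])
  have linI: "linear (inv D)"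
    using inj_linear_imp_inv_linear[OF lin inj] .
  have bI: "norm (inv D w) \<le> norm w / m" for w
    using D[of "inv D w"] m by (simp add: DI field_simps)
  have "\<exists>g. F g = z" for z
  proof -
    define h where "h g = g + inv D (z - F g)" for g
    have "\<exists>!g\<in>UNIV. h g = g"
    proof (rule Banach_fix[of UNIV "c / m"])
      show "\<And>x y. x \<in> UNIV \<Longrightarrow> y \<in> UNIV \<Longrightarrow> dist (h x) (h y) \<le> c / m * dist x y"
      proof -
        fix x y
        have "h x - h y = inv D (D (x - y)) + (inv D (z - F x) - inv D (z - F y))"
          by (simp add: h_def ID)
        also have "\<dots> = inv D (D (x - y) + ((z - F x) - (z - F y)))"
          by (simp only: linear_add[OF linI] linear_diff[OF linI])
        also have "D (x - y) + ((z - F x) - (z - F y)) = - (F x - F y - D (x - y))" by simp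
        finally have "norm (h x - h y) \<le> norm (F x - F y - D (x - y)) / m"
          using bI[of "- (F x - F y - D (x - y))"] by (simp only: norm_minus_cancel)
        also have "\<dots> \<le> c * norm (x - y) / m" using near[of x y] m by (intro divide_right_mono) auto
        finally show "dist (h x) (h y) \<le> c / m * dist x y" by (simp add: dist_norm)
      qed
    qed (use c m in \<open>auto simp: complete_UNIV\<close>)
    then obtain g where "h g = g" by blast
    then have "inv D (z - F g) = 0" by (simp add: h_def)
    then have "z - F g = D 0" using DI by metis
    then show ?thesis using linear_0[OF lin] by (intro exI[of _ g]) simp
  qed
  then show ?thesis unfolding surj_def by metis
qed

text \<open>Cover \<open>E\<close> by cubes with disjoint interiors and total volume close to that
  of \<open>E\<close>; the image of a cube of side s lies in a cube of side
  \<open>2 * L * DIM('v) * s\<close>. In the application \<open>E\<close> is the preimage of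
  \<open>A\<close>, whose volume is thus bounded from below.\<close>

lemma lipschitz_image_emeasure_le:
  fixes F :: "'v::euclidean_space \<Rightarrow> 'v"
  assumes L: "0 \<le> L" "\<And>x y. norm (F x - F y) \<le> L * norm (x - y)"
    and E: "E \<in> sets borel" "bounded E" and A: "A \<in> sets borel" "A \<subseteq> F ` E"
  shows "emeasure lborel A \<le> ennreal ((2 * L * DIM('v)) ^ DIM('v)) * emeasure lborel E"
proof -
  define C where "C = (2 * L * DIM('v)) ^ DIM('v)"
  have C: "0 \<le> C" using L by (simp add: C_def)
  obtain r where r: "0 < r" "\<And>x. x \<in> E \<Longrightarrow> norm x \<le> r"
    using E(2) bounded_pos by blast
  \<comment> \<open>The outer box is a cube, so that all dyadic pieces are cubes as well.\<close>
  define lo hi :: 'v where "lo = - r *\<^sub>R One" and "hi = r *\<^sub>R One"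
  have Esub: "E \<subseteq> cbox lo hi"
  proof
    fix x assume x: "x \<in> E"
    have "\<bar>x \<bullet> i\<bar> \<le> r" if "i \<in> Basis" for i
      using Basis_le_norm[OF that, of x] r(2)[OF x] by linarith
    then show "x \<in> cbox lo hi" by (auto simp: mem_box lo_def hi_def abs_le_iff minus_le_iff)
  qed
  have Elm: "E \<in> lmeasurable"
    using E Esub by (intro bounded_set_imp_lmeasurable) auto
  have Eem: "emeasure lborel E = ennreal (measure lebesgue E)"
    using emeasure_eq_measure2[OF Elm] E(1) by simp
  have bound: "emeasure lborel A \<le> ennreal (C * (measure lebesgue E + e))" if e: "0 < e" for e
  proof -
    obtain \<D> where \<D>: "countable \<D>"
      "\<And>Q. Q \<in> \<D> \<Longrightarrow> Q \<subseteq> cbox lo hi \<and> Q \<noteq> {} \<and> (\<exists>c d. Q = cbox c d)"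
      "pairwise (\<lambda>A B. interior A \<inter> interior B = {}) \<D>"
      "\<And>u v. cbox u v \<in> \<D> \<Longrightarrow> \<exists>n. \<forall>i \<in> Basis. v \<bullet> i - u \<bullet> i = (hi \<bullet> i - lo \<bullet> i)/2^n"
      "E \<subseteq> \<Union>\<D>" "\<Union>\<D> \<in> lmeasurable" "measure lebesgue (\<Union>\<D>) \<le> measure lebesgue E + e"
      using measurable_outer_intervals_bounded[OF Elm Esub e] by metis
    have "S \<in> sets lborel" if "S \<in> \<D>" for S
      using \<D>(2)[OF that] by auto
    then have Dborel: "\<Union>\<D> \<in> sets lborel"
      using \<D>(1) by (intro sets.countable_Union) auto
    \<comment> \<open>The family may be finite, so its enumeration is padded with empty
      sets.\<close>
    define Q where "Q n = (if n \<in> to_nat_on \<D> ` \<D> then from_nat_into \<D> n else {})" for n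
    have Qin: "Q n \<in> \<D> \<or> Q n = {}" for n
      using \<D>(1) by (auto simp: Q_def)
    have Qun: "\<Union>\<D> = (\<Union>n. Q n)"
    proof
      show "\<Union>\<D> \<subseteq> (\<Union>n. Q n)"
      proof
        fix x assume "x \<in> \<Union>\<D>"
        then obtain S where S: "S \<in> \<D>" "x \<in> S" by blast
        then have "Q (to_nat_on \<D> S) = S" using \<D>(1) by (simp add: Q_def)
        then show "x \<in> (\<Union>n. Q n)" using S by blast
      qed
      show "(\<Union>n. Q n) \<subseteq> \<Union>\<D>" using Qin by fastforce
    qed
    have dis: "disjoint_family (\<lambda>n. interior (Q n))"
      unfolding disjoint_family_on_def
    proof (intro ballI impI)
      fix i j :: nat assume ij: "i \<noteq> j"
      show "interior (Q i) \<inter> interior (Q j) = {}"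
      proof (cases "i \<in> to_nat_on \<D> ` \<D> \<and> j \<in> to_nat_on \<D> ` \<D>")
        case True
        then obtain S S' where S: "S \<in> \<D>" "i = to_nat_on \<D> S" "S' \<in> \<D>" "j = to_nat_on \<D> S'" by blast
        then have "Q i = S" "Q j = S'" "S \<noteq> S'" using \<D>(1) ij by (auto simp: Q_def)
        then show ?thesis using \<D>(3) S unfolding pairwise_def by blast
      next
        case False
        then show ?thesis by (auto simp: Q_def)
      qed
    qed
    have "\<exists>Q'. F ` Q n \<subseteq> Q' \<and> Q' \<in> sets borel \<and> emeasure lborel Q' \<le> ennreal C * emeasure lborel (interior (Q n))" for n
    proof (cases "Q n = {}")
      case True
      then show ?thesis by (intro exI[of _ "{}"]) auto
    next
      case False
      then have QD: "Q n \<in> \<D>" using Qin by blast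
      then obtain u v where uv: "Q n = cbox u v" using \<D>(2) by blast
      then obtain k where k: "\<And>i. i \<in> Basis \<Longrightarrow> v \<bullet> i - u \<bullet> i = (hi \<bullet> i - lo \<bullet> i)/2^k"
        using \<D>(4) QD by metis
      define s where "s = 2 * r / 2 ^ k"
      have side: "v \<bullet> i - u \<bullet> i = s" if "i \<in> Basis" for i
        using k[OF that] that by (simp add: s_def hi_def lo_def)
      have s: "0 < s" using r by (simp add: s_def)
      \<comment> \<open>By comparison with the l1 norm, points of the cube are within
        \<open>DIM('v) * s\<close> of its corner \<open>u\<close>.\<close>
      define l where "l = L * DIM('v) * s"
      have l0: "0 \<le> l" using L s by (simp add: l_def)
      define Q' where "Q' = cbox (F u - l *\<^sub>R One) (F u + l *\<^sub>R One)"
      have "F ` Q n \<subseteq> Q'"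
      proof
        fix y assume "y \<in> F ` Q n"
        then obtain x where x: "x \<in> cbox u v" "y = F x" using uv by auto
        have "norm (x - u) \<le> (\<Sum>i\<in>Basis. \<bar>(x - u) \<bullet> i\<bar>)" by (rule norm_le_l1)
        also have "\<dots> \<le> (\<Sum>i\<in>(Basis::'v set). s)"
        proof (rule sum_mono)
          fix i :: 'v assume i: "i \<in> Basis"
          then have "u \<bullet> i \<le> x \<bullet> i" "x \<bullet> i \<le> v \<bullet> i" using x by (auto simp: mem_box)
          then show "\<bar>(x - u) \<bullet> i\<bar> \<le> s" using side[OF i] by (simp add: inner_diff_left)
        qed
        finally have "norm (x - u) \<le> DIM('v) * s" by simp
        then have "L * norm (x - u) \<le> l" using L(1) unfolding l_def mult.assoc by (rule mult_left_mono)
        then have "norm (y - F u) \<le> l" using L(2)[of x u] x by simp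
        then have "\<bar>(y - F u) \<bullet> i\<bar> \<le> l" if "i \<in> Basis" for i
          using Basis_le_norm[OF that, of "y - F u"] by linarith
        then show "y \<in> Q'" by (auto simp: Q'_def mem_box inner_diff_left inner_add_left abs_le_iff algebra_simps)
      qed
      moreover have "emeasure lborel Q' = ennreal ((2 * l) ^ DIM('v))"
        unfolding Q'_def using l0 by (subst emeasure_lborel_cbox) (auto simp: inner_diff_left inner_add_left)
      moreover have "emeasure lborel (interior (Q n)) = ennreal (s ^ DIM('v))"
      proof -
        have "emeasure lborel (box u v) = ennreal (\<Prod>i\<in>Basis. (v - u) \<bullet> i)"
          by (rule emeasure_lborel_box) (use side s in force)
        also have "(\<Prod>i\<in>Basis. (v - u) \<bullet> i) = s ^ DIM('v)"
          using side by (simp add: inner_diff_left)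
        finally show ?thesis by (simp add: uv)
      qed
      moreover have "(2 * l) ^ DIM('v) = C * s ^ DIM('v)"
        by (simp add: l_def C_def power_mult_distrib[symmetric] mult_ac)
      ultimately show ?thesis
        using C s by (intro exI[of _ Q']) (auto simp: Q'_def ennreal_mult[symmetric])
    qed
    then obtain Q' where Q': "\<And>n. F ` Q n \<subseteq> Q' n" "\<And>n. Q' n \<in> sets borel"
      "\<And>n. emeasure lborel (Q' n) \<le> ennreal C * emeasure lborel (interior (Q n))" by metis
    have "A \<subseteq> F ` (\<Union>\<D>)" by (rule order_trans[OF A(2) image_mono[OF \<D>(5)]])
    also have "\<dots> = (\<Union>n. F ` Q n)" unfolding Qun by (rule image_UN)
    also have "\<dots> \<subseteq> (\<Union>n. Q' n)" by (rule UN_mono[OF order_refl Q'(1)])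
    finally have "emeasure lborel A \<le> emeasure lborel (\<Union>n. Q' n)"
      using Q'(2) by (intro emeasure_mono) auto
    also have "\<dots> \<le> (\<Sum>n. emeasure lborel (Q' n))"
      using Q'(2) by (intro emeasure_subadditive_countably) auto
    also have "\<dots> \<le> (\<Sum>n. ennreal C * emeasure lborel (interior (Q n)))"
      using Q'(3) by (intro suminf_le) auto
    also have "\<dots> = ennreal C * (\<Sum>n. emeasure lborel (interior (Q n)))"
      by (rule ennreal_suminf_cmult)
    also have "(\<Sum>n. emeasure lborel (interior (Q n))) = emeasure lborel (\<Union>n. interior (Q n))"
      using dis by (intro suminf_emeasure) auto
    also have "\<dots> \<le> emeasure lborel (\<Union>\<D>)"
    proof (rule emeasure_mono)
      show "(\<Union>n. interior (Q n)) \<subseteq> \<Union>\<D>" unfolding Qun by (rule UN_mono[OF order_refl interior_subset])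
      show "\<Union>\<D> \<in> sets lborel" by (rule Dborel)
    qed
    also have "emeasure lborel (\<Union>\<D>) = ennreal (measure lebesgue (\<Union>\<D>))"
    proof -
      show ?thesis using emeasure_eq_measure2[OF \<D>(6)] Dborel by simp
    qed
    also have "ennreal C * \<dots> \<le> ennreal C * ennreal (measure lebesgue E + e)"
      using \<D>(7) by (intro mult_left_mono ennreal_leI) auto
    finally show ?thesis using C e by (simp add: ennreal_mult mult_left_mono)
  qed
  have "emeasure lborel A \<le> ennreal (C * measure lebesgue E)"
  proof (rule ennreal_le_epsilon)
    fix e :: real assume e: "0 < e"
    have "emeasure lborel A \<le> ennreal (C * (measure lebesgue E + e / (C + 1)))"
      using bound[of "e / (C + 1)"] e C by simp
    also have "\<dots> \<le> ennreal (C * measure lebesgue E + e)"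
    proof (rule ennreal_leI)
      have "C * (e / (C + 1)) \<le> e" using C e by (simp add: field_simps)
      then show "C * (measure lebesgue E + e / (C + 1)) \<le> C * measure lebesgue E + e" by (simp add: distrib_left)
    qed
    also have "\<dots> = ennreal (C * measure lebesgue E) + ennreal e" using C e by (simp add: ennreal_plus)
    finally show "emeasure lborel A \<le> ennreal (C * measure lebesgue E) + ennreal e" .
  qed
  then show ?thesis using C by (simp add: Eem C_def ennreal_mult)
qed

section \<open>Minorization for randomly shifted nearly linear maps\<close>

text \<open>\<open>N\<close> carries the randomness independent of \<open>G\<close>, so \<omega> can
  be frozen while \<open>g\<close> varies. The bound \<open>m / 2\<close> in \<open>near\<close>
  leaves half of the expansion of \<open>D\<close>. The constants are uniform in \<open>n\<close>,
  \<open>x\<close> and \<omega> and therefore pass to the limit of \<Phi>.\<close>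

locale random_near_linear = prob_space M
  for M :: "'a measure" +
  fixes N :: "'a measure" and G :: "'a \<Rightarrow> 'v::euclidean_space" and dens :: "'v \<Rightarrow> real"
    and \<Phi> :: "nat \<Rightarrow> 'v \<Rightarrow> 'a \<Rightarrow> 'v \<Rightarrow> 'v" and Y :: "'v \<Rightarrow> 'a \<Rightarrow> 'v" and D :: "'v \<Rightarrow> 'v" and m \<Lambda> :: real
  assumes id_measurable: "id \<in> measurable M N"
    and G_measurable: "G \<in> borel_measurable M"
    and joint_law: "distr M (N \<Otimes>\<^sub>M borel) (\<lambda>\<omega>. (\<omega>, G \<omega>)) = distr M N id \<Otimes>\<^sub>M distr M borel G"
    and G_law: "distr M borel G = density lborel (\<lambda>g. ennreal (dens g))"
    and dens_measurable: "dens \<in> borel_measurable borel"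
    and dens_lower: "\<And>r. \<exists>c>0. \<forall>g. norm g \<le> r \<longrightarrow> c \<le> dens g"
    and \<Phi>_measurable: "\<And>n x. (\<lambda>(\<omega>, g). \<Phi> n x \<omega> g) \<in> borel_measurable (N \<Otimes>\<^sub>M borel)"
    and D: "linear D" "0 < m" "\<And>v. m * norm v \<le> norm (D v)"
    and near: "\<And>n x \<omega> g g'. norm (\<Phi> n x \<omega> g - \<Phi> n x \<omega> g' - D (g - g')) \<le> m / 2 * norm (g - g')"
    and \<Lambda>: "0 \<le> \<Lambda>" "\<And>n x x' \<omega> g. norm (\<Phi> n x \<omega> g - \<Phi> n x' \<omega> g) \<le> \<Lambda> * norm (x - x')"
    and Y_measurable: "\<And>x. Y x \<in> borel_measurable M"
    and conv: "\<And>x. AE \<omega> in M. (\<lambda>n. \<Phi> n x \<omega> (G \<omega>)) \<longlonglongrightarrow> Y x \<omega>"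
begin

abbreviation "M' \<equiv> distr M N id"
abbreviation "\<gamma> \<equiv> distr M borel G"

sublocale M': prob_space M' by (rule prob_space_distr[OF id_measurable])
sublocale \<gamma>: prob_space \<gamma> by (rule prob_space_distr[OF G_measurable])
sublocale pair_sigma_finite M' \<gamma> ..

lemma pair_measurable: "(\<lambda>\<omega>. (\<omega>, G \<omega>)) \<in> measurable M (N \<Otimes>\<^sub>M borel)"
  using measurable_Pair[OF id_measurable G_measurable] by simp

text \<open>Where the sequence diverges, \<open>lim\<close> is an unspecified value; for each x,
  \<open>AE_convergent\<close> confines this to a null set of \<omega>, for all \<open>g\<close> at
  once.\<close>

definition F :: "'v \<Rightarrow> 'a \<Rightarrow> 'v \<Rightarrow> 'v" where
  "F x \<omega> g = lim (\<lambda>n. \<Phi> n x \<omega> g)"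

lemma F_measurable: "(\<lambda>z. F x (fst z) (snd z)) \<in> borel_measurable (N \<Otimes>\<^sub>M borel)"
  unfolding F_def using \<Phi>_measurable by (intro borel_measurable_lim_metric) (simp add: case_prod_unfold)

definition lip_const :: real where
  "lip_const = onorm D + m / 2"

lemma lip_const_pos: "0 < lip_const"
  using onorm_pos_le[OF linear_conv_bounded_linear[THEN iffD1, OF D(1)]] D(2) by (simp add: lip_const_def)

lemma \<Phi>_lipschitz: "norm (\<Phi> n x \<omega> g - \<Phi> n x \<omega> g') \<le> lip_const * norm (g - g')"
proof -
  have "norm (D (g - g')) \<le> onorm D * norm (g - g')"
    by (rule onorm[OF linear_conv_bounded_linear[THEN iffD1, OF D(1)]])
  then show ?thesis
    using near[of n x \<omega> g g'] norm_triangle_ineq[of "\<Phi> n x \<omega> g - \<Phi> n x \<omega> g' - D (g - g')" "D (g - g')"]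
    by (simp add: lip_const_def distrib_right)
qed

lemma dens_pos: "0 < dens g"
  using dens_lower[of "norm g"] by (meson less_le_trans order_refl)

text \<open>Convergence for almost every \<open>g\<close> extends to all \<open>g\<close>, because the maps are equicontinuous
  and \<open>\<gamma>\<close> charges every ball.\<close>

lemma AE_convergent: "AE \<omega> in M'. \<forall>g. (\<lambda>n. \<Phi> n x \<omega> g) \<longlonglongrightarrow> F x \<omega> g"
proof -
  have meas: "{z \<in> space (N \<Otimes>\<^sub>M borel). Cauchy (\<lambda>n. \<Phi> n x (fst z) (snd z))} \<in> sets (N \<Otimes>\<^sub>M borel)"
    using \<Phi>_measurable by (intro sets_Collect_Cauchy) (simp add: case_prod_unfold)
  have "AE \<omega> in M. Cauchy (\<lambda>n. \<Phi> n x (fst (\<omega>, G \<omega>)) (snd (\<omega>, G \<omega>)))"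
    using conv[of x] by eventually_elim (auto intro: LIMSEQ_imp_Cauchy)
  then have "AE z in M' \<Otimes>\<^sub>M \<gamma>. Cauchy (\<lambda>n. \<Phi> n x (fst z) (snd z))"
    unfolding joint_law[symmetric] by (subst AE_distr_iff[OF pair_measurable meas])
  then have "AE \<omega> in M'. AE g in \<gamma>. Cauchy (\<lambda>n. \<Phi> n x \<omega> g)"
    by (auto dest!: AE_pair)
  then show ?thesis
  proof eventually_elim
    case (elim \<omega>)
    then have ae: "AE g in lborel. Cauchy (\<lambda>n. \<Phi> n x \<omega> g)"
      unfolding G_law using dens_measurable by (subst (asm) AE_density) (auto simp: dens_pos)
    have "Cauchy (\<lambda>n. \<Phi> n x \<omega> g)" for g
    proof (rule metric_CauchyI)
      fix e :: real assume e: "0 < e"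
      define r where "r = e / (3 * lip_const)"
      have r: "0 < r" using e lip_const_pos by (simp add: r_def)
      have "\<exists>g'\<in>ball g r. Cauchy (\<lambda>n. \<Phi> n x \<omega> g')"
      proof (rule ccontr)
        assume neg: "\<not> ?thesis"
        from ae have "AE g' in lborel. g' \<notin> ball g r"
          by (rule AE_mp) (use neg in auto)
        then have "ball g r \<in> null_sets lborel"
          by (subst AE_iff_null_sets) auto
        then show False using content_ball_pos[OF r, of g] by (simp add: null_sets_def measure_def)
      qed
      then obtain g' where g': "dist g g' < r" "Cauchy (\<lambda>n. \<Phi> n x \<omega> g')" by auto
      have close: "dist (\<Phi> n x \<omega> g) (\<Phi> n x \<omega> g') < e / 3" for n
      proof -
        have "dist (\<Phi> n x \<omega> g) (\<Phi> n x \<omega> g') \<le> lip_const * dist g g'"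
          using \<Phi>_lipschitz[of n x \<omega> g g'] by (simp add: dist_norm)
        also have "\<dots> < lip_const * r" using g'(1) lip_const_pos by simp
        also have "\<dots> = e / 3" using lip_const_pos by (simp add: r_def)
        finally show ?thesis .
      qed
      obtain K where K: "\<And>k n. k \<ge> K \<Longrightarrow> n \<ge> K \<Longrightarrow> dist (\<Phi> k x \<omega> g') (\<Phi> n x \<omega> g') < e / 3"
        using metric_CauchyD[OF g'(2), of "e / 3"] e by auto
      have "dist (\<Phi> k x \<omega> g) (\<Phi> n x \<omega> g) < e" if "k \<ge> K" "n \<ge> K" for k n
        using K[OF that] close[of k] close[of n]
          dist_triangle[of "\<Phi> k x \<omega> g" "\<Phi> n x \<omega> g" "\<Phi> k x \<omega> g'"]
          dist_triangle2[of "\<Phi> k x \<omega> g'" "\<Phi> n x \<omega> g" "\<Phi> n x \<omega> g'"] by linarith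
      then show "\<exists>K. \<forall>k\<ge>K. \<forall>n\<ge>K. dist (\<Phi> k x \<omega> g) (\<Phi> n x \<omega> g) < e" by blast
    qed
    then show ?case
      by (simp add: F_def Cauchy_convergent_iff convergent_LIMSEQ_iff)
  qed
qed

text \<open>Almost surely \<open>Y x\<close> is \<open>F x\<close> evaluated at \<open>G\<close>,
  and the product law permits Fubini with \<omega> as the outer variable.\<close>

lemma emeasure_law:
  assumes A: "A \<in> sets borel"
  shows "emeasure (distr M borel (Y x)) A = (\<integral>\<^sup>+\<omega>. emeasure \<gamma> (F x \<omega> -` A) \<partial>M')"
proof -
  have Fm: "(\<lambda>z. indicator A (F x (fst z) (snd z)) :: ennreal) \<in> borel_measurable (N \<Otimes>\<^sub>M borel)"
    by (rule measurable_compose[OF F_measurable borel_measurable_indicator[OF A]])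
  have "emeasure (distr M borel (Y x)) A = (\<integral>\<^sup>+y. indicator A y \<partial>distr M borel (Y x))"
    using A by simp
  also have "\<dots> = (\<integral>\<^sup>+\<omega>. indicator A (Y x \<omega>) \<partial>M)"
    by (rule nn_integral_distr) (use Y_measurable A in auto)
  also have "\<dots> = (\<integral>\<^sup>+\<omega>. indicator A (F x \<omega> (G \<omega>)) \<partial>M)"
    by (rule nn_integral_cong_AE) (use conv[of x] in eventually_elim, auto simp: F_def limI)
  also have "\<dots> = (\<integral>\<^sup>+z. indicator A (F x (fst z) (snd z)) \<partial>distr M (N \<Otimes>\<^sub>M borel) (\<lambda>\<omega>. (\<omega>, G \<omega>)))"
    by (subst nn_integral_distr[OF pair_measurable]) (use Fm in auto)
  also have "\<dots> = (\<integral>\<^sup>+\<omega>. \<integral>\<^sup>+g. indicator A (F x \<omega> g) \<partial>\<gamma> \<partial>M')"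
  proof -
    have "(\<lambda>z. indicator A (F x (fst z) (snd z)) :: ennreal) \<in> borel_measurable (M' \<Otimes>\<^sub>M \<gamma>)"
      using Fm measurable_cong_sets[OF sets_pair_measure_cong[of M' N \<gamma> borel] refl] by auto
    from \<gamma>.nn_integral_fst[OF this] show ?thesis unfolding joint_law by simp
  qed
  also have "\<dots> = (\<integral>\<^sup>+\<omega>. emeasure \<gamma> (F x \<omega> -` A) \<partial>M')"
  proof (rule nn_integral_cong)
    fix \<omega> assume "\<omega> \<in> space M'"
    then have "F x \<omega> \<in> borel_measurable borel"
      using measurable_compose[OF measurable_Pair1'[of \<omega> N borel] F_measurable[of x]] by simp
    then have "F x \<omega> -` A \<in> sets \<gamma>" using measurable_sets[of "F x \<omega>" borel borel A] A by simp
    moreover have "(\<lambda>g. indicator A (F x \<omega> g) :: ennreal) = indicator (F x \<omega> -` A)"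
      by (auto simp: indicator_def)
    ultimately show "(\<integral>\<^sup>+g. indicator A (F x \<omega> g) \<partial>\<gamma>) = emeasure \<gamma> (F x \<omega> -` A)"
      by simp
  qed
  finally show ?thesis .
qed

text \<open>For almost every \<omega> in a suitable event, \<open>F x \<omega>\<close> is onto,
  Lipschitz, and expands distances by at least \<open>m / 2\<close>. The preimage of the unit ball
  stays in a fixed ball where \<open>dens\<close> is bounded below, and preimages of sets have
  volume at least 1 / C times that of the set. Integrating over the event gives the factor
  p.\<close>

theorem minorization:
  "\<exists>k>0. \<forall>x. norm x \<le> R \<longrightarrow> (\<forall>A\<in>sets borel.
    ennreal k * emeasure lborel (A \<inter> cball 0 1) \<le> emeasure (distr M borel (Y x)) A)"
proof -
  have F0m: "(\<lambda>\<omega>. F 0 \<omega> 0) \<in> borel_measurable N"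
    using measurable_compose[OF measurable_Pair2'[of 0 borel N] F_measurable[of 0]] by simp
  \<comment> \<open>The event is defined at \<open>x = 0\<close> and hence serves all x; the
    Lipschitz dependence on x transfers the bound to the ball of radius \<open>R\<close>.\<close>
  define S where "S k = {\<omega> \<in> space N. norm (F 0 \<omega> 0) \<le> real k}" for k
  have Sm: "S k \<in> sets M'" for k unfolding S_def using F0m by simp
  have "\<exists>k. emeasure M' (S k) \<noteq> 0"
  proof (rule ccontr)
    assume "\<not> ?thesis"
    then have "emeasure M' (\<Union>k. S k) = 0"
      using Sm by (intro emeasure_UN_eq_0) auto
    moreover have "(\<Union>k. S k) = space M'"
      using real_arch_simple by (auto simp: S_def)
    ultimately show False using M'.emeasure_space_1 by simp
  qed
  then obtain k where k: "emeasure M' (S k) \<noteq> 0" by blast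
  define p where "p = measure M' (S k)"
  have p: "0 < p" "emeasure M' (S k) = ennreal p"
    using k by (auto simp: p_def M'.emeasure_eq_measure zero_less_measure_iff)
  \<comment> \<open>Solves \<open>m / 2 * r = 1 + real k + \<Lambda> * \<bar>R\<bar>\<close>, the
    bound on a preimage obtained from the expansion.\<close>
  define r where "r = 2 * (1 + real k + \<Lambda> * \<bar>R\<bar>) / m"
  obtain c where c: "0 < c" "\<And>g. norm g \<le> r \<Longrightarrow> c \<le> dens g" using dens_lower by blast
  define C where "C = (2 * lip_const * DIM('v)) ^ DIM('v)"
  have C: "0 < C" using lip_const_pos by (simp add: C_def)
  have "ennreal (p * (c / C)) * emeasure lborel (A \<inter> cball 0 1) \<le> emeasure (distr M borel (Y x)) A"
    if x: "norm x \<le> R" and A: "A \<in> sets borel" for x A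
  proof -
    let ?A = "A \<inter> cball 0 1"
    have A': "?A \<in> sets borel" using A by auto
    have "AE \<omega> in M'. ennreal (c / C) * emeasure lborel ?A * indicator (S k) \<omega> \<le> emeasure \<gamma> (F x \<omega> -` ?A)"
      using AE_convergent[of x] AE_convergent[of 0]
    proof eventually_elim
      case (elim \<omega>)
      note lx = elim(1)[rule_format] and l0 = elim(2)[rule_format]
      show ?case
      proof (cases "\<omega> \<in> S k")
        case False
        then show ?thesis by simp
      next
        case True
        let ?E = "F x \<omega> -` ?A"
        have Fnear: "norm (F x \<omega> g - F x \<omega> g' - D (g - g')) \<le> m / 2 * norm (g - g')" for g g'
          by (rule LIMSEQ_le_const2[OF tendsto_norm[OF tendsto_diff[OF tendsto_diff[OF lx lx] tendsto_const]]])
             (use near in auto)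
        have Flip: "norm (F x \<omega> g - F x \<omega> g') \<le> lip_const * norm (g - g')" for g g'
          by (rule LIMSEQ_le_const2[OF tendsto_norm[OF tendsto_diff[OF lx lx]]]) (use \<Phi>_lipschitz in auto)
        have Fstart: "norm (F x \<omega> 0 - F 0 \<omega> 0) \<le> \<Lambda> * norm (x - 0)"
          by (rule LIMSEQ_le_const2[OF tendsto_norm[OF tendsto_diff[OF lx l0]]]) (use \<Lambda>(2)[of _ x \<omega> 0 0] in auto)
        have surj: "surj (F x \<omega>)"
          by (rule near_linear_surj[OF D(1,2,3) _ _ Fnear]) (use D(2) in auto)
        have Er: "norm g \<le> r" if "g \<in> ?E" for g
        proof -
          have "(m - m / 2) * norm (g - 0) \<le> norm (F x \<omega> g - F x \<omega> 0)"
            by (rule near_linear_expanding[of m D "F x \<omega>" g 0 "m / 2", OF D(3) Fnear])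
          also have "\<dots> \<le> norm (F x \<omega> g) + (norm (F x \<omega> 0 - F 0 \<omega> 0) + norm (F 0 \<omega> 0))"
            using norm_triangle_ineq4[of "F x \<omega> g" "F x \<omega> 0"]
              norm_triangle_ineq[of "F x \<omega> 0 - F 0 \<omega> 0" "F 0 \<omega> 0"] by simp
          also have "\<dots> \<le> 1 + (\<Lambda> * \<bar>R\<bar> + real k)"
          proof (intro add_mono)
            show "norm (F x \<omega> g) \<le> 1" using that by simp
            have "\<Lambda> * norm (x - 0) \<le> \<Lambda> * \<bar>R\<bar>" using \<Lambda>(1) x by (intro mult_left_mono) auto
            then show "norm (F x \<omega> 0 - F 0 \<omega> 0) \<le> \<Lambda> * \<bar>R\<bar>" using Fstart by linarith
            show "norm (F 0 \<omega> 0) \<le> real k" using True by (simp add: S_def)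
          qed
          finally show ?thesis using D(2) by (simp add: r_def field_simps)
        qed
        have "continuous_on UNIV (F x \<omega>)"
          by (rule lipschitz_on_continuous_on[of lip_const])
             (use Flip lip_const_pos in \<open>auto simp: lipschitz_on_def dist_norm\<close>)
        then have Em: "?E \<in> sets borel"
          using measurable_sets[OF borel_measurable_continuous_onI A'] by auto
        have "emeasure lborel ?A \<le> ennreal C * emeasure lborel ?E"
          unfolding C_def
        proof (rule lipschitz_image_emeasure_le[OF _ Flip Em _ A'])
          show "bounded ?E" by (rule boundedI[OF Er])
          show "?A \<subseteq> F x \<omega> ` ?E" by (simp only: surj_image_vimage_eq[OF surj] order_refl)
        qed (use lip_const_pos in auto)
        then have "ennreal (c / C) * emeasure lborel ?A \<le> ennreal (c / C) * (ennreal C * emeasure lborel ?E)"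
          by (rule mult_left_mono) simp
        also have "\<dots> = ennreal c * emeasure lborel ?E"
          using c C by (simp add: mult.assoc[symmetric] ennreal_mult[symmetric])
        also have "\<dots> = (\<integral>\<^sup>+g. ennreal c * indicator ?E g \<partial>lborel)"
          using Em by (simp add: nn_integral_cmult_indicator)
        also have "\<dots> \<le> (\<integral>\<^sup>+g. ennreal (dens g) * indicator ?E g \<partial>lborel)"
          by (rule nn_integral_mono) (use Er c(2) in \<open>auto simp: indicator_def intro!: ennreal_leI\<close>)
        also have "\<dots> = emeasure \<gamma> ?E"
          unfolding G_law using Em dens_measurable by (simp add: emeasure_density)
        finally show ?thesis using True by simp
      qed
    qed
    then have "(\<integral>\<^sup>+\<omega>. ennreal (c / C) * emeasure lborel ?A * indicator (S k) \<omega> \<partial>M')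
        \<le> (\<integral>\<^sup>+\<omega>. emeasure \<gamma> (F x \<omega> -` ?A) \<partial>M')"
      by (rule nn_integral_mono_AE)
    also have "\<dots> = emeasure (distr M borel (Y x)) ?A" by (rule emeasure_law[OF A', symmetric])
    also have "\<dots> \<le> emeasure (distr M borel (Y x)) A" using A by (intro emeasure_mono) auto
    also have "(\<integral>\<^sup>+\<omega>. ennreal (c / C) * emeasure lborel ?A * indicator (S k) \<omega> \<partial>M')
        = ennreal (c / C) * emeasure lborel ?A * ennreal p"
      using Sm p by (simp add: nn_integral_cmult_indicator)
    also have "ennreal (c / C) * emeasure lborel ?A * ennreal p = ennreal (p * (c / C)) * emeasure lborel ?A"
      using p c C by (subst ennreal_mult) (auto simp: mult_ac)
    finally show ?thesis .
  qed
  moreover have "0 < p * (c / C)" using p c C by simp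
  ultimately show ?thesis by blast
qed

end

section \<open>The equation driven by fractional Brownian motion\<close>

locale fbm_sde = lipschitz_drift T K b + fbm_process M H B + hurst H
  for T K :: real and b :: "real \<Rightarrow> real^'d \<Rightarrow> real^'d" and M :: "'a measure" and H :: real
    and B :: "real \<Rightarrow> 'a \<Rightarrow> real^'d" +
  fixes \<sigma> :: "real \<Rightarrow> real^'d^'d" and X :: "real^'d \<Rightarrow> real \<Rightarrow> 'a \<Rightarrow> real^'d" and Kbar \<alpha> C\<sigma> :: real
  assumes drift_time: "\<And>x. continuous_on {0..T} (\<lambda>t. b t x)"
    and sigma_invertible: "\<And>t. t \<in> {0..T} \<Longrightarrow> invertible (\<sigma> t)"
    and sigma_bound: "\<And>t. t \<in> {0..T} \<Longrightarrow> norm (\<sigma> t) \<le> C\<sigma>"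
    and sigma_hoelder: "0 \<le> Kbar" "0 < \<alpha>"
      "\<And>s t. s \<in> {0..T} \<Longrightarrow> t \<in> {0..T} \<Longrightarrow>
        norm (matrix_inv (\<sigma> t) - matrix_inv (\<sigma> s)) \<le> Kbar * \<bar>t - s\<bar> powr \<alpha>"
    and solution: "\<And>x. is_solution M T b \<sigma> B x (X x)"
begin

text \<open>A functional of the path through its grid values, hence defined for every path. The
  index \<open>Suc n\<close> avoids the grid with no cells.\<close>

definition flow_approx :: "nat \<Rightarrow> real^'d \<Rightarrow> (real \<Rightarrow> real^'d) \<Rightarrow> real^'d" where
  "flow_approx n x \<beta> = euler b (T / real (Suc n)) (\<lambda>k. x + rs_sum \<sigma> T (Suc n) \<beta> k) (Suc n)"

lemma flow_approx_measurable:
  assumes f: "f \<in> borel_measurable L" and \<beta>: "\<And>t. t \<in> {0..T} \<Longrightarrow> (\<lambda>z. \<beta> z t) \<in> borel_measurable L"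
  shows "(\<lambda>z. flow_approx n (f z) (\<beta> z)) \<in> borel_measurable L"
  unfolding flow_approx_def
proof (rule euler_measurable)
  fix k assume k: "k \<le> Suc n"
  have mv: "(\<lambda>v. A *v v) \<in> borel_measurable borel" for A :: "real^'d^'d"
    by (intro borel_measurable_continuous_onI continuous_on_compose2[OF linear_continuous_on[OF matrix_vector_mul_bounded_linear]]) auto
  have grid: "real j * T / real (Suc n) \<in> {0..T}" if "j \<le> Suc n" for j
    using grid_mem[of "Suc n" j] that by simp
  have "(\<lambda>z. \<sigma> (real (Suc j) * T / real (Suc n)) *v (\<beta> z (real (Suc j) * T / real (Suc n)) - \<beta> z (real j * T / real (Suc n)))) \<in> borel_measurable L"
    if "j < k" for j
    using that k by (intro measurable_compose[OF _ mv] borel_measurable_diff \<beta> grid) auto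
  then show "(\<lambda>z. f z + rs_sum \<sigma> T (Suc n) (\<beta> z) k) \<in> borel_measurable L"
    unfolding rs_sum_def by (intro borel_measurable_add f borel_measurable_sum) auto
qed simp

lemma flow_approx_tendsto: "AE \<omega> in M. (\<lambda>n. flow_approx n x (\<lambda>t. B t \<omega>)) \<longlonglongrightarrow> X x T \<omega>"
proof -
  have "AE \<omega> in M. continuous_on {0..T} (\<lambda>t. X x t \<omega>) \<and> (\<forall>t\<in>{0..T}. has_RS_integral \<sigma> (\<lambda>s. B s \<omega>) 0 t
      (X x t \<omega> - x - integral {0..t} (\<lambda>s. b s (X x s \<omega>))))"
    using solution[of x] by (simp add: is_solution_def)
  then show ?thesis
  proof eventually_elim
    case (elim \<omega>)
    then show ?case unfolding flow_approx_def by (intro euler_converges drift_time) auto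
  qed
qed

lemma X_measurable: "X x T \<in> borel_measurable M"
  using solution[of x] T by (simp add: is_solution_def)

text \<open>\<open>X\<close> is given separately for each x, without joint measurability. The limit
  of the Euler schemes is jointly measurable in x and \<omega> and almost surely equal to
  \<open>X x T\<close>, so it has the same law.\<close>

lemma kernel_measurable: "PT_kernel M X T \<in> borel \<rightarrow>\<^sub>M prob_algebra borel"
proof -
  have Bm: "(\<lambda>z. B t (snd z)) \<in> borel_measurable (borel \<Otimes>\<^sub>M M)" if "t \<in> {0..T}" for t
    using measurable_compose[OF measurable_snd fbm_measurable] that by auto
  have m: "(\<lambda>z. lim (\<lambda>n. flow_approx n (fst z) (\<lambda>t. B t (snd z)))) \<in> borel_measurable (borel \<Otimes>\<^sub>M M)"
    using Bm by (intro borel_measurable_lim_metric flow_approx_measurable) auto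
  have "PT_kernel M X T x = distr M borel (\<lambda>\<omega>. lim (\<lambda>n. flow_approx n x (\<lambda>t. B t \<omega>)))" for x
    unfolding PT_kernel_def
  proof (rule distr_cong_AE)
    show "AE \<omega> in M. X x T \<omega> = lim (\<lambda>n. flow_approx n x (\<lambda>t. B t \<omega>))"
      using flow_approx_tendsto[of x] by eventually_elim (simp add: limI)
    show "(\<lambda>\<omega>. lim (\<lambda>n. flow_approx n x (\<lambda>t. B t \<omega>))) \<in> borel_measurable M"
      using measurable_compose[OF measurable_Pair1'[of x borel M] m] by simp
  qed (use X_measurable in auto)
  moreover have "(\<lambda>x. distr M borel (\<lambda>\<omega>. lim (\<lambda>n. flow_approx n x (\<lambda>t. B t \<omega>)))) \<in> borel \<rightarrow>\<^sub>M prob_algebra borel"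
  proof (rule measurable_distr_prob_space2)
    show "(\<lambda>x. M) \<in> borel \<rightarrow>\<^sub>M prob_algebra M"
      by (intro measurable_const) (simp add: space_prob_algebra prob_space_axioms)
  qed (use m in \<open>simp add: case_prod_unfold\<close>)
  ultimately show ?thesis by (simp cong: measurable_cong)
qed

lemma sigma_bound_nonneg: "0 \<le> C\<sigma>"
  using order_trans[OF norm_ge_zero sigma_bound[of T]] T by simp

lemma sigma_inverse:
  assumes "t \<in> {0..T}"
  shows "\<sigma> t *v (matrix_inv (\<sigma> t) *v v) = v" "matrix_inv (\<sigma> t) *v (\<sigma> t *v v) = v"
proof -
  have "\<sigma> t ** matrix_inv (\<sigma> t) = mat 1 \<and> matrix_inv (\<sigma> t) ** \<sigma> t = mat 1"
    using sigma_invertible[OF assms] unfolding matrix_inv_def invertible_def by (rule someI_ex)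
  then show "\<sigma> t *v (matrix_inv (\<sigma> t) *v v) = v" "matrix_inv (\<sigma> t) *v (\<sigma> t *v v) = v"
    by (simp_all add: matrix_vector_mul_assoc)
qed

text \<open>Only the inverse is assumed continuous; the identity
  \<open>\<sigma> t - \<sigma> T = \<sigma> t (\<sigma>\<inverse> T - \<sigma>\<inverse> t) \<sigma> T\<close> transfers this to \<open>\<sigma>\<close>.\<close>

lemma sigma_diff_le:
  assumes t: "t \<in> {0..T}"
  shows "norm (\<sigma> t *v v - \<sigma> T *v v) \<le> (C\<sigma> * C\<sigma> * Kbar * \<bar>T - t\<bar> powr \<alpha>) * norm v"
proof -
  have TT: "T \<in> {0..T}" using T by simp
  let ?w = "\<sigma> T *v v"
  have "\<sigma> t *v ((matrix_inv (\<sigma> T) - matrix_inv (\<sigma> t)) *v ?w) = \<sigma> t *v v - ?w"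
    using sigma_inverse[OF t] sigma_inverse[OF TT]
    by (simp add: matrix_vector_mult_diff_rdistrib matrix_vector_mult_diff_distrib)
  then have "norm (\<sigma> t *v v - ?w) \<le> norm (\<sigma> t) * norm ((matrix_inv (\<sigma> T) - matrix_inv (\<sigma> t)) *v ?w)"
    using norm_matrix_vector_mult_le[of "\<sigma> t"] by metis
  also have "\<dots> \<le> norm (\<sigma> t) * (norm (matrix_inv (\<sigma> T) - matrix_inv (\<sigma> t)) * (norm (\<sigma> T) * norm v))"
    by (intro mult_left_mono order_trans[OF norm_matrix_vector_mult_le] norm_matrix_vector_mult_le) auto
  also have "\<dots> \<le> C\<sigma> * ((Kbar * \<bar>T - t\<bar> powr \<alpha>) * (C\<sigma> * norm v))"
    using sigma_bound[OF t] sigma_bound[OF TT] sigma_hoelder(3)[OF t TT] sigma_bound_nonneg sigma_hoelder(1)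
    by (intro mult_mono mult_nonneg_nonneg) auto
  finally show ?thesis by (simp add: mult_ac)
qed

abbreviation split_flow :: "real \<Rightarrow> nat \<Rightarrow> real^'d \<Rightarrow> (real \<Rightarrow> real^'d) \<Rightarrow> real^'d \<Rightarrow> real^'d" where
  "split_flow e n x r g \<equiv> flow_approx n x (\<lambda>t. r t + bump T e t *\<^sub>R g)"

text \<open>The constant \<open>m\<close> is fixed before e, since the lower bound on the absolute
  value of \<open>bump T e T\<close> holds for all small e. Then e is taken so small that drift and
  variation of \<sigma> contribute at most \<open>m / 2\<close>.\<close>

lemma bump_parameters:
  obtains e m where "0 < e" "2 * e \<le> T" "0 < m"
    "\<forall>v. m * norm v \<le> norm (bump T e T *\<^sub>R (\<sigma> T *v v))"
    "\<forall>n x r g g'. norm (split_flow e n x r g - split_flow e n x r g'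
        - bump T e T *\<^sub>R (\<sigma> T *v (g - g'))) \<le> m / 2 * norm (g - g')"
proof -
  have TT: "T \<in> {0..T}" using T by simp
  define w where "w = (2 powr (2 * H) - 2) / 4 / (4 - 2 powr (2 * H))"
  have w: "0 < w" using two_powr_bounds by (simp add: w_def)
  define q where "q = norm (matrix_inv (\<sigma> T)) + 1"
  have q: "0 < q" by (simp add: q_def add_nonneg_pos)
  define m where "m = w / q"
  have m: "0 < m" using w q by (simp add: m_def)
  have low: "norm v / q \<le> norm (\<sigma> T *v v)" for v
  proof -
    have "norm v \<le> norm (matrix_inv (\<sigma> T)) * norm (\<sigma> T *v v)"
      using norm_matrix_vector_mult_le[of "matrix_inv (\<sigma> T)" "\<sigma> T *v v"] sigma_inverse[OF TT] by simp
    also have "\<dots> \<le> q * norm (\<sigma> T *v v)" by (intro mult_right_mono) (auto simp: q_def)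
    finally show ?thesis using q by (simp add: field_simps)
  qed
  define Q where "Q = K * exp (K * T) * C\<sigma> + 1"
  have Q: "0 < Q" using K sigma_bound_nonneg by (simp add: Q_def add_nonneg_pos)
  \<comment> \<open>Both weighted variations will be at most \<eta>, and their joint effect is
    \<open>Q * \<eta> = m / 2\<close>.\<close>
  define \<eta> where "\<eta> = m / (2 * Q)"
  have \<eta>: "0 < \<eta>" using m Q by (simp add: \<eta>_def)
  define \<rho> where "\<rho> t = C\<sigma> * C\<sigma> * Kbar * \<bar>T - t\<bar> powr \<alpha>" for t
  have ev1: "\<forall>\<^sub>F e in at_right 0. \<forall>n. weighted_variation (\<lambda>t. T - t) (bump T e) T n \<le> \<eta>"
  proof (rule bump_concentrates[OF T _ _ \<eta>, where \<rho>max=T])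
    fix h :: real assume "0 < h"
    then show "\<exists>\<delta>>0. \<forall>t. 0 \<le> t \<and> t \<le> T \<and> T - \<delta> < t \<longrightarrow> T - t \<le> h" by (intro exI[of _ h]) auto
  qed auto
  have ev2: "\<forall>\<^sub>F e in at_right 0. \<forall>n. weighted_variation \<rho> (bump T e) T n \<le> \<eta>"
  proof (rule bump_concentrates[OF T _ _ \<eta>, where \<rho>max="C\<sigma> * C\<sigma> * Kbar * T powr \<alpha>"])
    fix t assume t: "0 \<le> t" "t \<le> T"
    then have "\<bar>T - t\<bar> powr \<alpha> \<le> T powr \<alpha>" using sigma_hoelder(2) by (intro powr_mono2) auto
    then show "0 \<le> \<rho> t \<and> \<rho> t \<le> C\<sigma> * C\<sigma> * Kbar * T powr \<alpha>"
      unfolding \<rho>_def using sigma_bound_nonneg sigma_hoelder(1) by (auto intro!: mult_left_mono mult_nonneg_nonneg)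
  next
    fix h :: real assume h: "0 < h"
    define c where "c = C\<sigma> * C\<sigma> * Kbar + 1"
    have c: "0 < c" "C\<sigma> * C\<sigma> * Kbar \<le> c" using sigma_bound_nonneg sigma_hoelder(1) by (auto simp: c_def add_nonneg_pos)
    \<comment> \<open>Solves \<open>c * \<delta> powr \<alpha> = h\<close>.\<close>
    define \<delta> where "\<delta> = (h / c) powr (1 / \<alpha>)"
    have d: "0 < \<delta>" using h c by (simp add: \<delta>_def)
    have "\<rho> t \<le> h" if t: "t \<le> T" "T - \<delta> < t" for t
    proof -
      have "\<bar>T - t\<bar> powr \<alpha> \<le> \<delta> powr \<alpha>" using t sigma_hoelder(2) by (intro powr_mono2) auto
      also have "\<dots> = h / c" using h c sigma_hoelder(2) by (simp add: \<delta>_def powr_powr)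
      finally have "\<rho> t \<le> c * (h / c)"
        unfolding \<rho>_def using c by (intro mult_mono) auto
      then show ?thesis using c by simp
    qed
    then show "\<exists>\<delta>>0. \<forall>t. 0 \<le> t \<and> t \<le> T \<and> T - \<delta> < t \<longrightarrow> \<rho> t \<le> h" using d by blast
  qed
  have ev3: "\<forall>\<^sub>F e in at_right 0. w \<le> \<bar>bump T e T\<bar>"
    using bump_end[OF T] by (simp add: w_def)
  have ev4: "\<forall>\<^sub>F e in at_right 0. 0 < e \<and> e < T / 2"
    using T by (intro eventually_conj eventually_at_right_less eventually_at_rightI[of 0 "T / 2"]) auto
  have "\<forall>\<^sub>F e in at_right 0. (0 < e \<and> e < T / 2) \<and> w \<le> \<bar>bump T e T\<bar> \<and>
     (\<forall>n. weighted_variation (\<lambda>t. T - t) (bump T e) T n \<le> \<eta>) \<and>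
     (\<forall>n. weighted_variation \<rho> (bump T e) T n \<le> \<eta>)"
    by (intro eventually_conj ev1 ev2 ev3 ev4)
  from eventually_happens[OF this] obtain e where e: "0 < e" "e < T / 2" "w \<le> \<bar>bump T e T\<bar>"
    "\<And>n. weighted_variation (\<lambda>t. T - t) (bump T e) T n \<le> \<eta>"
    "\<And>n. weighted_variation \<rho> (bump T e) T n \<le> \<eta>"
    by auto
  show ?thesis
  proof (rule that[OF e(1) _ m], goal_cases)
    case 1
    show ?case using e(2) by simp
  next
    case 2
    show ?case
    proof
      fix v
      have "w * (norm v / q) \<le> \<bar>bump T e T\<bar> * norm (\<sigma> T *v v)"
        using low[of v] e(3) w q by (intro mult_mono) auto
      then show "m * norm v \<le> norm (bump T e T *\<^sub>R (\<sigma> T *v v))" by (simp add: m_def)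
    qed
  next
    case 3
    show ?case
    proof (intro allI)
      fix n x r g g'
      have "norm (split_flow e n x r g - split_flow e n x r g'
          - bump T e T *\<^sub>R (\<sigma> T *v (g - g'))) \<le> (K * exp (K * T) * C\<sigma> * \<eta> + \<eta>) * norm (g - g')"
        unfolding flow_approx_def
        by (rule euler_near_linear[where \<rho>=\<rho>])
           (use sigma_bound sigma_diff_le e(4,5)[of "Suc n"] bump_0 in \<open>auto simp: \<rho>_def simp del: of_nat_Suc\<close>)
      also have "K * exp (K * T) * C\<sigma> * \<eta> + \<eta> = Q * \<eta>" by (simp add: Q_def distrib_right)
      also have "Q * \<eta> = m / 2" using Q by (simp add: \<eta>_def)
      finally show "norm (split_flow e n x r g - split_flow e n x r g'
          - bump T e T *\<^sub>R (\<sigma> T *v (g - g'))) \<le> m / 2 * norm (g - g')" .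
    qed
  qed
qed

lemma kernel_minorization:
  "\<exists>k>0. \<forall>x. norm x \<le> R \<longrightarrow> (\<forall>A\<in>sets borel.
    ennreal k * emeasure lborel (A \<inter> cball 0 1) \<le> emeasure (PT_kernel M X T x) A)"
proof -
  obtain e m where e: "0 < e" "2 * e \<le> T" and m: "0 < m"
    and expand: "\<forall>v. m * norm v \<le> norm (bump T e T *\<^sub>R (\<sigma> T *v v))"
    and near: "\<forall>n x r g g'. norm (split_flow e n x r g - split_flow e n x r g'
        - bump T e T *\<^sub>R (\<sigma> T *v (g - g'))) \<le> m / 2 * norm (g - g')"
    by (rule bump_parameters)
  define c where "c = e powr (2 * H) * (4 - 2 powr (2 * H))"
  have c: "0 < c" using e two_powr_bounds by (simp add: c_def)
  \<comment> \<open>The weights of the second difference, for which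
    \<open>pivot_cov t / pivot_var\<close> is \<open>bump T e t\<close>.\<close>
  interpret P: fbm_conditioning M H B "[(T, 1), (T - e, - 2), (T - 2 * e, 1)]"
    by unfold_locales (use e in auto)
  have cov: "P.pivot_cov t = c * bump T e t" if "0 \<le> t" for t
    using second_diff_cov[OF e that] by (simp add: P.pivot_cov_def c_def)
  have var: "P.pivot_var = c"
  proof -
    have "P.pivot_var = c * (bump T e T - 2 * bump T e (T - e) + bump T e (T - 2 * e))"
      unfolding P.pivot_var_def using e by (simp add: cov distrib_left right_diff_distrib)
    then show ?thesis using second_diff_var[OF e] by simp
  qed
  have v: "0 < P.pivot_var" using var c by simp
  have split: "B t \<omega> = P.residual t \<omega> + bump T e t *\<^sub>R P.pivot \<omega>" if "0 \<le> t" for t \<omega>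
    using c by (simp add: P.residual_def cov[OF that] var)
  interpret R: random_near_linear M P.residual_algebra P.pivot P.pivot_density
    "\<lambda>n x \<omega> g. split_flow e n x (\<lambda>t. P.residual t \<omega>) g" "\<lambda>x. X x T"
    "\<lambda>v. bump T e T *\<^sub>R (\<sigma> T *v v)" m "1 + K * exp (K * T) * T"
  proof
    show "id \<in> measurable M P.residual_algebra"
      "distr M (P.residual_algebra \<Otimes>\<^sub>M borel) (\<lambda>\<omega>. (\<omega>, P.pivot \<omega>)) = distr M P.residual_algebra id \<Otimes>\<^sub>M distr M borel P.pivot"
      using P.joint_law_residual_pivot[OF v] by auto
    show "P.pivot \<in> borel_measurable M" "P.pivot_density \<in> borel_measurable borel" by measurable
    show "distr M borel P.pivot = density lborel (\<lambda>g. ennreal (P.pivot_density g))" by (rule P.pivot_law[OF v])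
    show "\<exists>c>0. \<forall>g. norm g \<le> r \<longrightarrow> c \<le> P.pivot_density g" for r
    proof (intro exI conjI allI impI)
      \<comment> \<open>If \<open>norm g\<close> is at most r, each coordinate lies in [-r, r],
        where the centred normal density is smallest at the end points.\<close>
      let ?d = "normal_density 0 (sqrt P.pivot_var) r"
      have d0: "0 < ?d" using v by (intro normal_density_pos) simp
      show "0 < ?d ^ DIM(real^'d)" using d0 by simp
      fix g :: "real^'d" assume g: "norm g \<le> r"
      have "(\<Prod>i\<in>(Basis :: (real^'d) set). ?d) \<le> P.pivot_density g"
        unfolding P.pivot_density_def
      proof (rule prod_mono, intro conjI)
        fix i :: "real^'d" assume i: "i \<in> Basis"
        have "\<bar>g \<bullet> i\<bar> \<le> \<bar>r\<bar>" using Basis_le_norm[OF i, of g] g by linarith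
        then have "(g \<bullet> i)\<^sup>2 \<le> r\<^sup>2" by (simp add: abs_le_square_iff)
        then show "?d \<le> normal_density 0 (sqrt P.pivot_var) (g \<bullet> i)"
          using v unfolding normal_density_def by (intro mult_left_mono) (auto simp: divide_right_mono)
      qed (use d0 in simp)
      then show "?d ^ DIM(real^'d) \<le> P.pivot_density g" by simp
    qed
    show "(\<lambda>(\<omega>, g). split_flow e n x (\<lambda>t. P.residual t \<omega>) g) \<in> borel_measurable (P.residual_algebra \<Otimes>\<^sub>M borel)" for n x
      unfolding case_prod_unfold
    proof (rule flow_approx_measurable)
      fix t assume "t \<in> {0..T}"
      then have [measurable]: "P.residual t \<in> borel_measurable P.residual_algebra"
        by (intro P.residual_measurable_algebra) auto
      show "(\<lambda>z. P.residual t (fst z) + bump T e t *\<^sub>R snd z) \<in> borel_measurable (P.residual_algebra \<Otimes>\<^sub>M borel)"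
        by measurable
    qed simp
    show "0 \<le> 1 + K * exp (K * T) * T" using K T by simp
    show "norm (split_flow e n x (\<lambda>t. P.residual t \<omega>) g - split_flow e n x' (\<lambda>t. P.residual t \<omega>) g)
        \<le> (1 + K * exp (K * T) * T) * norm (x - x')" for n x x' \<omega> g
      unfolding flow_approx_def by (rule euler_lipschitz_start) simp
    show "AE \<omega> in M. (\<lambda>n. split_flow e n x (\<lambda>t. P.residual t \<omega>) (P.pivot \<omega>)) \<longlonglongrightarrow> X x T \<omega>" for x
      using flow_approx_tendsto[of x]
    proof eventually_elim
      case (elim \<omega>)
      have "split_flow e n x (\<lambda>t. P.residual t \<omega>) (P.pivot \<omega>) = flow_approx n x (\<lambda>t. B t \<omega>)" for n
      proof -
        \<comment> \<open>Grid times are nonnegative, where the decomposition of B holds; putting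
          the pivot in for g therefore gives back the scheme along B.\<close>
        have "rs_sum \<sigma> T (Suc n) (\<lambda>t. P.residual t \<omega> + bump T e t *\<^sub>R P.pivot \<omega>) k = rs_sum \<sigma> T (Suc n) (\<lambda>t. B t \<omega>) k" for k
          unfolding rs_sum_def using T by (intro sum.cong) (auto simp: split)
        then show ?thesis by (simp add: flow_approx_def)
      qed
      then show ?case using elim by simp
    qed
  qed (use m expand near X_measurable in
      \<open>auto simp: matrix_vector_right_distrib scaleR_add_right matrix_vector_mult_scaleR\<close>)
  show ?thesis using R.minorization[of R] unfolding PT_kernel_def .
qed

theorem ex1_invariant_measure:
  assumes a: "0 < a" "a < 1"
    and moment: "\<And>x. (\<integral>\<^sup>+\<omega>. ennreal ((norm (X x T \<omega>))\<^sup>2) \<partial>M) \<le> ennreal (a * (1 + (norm x)\<^sup>2))"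
  shows "\<exists>!\<mu>. prob_space \<mu> \<and> sets \<mu> = sets borel \<and>
    (\<forall>f\<in>borel_measurable borel. bounded (range f) \<longrightarrow> (\<integral>x. PT_op M X T f x \<partial>\<mu>) = (\<integral>x. f x \<partial>\<mu>))"
proof -
  interpret Ker: markov_kernel borel "PT_kernel M X T"
    by unfold_locales (simp_all add: kernel_measurable)
  obtain k where k: "0 < k" "\<And>x A. norm x \<le> sqrt (4 * a / (1 - a)) \<Longrightarrow> A \<in> sets borel \<Longrightarrow>
    ennreal k * emeasure lborel (A \<inter> cball 0 1) \<le> emeasure (PT_kernel M X T x) A"
    using kernel_minorization[of "sqrt (4 * a / (1 - a))"] by blast
  \<comment> \<open>The minorizing measure: k times Lebesgue measure on the unit ball, with k chosen
    for the sublevel set of the squared norm that Harris' theorem requires.\<close>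
  define \<nu> :: "(real^'d) measure" where "\<nu> = density lborel (\<lambda>y. ennreal k * indicator (cball 0 1) y)"
  have nu: "emeasure \<nu> A = ennreal k * emeasure lborel (A \<inter> cball 0 1)" if "A \<in> sets borel" for A
  proof -
    have "emeasure \<nu> A = (\<integral>\<^sup>+y. ennreal k * indicator (A \<inter> cball 0 1) y \<partial>lborel)"
      unfolding \<nu>_def using that
      by (subst emeasure_density) (auto intro!: nn_integral_cong simp: indicator_def)
    then show ?thesis using that by (simp add: nn_integral_cmult_indicator)
  qed
  have op: "PT_op M X T = markov_op (PT_kernel M X T)"
    by (auto simp: PT_op_def markov_op_def fun_eq_iff)
  show ?thesis
    unfolding op
  proof (rule Ker.ex1_invariant_if_drift_minorization[where V="\<lambda>x. (norm x)\<^sup>2" and a=a and \<nu>=\<nu>])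
    show "(\<integral>\<^sup>+y. ennreal ((norm y)\<^sup>2) \<partial>PT_kernel M X T x) \<le> ennreal (a * (1 + (norm x)\<^sup>2))" for x
      unfolding PT_kernel_def using moment[of x] by (subst nn_integral_distr[OF X_measurable]) auto
    show "sets \<nu> = sets borel" by (simp add: \<nu>_def)
    have cb: "emeasure lborel (cball 0 1 :: (real^'d) set) = ennreal (measure lborel (cball 0 1 :: (real^'d) set))"
      using emeasure_lborel_cball_finite[of "0 :: real^'d" 1] by (intro emeasure_eq_ennreal_measure) auto
    show "finite_measure \<nu>"
      by (rule finite_measureI) (use nu[of UNIV] cb in \<open>simp add: \<nu>_def ennreal_mult_eq_top_iff\<close>)
    show "emeasure \<nu> UNIV \<noteq> 0"
      using nu[of UNIV] cb k(1) by (simp add: ennreal_eq_0_iff not_le)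
    fix x :: "real^'d" and A :: "(real^'d) set" assume x: "(norm x)\<^sup>2 \<le> 4 * a / (1 - a)" and A: "A \<in> sets borel"
    have "norm x \<le> sqrt (4 * a / (1 - a))" using x by (rule real_le_rsqrt)
    then show "emeasure \<nu> A \<le> emeasure (PT_kernel M X T x) A" using k(2) A nu[OF A] by simp
  qed (use a in auto)
qed

end

theorem theorem3p2:
  fixes M :: "'a measure"
    and H T K Kbar \<alpha>0 L Mc :: real
    and B :: "real \<Rightarrow> 'a \<Rightarrow> real^'d"
    and b :: "real \<Rightarrow> real^'d \<Rightarrow> real^'d"
    and \<sigma> :: "real \<Rightarrow> real^'d^'d"
    and X :: "real^'d \<Rightarrow> real \<Rightarrow> 'a \<Rightarrow> real^'d"
  assumes T: "0 < T"
    and H: "1/2 < H" "H < 1"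
    and fbm: "fBm M H B"
    and H1_b_lip: "0 < K" "\<forall>t\<in>{0..T}. \<forall>x y. norm (b t x - b t y) \<le> K * norm (x - y)"
    and H1_b_time: "\<forall>x. \<exists>C. \<forall>s\<in>{0..T}. \<forall>t\<in>{0..T}. norm (b t x - b s x) \<le> C * \<bar>t - s\<bar>"
    and H1_sigma_inv: "\<forall>t\<in>{0..T}. invertible (\<sigma> t)"
    and H1_sigma_bdd: "\<exists>C. \<forall>t\<in>{0..T}. norm (\<sigma> t) \<le> C"
    and H1_sigma_hoelder: "0 \<le> Kbar" "H - 1/2 < \<alpha>0" "\<alpha>0 \<le> 1"
      "\<forall>s\<in>{0..T}. \<forall>t\<in>{0..T}.
         norm (matrix_inv (\<sigma> t) - matrix_inv (\<sigma> s)) \<le> Kbar * \<bar>t - s\<bar> powr \<alpha>0"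
    and H2: "\<forall>t\<in>{0..T}. \<forall>x. x \<bullet> b t x \<le> L * (norm x)\<^sup>2"
    and sol: "\<forall>x. is_solution M T b \<sigma> B x (X x)"
    and Mc: "0 < Mc"
      "\<forall>x. (\<integral>\<^sup>+\<omega>. ennreal ((norm (X x T \<omega>))\<^sup>2) \<partial>M)
              \<le> ennreal (Mc * exp (2 * L * T) * (1 + (norm x)\<^sup>2))"
      "Mc * exp (2 * L * T) < 1"
  shows "\<exists>!\<mu> :: (real^'d) measure. prob_space \<mu> \<and> sets \<mu> = sets borel \<and>
           (\<forall>f \<in> borel_measurable borel. bounded (range f) \<longrightarrow>
              (\<integral>x. PT_op M X T f x \<partial>\<mu>) = (\<integral>x. f x \<partial>\<mu>))"
proof -
  obtain C where C: "\<And>t. t \<in> {0..T} \<Longrightarrow> norm (\<sigma> t) \<le> C"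
    using H1_sigma_bdd by blast
  have time: "continuous_on {0..T} (\<lambda>t. b t x)" for x
  proof -
    obtain D where D: "\<And>s t. s \<in> {0..T} \<Longrightarrow> t \<in> {0..T} \<Longrightarrow> norm (b t x - b s x) \<le> D * \<bar>t - s\<bar>"
      using H1_b_time by blast
    have "\<bar>D\<bar>-lipschitz_on {0..T} (\<lambda>t. b t x)"
    proof (rule lipschitz_onI)
      fix s t assume "s \<in> {0..T}" "t \<in> {0..T}"
      then have "norm (b s x - b t x) \<le> D * \<bar>s - t\<bar>" by (intro D)
      also have "\<dots> \<le> \<bar>D\<bar> * \<bar>s - t\<bar>" by (intro mult_right_mono) auto
      finally show "dist (b s x) (b t x) \<le> \<bar>D\<bar> * dist s t" by (simp add: dist_norm)
    qed simp
    then show ?thesis by (rule lipschitz_on_continuous_on)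
  qed
  \<comment> \<open>The positive exponent required here comes from
    \<open>\<alpha>0 > H - 1/2 > 0\<close>.\<close>
  interpret fbm_sde T K b M H B \<sigma> X Kbar \<alpha>0 C
    by unfold_locales
       (use T H fbm H1_b_lip H1_sigma_inv H1_sigma_hoelder sol C time in auto)
  show ?thesis
    by (rule ex1_invariant_measure[of "Mc * exp (2 * L * T)"]) (use Mc in auto)
qed

end
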